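(* Let $(\xi,\xi';\lambda,\lambda')\in(\mathbb Z/2\mathbb Z)^6\times\mathbb C^6$ with $\xi,\xi'\in(\mathbb Z/2\mathbb Z)^3$ and $\lambda,\lambda'\in\mathbb C^3$. The following conditions are equivalent: (i) $\mathrm{Diff}_G(I(\xi,\lambda),I(\xi',\lambda'))\neq\{0\}$; (ii) $\dim_{\mathbb C}\mathrm{Diff}_G(I(\xi,\lambda),I(\xi',\lambda'))=1$; (iii) $(\xi,\xi';\lambda,\lambda')\in\mathrm{Supp}(\mathcal D)$.
   Context: $\mathbb N_+=\{1,2,\dots\}$. $G=GL(3,\mathbb R)$; $P=MAN_+\subset G$ is the group of invertible upper triangular matrices, $M=\{\mathrm{diag}(\pm1,\pm1,\pm1)\}$, $A$ = positive diagonal matrices, $N_+$ = upper unipotent. For $\xi\in(\mathbb Z/2\mathbb Z)^3,\lambda\in\mathbb C^3$, $I(\xi,\lambda)=\mathrm{Ind}_P^G(\mathbb C_\xi\boxtimes\mathbb C_\lambda)$ is the unnormalized principal series: smooth $f$ on $G$ with $f(gman)=\prod_j m_j^{-\xi_j}\prod_j a_j^{-\lambda_j}f(g)$ for $m=\mathrm{diag}(m_j)\in M$, $a=\mathrm{diag}(a_j)\in A$, $n\in N_+$, with left translation. $\mathrm{Diff}_G(I(\xi,\lambda),I(\xi',\lambda'))$ is the space of $G$-intertwining differential operators $I(\xi,\lambda)\to I(\xi',\lambda')$ (on sections of line bundles over $G/P$). Let $\Lambda_j\subset\mathbb C^6$ ($j=0,\dots,5$) be the set of $(\lambda,\lambda')$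 such that (L$j$) holds: (L0) $\lambda=\lambda'$; (L1) $\lambda_1=\lambda_1'$, $\lambda_2'-\lambda_2\in\mathbb N_+$, $\lambda_2-\lambda_3'=1$, $\lambda_3-\lambda_2'=-1$; (L2) $\lambda_2=\lambda_2'$, $\lambda_3-\lambda_3'\in\mathbb N_+$, $\lambda_1-\lambda_3'=2$, $\lambda_3-\lambda_1'=-2$; (L3) $\lambda_3=\lambda_3'$, $\lambda_1'-\lambda_1\in\mathbb N_+$, $\lambda_2-\lambda_1'=-1$, $\lambda_1-\lambda_2'=1$; (L4) $\lambda_1'-\lambda_1,\lambda_3-\lambda_3'\in\mathbb N_+$, $\lambda_1'-\lambda_3=2$, $\lambda_1-\lambda_3'\neq2$, $(\lambda_2,\lambda_2')=(\lambda_3'+1,\lambda_1-1)$; (L5) $\lambda_1'-\lambda_1,\lambda_3-\lambda_3'\in\mathbb N_+$, $\lambda_1'-\lambda_3\neq2$, $\lambda_1-\lambda_3'=2$, $(\lambda_2,\lambda_2')=(\lambda_1'-1,\lambda_3+1)$. $\mathrm{Supp}(\mathcal D)_j=\{(\xi,\xi';\lambda,\lambda'):(\lambda,\lambda')\in\Lambda_j,\ \xi_k+\xi_k'\equiv\lambda_k'-\lambda_k\bmod2\ (k=1,2,3)\}$ and $\mathrm{Supp}(\mathcal D)=\bigcup_{j=0}^5\mathrm{Supp}(\mathcal D)_j$. *)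

theory Defs
  imports "HOL-Analysis.Analysis" "HOL-Library.Z2" "HOL-Library.Function_Algebras"
begin

type_synonym mat3 = "real^3^3"

definition diag :: "real^3 \<Rightarrow> mat3" where
  "diag v = (\<chi> i j. if i = j then v $ i else 0)"

text \<open>The order on the index type \<open>3\<close> satisfies \<open>3 = 0 < 1 < 2\<close>, so triangular matrices
  are written out entry by entry.\<close>

definition upper_unip :: "mat3 set" where
  "upper_unip = {vector [vector [1, x, y], vector [0, 1, z], vector [0, 0, 1]] | x y z. True}"

definition lower_unip :: "real^3 \<Rightarrow> mat3" where
  "lower_unip x = vector [vector [1, 0, 0], vector [x $ 1, 1, 0], vector [x $ 2, x $ 3, 1]]"

definition GL3 :: "mat3 set" where
  "GL3 = {g. invertible g}"

text \<open>For open \<open>S\<close> and finite-dimensional \<open>'a\<close> this is the usual notion of a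
  \<open>C\<^sup>k\<close> function: all iterated directional derivatives up to order \<open>k\<close> exist
  and are continuous.\<close>

primrec Ck_on :: "nat \<Rightarrow> ('a::real_normed_vector \<Rightarrow> 'b::real_normed_vector) \<Rightarrow> 'a set \<Rightarrow> bool" where
  "Ck_on 0 f S \<longleftrightarrow> continuous_on S f"
| "Ck_on (Suc k) f S \<longleftrightarrow> (\<forall>x\<in>S. f differentiable (at x)) \<and>
     (\<forall>v. Ck_on k (\<lambda>x. frechet_derivative f (at x) v) S)"

definition smooth_on :: "('a::real_normed_vector \<Rightarrow> 'b::real_normed_vector) \<Rightarrow> 'a set \<Rightarrow> bool" where
  "smooth_on f S \<longleftrightarrow> (\<forall>k. Ck_on k f S)"

text \<open>\<open>sign_char e m\<close> is \<open>m\<close> to the power \<open>-e\<close>, for \<open>m\<close> equal to \<open>1\<close> or \<open>-1\<close> and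
  \<open>e\<close> an exponent modulo 2.\<close>

definition sign_char :: "bit \<Rightarrow> real \<Rightarrow> real" where
  "sign_char e m = (if e = 0 then 1 else inverse m)"

text \<open>A function on the group is represented by a total function on all matrices which vanishes
  outside the group, so that HOL equality of representatives is equality on the group.\<close>

definition principal_series :: "bit^3 \<Rightarrow> complex^3 \<Rightarrow> (mat3 \<Rightarrow> complex) set" where
  "principal_series \<xi> \<mu> = {f.
     smooth_on f GL3 \<and> (\<forall>g. g \<notin> GL3 \<longrightarrow> f g = 0) \<and>
     (\<forall>g\<in>GL3. \<forall>m a. \<forall>n\<in>upper_unip.
        (\<forall>j. m $ j = 1 \<or> m $ j = -1) \<longrightarrow> (\<forall>j. a $ j > 0) \<longrightarrow>
        f (g ** diag m ** diag a ** n) =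
          (\<Prod>j\<in>UNIV. complex_of_real (sign_char (\<xi> $ j) (m $ j))) *
          (\<Prod>j\<in>UNIV. complex_of_real (a $ j) powr (- (\<mu> $ j))) * f g)}"

definition left_transl :: "mat3 \<Rightarrow> (mat3 \<Rightarrow> complex) \<Rightarrow> mat3 \<Rightarrow> complex" where
  "left_transl h f = (\<lambda>g. f (matrix_inv h ** g))"

definition partial :: "3 \<Rightarrow> (real^3 \<Rightarrow> complex) \<Rightarrow> real^3 \<Rightarrow> complex" where
  "partial i F = (\<lambda>x. frechet_derivative F (at x) (axis i 1))"

definition multi_partial :: "nat^3 \<Rightarrow> (real^3 \<Rightarrow> complex) \<Rightarrow> real^3 \<Rightarrow> complex" where
  "multi_partial \<alpha> F =
     (partial 1 ^^ (\<alpha> $ 1)) ((partial 2 ^^ (\<alpha> $ 2)) ((partial 3 ^^ (\<alpha> $ 3)) F))"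

definition multi_indices :: "nat \<Rightarrow> (nat^3) set" where
  "multi_indices k = {\<alpha>. (\<Sum>i\<in>UNIV. \<alpha> $ i) \<le> k}"

lemma finite_multi_indices: "finite (multi_indices k)"
proof (rule finite_imageD)
  show "finite ((\<lambda>\<alpha>. (\<alpha> $ 1, \<alpha> $ 2, \<alpha> $ 3)) ` multi_indices k)"
    by (rule finite_subset[of _ "{..k} \<times> {..k} \<times> {..k}"])
       (auto simp: multi_indices_def sum_3)
  show "inj_on (\<lambda>\<alpha>. (\<alpha> $ 1, \<alpha> $ 2, \<alpha> $ 3)) (multi_indices k)"
    by (auto simp: inj_on_def vec_eq_iff forall_3)
qed

text \<open>The maps sending \<open>x\<close> to the class of \<open>g ** lower_unip x\<close>, with \<open>g\<close> in the group, are the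
  inverse charts of an atlas of the flag variety \<open>G/P\<close> by translated big cells, and
  \<open>\<lambda>x. f (g ** lower_unip x)\<close> is the section \<open>f\<close> in the corresponding trivialization of the
  line bundle. A differential operator has to be given, in each of these charts, by
  a linear partial differential operator with smooth coefficients; as every group element
  lies in some chart, this implies complex linearity. The order may be taken constant on each
  chart because \<open>G/P\<close> is compact.\<close>

definition differential_operator ::
  "(mat3 \<Rightarrow> complex) set \<Rightarrow> ((mat3 \<Rightarrow> complex) \<Rightarrow> mat3 \<Rightarrow> complex) \<Rightarrow> bool" where
  "differential_operator V D \<longleftrightarrow>
     (\<forall>g\<in>GL3. \<exists>k c. (\<forall>\<alpha>. smooth_on (c \<alpha>) UNIV) \<and>
        (\<forall>f\<in>V. \<forall>x. D f (g ** lower_unip x) =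
           (\<Sum>\<alpha>\<in>multi_indices k.
              c \<alpha> x * multi_partial \<alpha> (\<lambda>y. f (g ** lower_unip y)) x)))"

text \<open>An operator is represented by a total function which is \<open>0\<close> outside its domain, so that
  HOL equality is equality of operators.\<close>

definition Diff_G ::
  "bit^3 \<Rightarrow> complex^3 \<Rightarrow> bit^3 \<Rightarrow> complex^3 \<Rightarrow> ((mat3 \<Rightarrow> complex) \<Rightarrow> mat3 \<Rightarrow> complex) set" where
  "Diff_G \<xi> \<mu> \<xi>' \<mu>' = {D.
     (\<forall>f\<in>principal_series \<xi> \<mu>. D f \<in> principal_series \<xi>' \<mu>') \<and>
     (\<forall>f. f \<notin> principal_series \<xi> \<mu> \<longrightarrow> D f = 0) \<and>
     differential_operator (principal_series \<xi> \<mu>) D \<and>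
     (\<forall>h\<in>GL3. \<forall>f\<in>principal_series \<xi> \<mu>. D (left_transl h f) = left_transl h (D f))}"

definition op_scale ::
  "complex \<Rightarrow> ((mat3 \<Rightarrow> complex) \<Rightarrow> mat3 \<Rightarrow> complex) \<Rightarrow> (mat3 \<Rightarrow> complex) \<Rightarrow> mat3 \<Rightarrow> complex" where
  "op_scale c D = (\<lambda>f g. c * D f g)"

lemma vector_space_op_scale: "vector_space op_scale"
  by unfold_locales (auto simp: op_scale_def fun_eq_iff algebra_simps)

definition pos_nats :: "complex set" where
  "pos_nats = of_nat ` {n. n \<ge> 1}"

definition Lambda :: "nat \<Rightarrow> ((complex^3) \<times> (complex^3)) set" where
  "Lambda j = {(\<mu>, \<mu>').
     (j = 0 \<and> \<mu> = \<mu>') \<or>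
     (j = 1 \<and> \<mu>$1 = \<mu>'$1 \<and> \<mu>'$2 - \<mu>$2 \<in> pos_nats \<and> \<mu>$2 - \<mu>'$3 = 1 \<and> \<mu>$3 - \<mu>'$2 = -1) \<or>
     (j = 2 \<and> \<mu>$2 = \<mu>'$2 \<and> \<mu>$3 - \<mu>'$3 \<in> pos_nats \<and> \<mu>$1 - \<mu>'$3 = 2 \<and> \<mu>$3 - \<mu>'$1 = -2) \<or>
     (j = 3 \<and> \<mu>$3 = \<mu>'$3 \<and> \<mu>'$1 - \<mu>$1 \<in> pos_nats \<and> \<mu>$2 - \<mu>'$1 = -1 \<and> \<mu>$1 - \<mu>'$2 = 1) \<or>
     (j = 4 \<and> \<mu>'$1 - \<mu>$1 \<in> pos_nats \<and> \<mu>$3 - \<mu>'$3 \<in> pos_nats \<and>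
        \<mu>'$1 - \<mu>$3 = 2 \<and> \<mu>$1 - \<mu>'$3 \<noteq> 2 \<and> \<mu>$2 = \<mu>'$3 + 1 \<and> \<mu>'$2 = \<mu>$1 - 1) \<or>
     (j = 5 \<and> \<mu>'$1 - \<mu>$1 \<in> pos_nats \<and> \<mu>$3 - \<mu>'$3 \<in> pos_nats \<and>
        \<mu>'$1 - \<mu>$3 \<noteq> 2 \<and> \<mu>$1 - \<mu>'$3 = 2 \<and> \<mu>$2 = \<mu>'$1 - 1 \<and> \<mu>'$2 = \<mu>$3 + 1)}"

text \<open>The parity condition includes that the complex number \<open>\<mu>' $ k - \<mu> $ k\<close> is an integer;
  the right-hand \<open>of_int n\<close> is the residue of \<open>n\<close> modulo 2.\<close>

definition Supp_D_part :: "nat \<Rightarrow> ((bit^3) \<times> (bit^3) \<times> (complex^3) \<times> (complex^3)) set" where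
  "Supp_D_part j = {(\<xi>, \<xi>', \<mu>, \<mu>'). (\<mu>, \<mu>') \<in> Lambda j \<and>
     (\<forall>k. \<exists>n::int. \<mu>' $ k - \<mu> $ k = of_int n \<and> \<xi> $ k + \<xi>' $ k = of_int n)}"

definition Supp_D :: "((bit^3) \<times> (bit^3) \<times> (complex^3) \<times> (complex^3)) set" where
  "Supp_D = (\<Union>j\<in>{0..5}. Supp_D_part j)"

end

theory Submission imports Defs begin

text \<open>An intertwining differential operator commutes with left translations, so it is determined by
  its value at the identity: it has the form \<open>f \<mapsto> u f\<close>, where \<open>u\<close> is an element of the enveloping
  algebra of the lower triangular nilpotent matrices acting by left invariant vector fields. The
  operators thus correspond to the highest weight vectors in a Verma module of \<open>gl\<^sub>3\<close>, and the theorem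
  is the explicit form of the classification of homomorphisms between such modules by strong linkage,
  together with a parity condition from the finite group of sign matrices. For \<open>gl\<^sub>3\<close> the highest
  weight vectors can be computed directly.

  The passage to the enveloping algebra rests on three facts. Commutators of the operators \<open>rd X\<close>
  come from commutators of matrices (\<open>rd_commutator\<close>), by the symmetry of second derivatives. In the
  coordinates of the big cell the ordered monomials \<open>lowering a b c\<close> are differential operators with
  polynomial coefficients, and at the origin they are the partial derivatives (\<open>chart_lowering\<close>,
  \<open>multi_partial_zero\<close>). Finally the principal series contains functions with enough jets at the
  identity to separate these monomials (\<open>exists_test_function\<close>, \<open>lowering_independent\<close>), so equations
  between operators become equations between coefficients.

  Equivariance under diagonal matrices forces \<open>\<mu>' = \<mu> + (p, q - p, - q)\<close> with natural numbers \<open>p\<close>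
  and \<open>q\<close>, fixes the parities, and leaves the operators
  \<open>\<Sum>\<^sub>b e\<^sub>b E\<^sub>2\<^sub>1\<^bsup>p-b\<^esup> E\<^sub>3\<^sub>1\<^bsup>b\<^esup> E\<^sub>3\<^sub>2\<^bsup>q-b\<^esup>\<close>, called \<open>root_op\<close>. Invariance under the upper unipotent matrices
  means that \<open>E\<^sub>1\<^sub>2\<close> and \<open>E\<^sub>2\<^sub>3\<close> annihilate the result. Each of them gives a two-term recursion for
  \<open>e\<close> (\<open>singular\<close>). One recursion determines \<open>e\<close> from \<open>e 0\<close>, which bounds the dimension by one;
  their compatibility is an elementary condition on \<open>p\<close>, \<open>q\<close> and the highest weight (\<open>linked\<close>),
  whose cases are the sets \<open>Lambda j\<close>.\<close>

section \<open>Calculus of smooth functions\<close>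

lemma has_derivative_frechet:
  "f differentiable (at x) \<Longrightarrow> (f has_derivative frechet_derivative f (at x)) (at x)"
  by (simp add: frechet_derivative_works)

lemma frechet_derivative_eq:
  "(f has_derivative f') (at x) \<Longrightarrow> frechet_derivative f (at x) v = f' v"
  by (simp add: frechet_derivative_at[symmetric])

lemma Ck_on_cong:
  assumes "open S" "\<And>x. x \<in> S \<Longrightarrow> f x = g x" "Ck_on k f S"
  shows "Ck_on k g S"
  using assms(2,3)
proof (induction k arbitrary: f g)
  case 0
  then show ?case by (simp cong: continuous_on_cong)
next
  case (Suc k)
  have hd: "(g has_derivative frechet_derivative f (at x)) (at x)" if "x \<in> S" for x
  proof (rule has_derivative_transform_within_open[OF _ assms(1) that])
    show "(f has_derivative frechet_derivative f (at x)) (at x)"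
      using Suc.prems(2) that by (simp add: has_derivative_frechet)
  qed (rule Suc.prems(1))
  have "Ck_on k (\<lambda>x. frechet_derivative g (at x) v) S" for v
  proof (rule Suc.IH)
    show "frechet_derivative f (at x) v = frechet_derivative g (at x) v" if "x \<in> S" for x
      by (rule frechet_derivative_eq[OF hd[OF that], symmetric])
    show "Ck_on k (\<lambda>x. frechet_derivative f (at x) v) S" using Suc.prems(2) by simp
  qed
  then show ?case using hd by (auto simp: differentiable_def)
qed

lemma smooth_on_cong:
  assumes "open S" "\<And>x. x \<in> S \<Longrightarrow> f x = g x" "smooth_on f S"
  shows "smooth_on g S"
  using assms(3) Ck_on_cong[OF assms(1,2)] by (simp add: smooth_on_def)

lemma Ck_on_Suc_imp: "Ck_on (Suc k) f S \<Longrightarrow> Ck_on k f S"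
proof (induction k arbitrary: f)
  case 0
  then have "f differentiable_on S"
    by (auto simp: differentiable_on_def intro: differentiable_at_withinI)
  then show ?case by (simp add: differentiable_imp_continuous_on)
next
  case (Suc k)
  have "Ck_on k (\<lambda>x. frechet_derivative f (at x) v) S" for v
  proof (rule Suc.IH)
    show "Ck_on (Suc k) (\<lambda>x. frechet_derivative f (at x) v) S"
      using iffD1[OF Ck_on.simps(2) Suc.prems] by (elim conjE) (erule spec)
  qed
  then show ?case using Suc.prems by simp
qed

lemma smooth_on_frechet:
  "smooth_on f S \<Longrightarrow> smooth_on (\<lambda>x. frechet_derivative f (at x) v) S"
  unfolding smooth_on_def
proof
  fix k assume "\<forall>k. Ck_on k f S"
  then have "Ck_on (Suc k) f S" by blast
  then show "Ck_on k (\<lambda>x. frechet_derivative f (at x) v) S" by simp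
qed

lemma smooth_on_differentiable:
  assumes "smooth_on f S" "x \<in> S"
  shows "f differentiable (at x)"
proof -
  have "Ck_on (Suc 0) f S" using assms(1) unfolding smooth_on_def by blast
  then show ?thesis using assms(2) by simp
qed

lemma smooth_on_has_derivative:
  "smooth_on f S \<Longrightarrow> x \<in> S \<Longrightarrow> (f has_derivative frechet_derivative f (at x)) (at x)"
  by (simp add: has_derivative_frechet smooth_on_differentiable)

lemma smooth_on_continuous:
  assumes "smooth_on f S"
  shows "continuous_on S f"
proof -
  have "Ck_on 0 f S" using assms unfolding smooth_on_def by blast
  then show ?thesis by simp
qed

lemma Ck_on_const: "Ck_on k (\<lambda>x. c) S"
  by (induction k arbitrary: c) auto

lemma smooth_on_const [simp]: "smooth_on (\<lambda>x. c) S"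
  by (simp add: smooth_on_def Ck_on_const)

lemma smooth_on_bounded_linear:
  assumes "bounded_linear f"
  shows "smooth_on f S"
proof -
  have d: "(f has_derivative f) (at x)" for x
    using assms by (rule bounded_linear_imp_has_derivative)
  have "Ck_on k f S" for k
  proof (cases k)
    case 0
    then show ?thesis by (simp add: linear_continuous_on[OF assms])
  next
    case (Suc l)
    have "f differentiable (at x)" for x using d unfolding differentiable_def by blast
    then show ?thesis by (simp add: Suc frechet_derivative_eq[OF d] Ck_on_const)
  qed
  then show ?thesis by (simp add: smooth_on_def)
qed

lemma frechet_derivative_add:
  "f differentiable (at x) \<Longrightarrow> g differentiable (at x) \<Longrightarrow>
   frechet_derivative (\<lambda>x. f x + g x) (at x) v = frechet_derivative f (at x) v + frechet_derivative g (at x) v"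
  by (rule frechet_derivative_eq[OF has_derivative_add]) (rule has_derivative_frechet, assumption)+

lemma frechet_derivative_mult:
  fixes f g :: "'a::real_normed_vector \<Rightarrow> 'b::real_normed_algebra"
  shows "f differentiable (at x) \<Longrightarrow> g differentiable (at x) \<Longrightarrow>
   frechet_derivative (\<lambda>x. f x * g x) (at x) v = f x * frechet_derivative g (at x) v + frechet_derivative f (at x) v * g x"
  by (rule frechet_derivative_eq[OF has_derivative_mult]) (rule has_derivative_frechet, assumption)+

lemma Ck_on_add:
  assumes "open S"
  shows "Ck_on k f S \<Longrightarrow> Ck_on k g S \<Longrightarrow> Ck_on k (\<lambda>x. f x + g x) S"
proof (induction k arbitrary: f g)
  case 0
  then show ?case by (auto intro: continuous_on_add)
next
  case (Suc k)
  have "Ck_on k (\<lambda>x. frechet_derivative (\<lambda>x. f x + g x) (at x) v) S" for v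
  proof (rule Ck_on_cong[OF assms])
    show "Ck_on k (\<lambda>x. frechet_derivative f (at x) v + frechet_derivative g (at x) v) S"
      by (rule Suc.IH) (use Suc.prems in simp_all)
    show "frechet_derivative f (at x) v + frechet_derivative g (at x) v
        = frechet_derivative (\<lambda>x. f x + g x) (at x) v" if "x \<in> S" for x
      using Suc.prems that by (simp add: frechet_derivative_add)
  qed
  then show ?case using Suc.prems by auto
qed

lemma Ck_on_mult:
  fixes f g :: "'a::real_normed_vector \<Rightarrow> 'b::real_normed_algebra"
  assumes "open S"
  shows "Ck_on k f S \<Longrightarrow> Ck_on k g S \<Longrightarrow> Ck_on k (\<lambda>x. f x * g x) S"
proof (induction k arbitrary: f g)
  case 0
  then show ?case by (auto intro: continuous_on_mult)
next
  case (Suc k)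
  have "Ck_on k (\<lambda>x. frechet_derivative (\<lambda>x. f x * g x) (at x) v) S" for v
  proof (rule Ck_on_cong[OF assms])
    show "Ck_on k (\<lambda>x. f x * frechet_derivative g (at x) v + frechet_derivative f (at x) v * g x) S"
      by (rule Ck_on_add[OF assms]; rule Suc.IH)
        (use Suc.prems Suc.prems[THEN Ck_on_Suc_imp] in simp_all)
    show "f x * frechet_derivative g (at x) v + frechet_derivative f (at x) v * g x
        = frechet_derivative (\<lambda>x. f x * g x) (at x) v" if "x \<in> S" for x
      using Suc.prems that by (simp add: frechet_derivative_mult)
  qed
  then show ?case using Suc.prems by auto
qed

lemma smooth_on_add:
  "open S \<Longrightarrow> smooth_on f S \<Longrightarrow> smooth_on g S \<Longrightarrow> smooth_on (\<lambda>x. f x + g x) S"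
  by (simp add: smooth_on_def Ck_on_add)

lemma smooth_on_mult:
  fixes f g :: "'a::real_normed_vector \<Rightarrow> 'b::real_normed_algebra"
  shows "open S \<Longrightarrow> smooth_on f S \<Longrightarrow> smooth_on g S \<Longrightarrow> smooth_on (\<lambda>x. f x * g x) S"
  by (simp add: smooth_on_def Ck_on_mult)

lemma smooth_on_sum:
  "open S \<Longrightarrow> (\<And>i. i \<in> I \<Longrightarrow> smooth_on (f i) S) \<Longrightarrow> smooth_on (\<lambda>x. \<Sum>i\<in>I. f i x) S"
  by (induction I rule: infinite_finite_induct) (auto intro: smooth_on_add)

lemma smooth_on_power:
  fixes f :: "'a::real_normed_vector \<Rightarrow> 'b::{real_normed_algebra_1}"
  shows "open S \<Longrightarrow> smooth_on f S \<Longrightarrow> smooth_on (\<lambda>x. f x ^ n) S"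
  by (induction n) (auto intro: smooth_on_mult)

lemma smooth_on_compose_affine:
  assumes L: "bounded_linear L" and S: "open S" and T: "\<And>x. x \<in> S \<Longrightarrow> a + L x \<in> T" and f: "smooth_on f T"
  shows "smooth_on (\<lambda>x. f (a + L x)) S"
proof -
  have "Ck_on k (\<lambda>x. f (a + L x)) S" if "Ck_on k f T" for k f
    using that
  proof (induction k arbitrary: f)
    case 0
    then show ?case
      using T by (auto intro!: continuous_on_compose2[OF _ continuous_on_add[OF continuous_on_const linear_continuous_on[OF L]]])
  next
    case (Suc k)
    have hd: "((\<lambda>x. f (a + L x)) has_derivative (\<lambda>v. frechet_derivative f (at (a + L x)) (L v))) (at x)"
      if "x \<in> S" for x
    proof -
      have "((\<lambda>x. a + L x) has_derivative L) (at x)"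
        using has_derivative_add[OF has_derivative_const bounded_linear_imp_has_derivative[OF L]] by simp
      moreover have "(f has_derivative frechet_derivative f (at (a + L x))) (at (a + L x))"
        using Suc.prems T[OF that] by (auto intro: has_derivative_frechet)
      ultimately show ?thesis by (rule has_derivative_compose)
    qed
    have e: "frechet_derivative (\<lambda>x. f (a + L x)) (at x) v = frechet_derivative f (at (a + L x)) (L v)"
      if "x \<in> S" for x v
      by (rule frechet_derivative_eq[OF hd[OF that]])
    have "Ck_on k (\<lambda>x. frechet_derivative (\<lambda>x. f (a + L x)) (at x) v) S" for v
    proof (rule Ck_on_cong[OF S])
      show "Ck_on k (\<lambda>x. frechet_derivative f (at (a + L x)) (L v)) S"
        by (rule Suc.IH[of "\<lambda>y. frechet_derivative f (at y) (L v)"]) (use Suc.prems in simp)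
    qed (simp add: e)
    then show ?case using hd by (auto simp: differentiable_def)
  qed
  then show ?thesis using f unfolding smooth_on_def by blast
qed

text \<open>The derivative of a complex power of \<open>q\<close> is a power with a different exponent times a
  derivative of \<open>q\<close>, so the induction on the order has to run over all exponents at once.\<close>

lemma smooth_on_powr:
  fixes q :: "'a::real_normed_vector \<Rightarrow> complex"
  assumes S: "open S" and q: "smooth_on q S" and nz: "\<And>x. x \<in> S \<Longrightarrow> q x \<notin> \<real>\<^sub>\<le>\<^sub>0"
  shows "smooth_on (\<lambda>x. q x powr s) S"
proof -
  have hd: "((\<lambda>x. q x powr s) has_derivative (\<lambda>v. s * q x powr (s - 1) * frechet_derivative q (at x) v)) (at x)"
    if "x \<in> S" for x s
    using has_derivative_compose[OF smooth_on_has_derivative[OF q that],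
        OF has_field_derivative_powr[OF nz[OF that], unfolded has_field_derivative_def]]
    by (simp add: mult.assoc)
  have "Ck_on k (\<lambda>x. q x powr s) S" for k
  proof (induction k arbitrary: s)
    case 0
    have "isCont (\<lambda>x. q x powr s) x" if "x \<in> S" for x
      using has_derivative_continuous[OF hd[OF that]] .
    then show ?case by (simp add: continuous_at_imp_continuous_on)
  next
    case (Suc k)
    have e: "frechet_derivative (\<lambda>x. q x powr s) (at x) v = s * q x powr (s - 1) * frechet_derivative q (at x) v"
      if "x \<in> S" for x v
      by (rule frechet_derivative_eq[OF hd[OF that]])
    have "Ck_on k (\<lambda>x. frechet_derivative q (at x) v) S" for v
      using smooth_on_frechet[OF q] by (simp add: smooth_on_def)
    then have m: "Ck_on k (\<lambda>x. s * q x powr (s - 1) * frechet_derivative q (at x) v) S" for v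
      by (rule Ck_on_mult[OF S Ck_on_mult[OF S Ck_on_const Suc]])
    have "Ck_on k (\<lambda>x. frechet_derivative (\<lambda>x. q x powr s) (at x) v) S" for v
      by (rule Ck_on_cong[OF S _ m[of v]]) (simp add: e)
    moreover have "(\<lambda>x. q x powr s) differentiable (at x)" if "x \<in> S" for x
      using hd[OF that] unfolding differentiable_def by blast
    ultimately show ?case by simp
  qed
  then show ?thesis unfolding smooth_on_def by blast
qed

text \<open>Both iterated derivatives are limits of the same second difference quotient.\<close>

lemma frechet_derivative_commute:
  fixes f :: "'a::real_normed_vector \<Rightarrow> complex"
  assumes S: "open S" and f: "smooth_on f S" and x: "x \<in> S"
  shows "frechet_derivative (\<lambda>y. frechet_derivative f (at y) v) (at x) u =
         frechet_derivative (\<lambda>y. frechet_derivative f (at y) u) (at x) v"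
proof -
  \<comment> \<open>The second difference is symmetric in \<open>u\<close> and \<open>v\<close>; two applications of the mean value theorem
    compare it with the derivative taken first along \<open>v\<close> and then along \<open>u\<close>.\<close>
  define \<Delta> where "\<Delta> u v h = f (x + h *\<^sub>R u + h *\<^sub>R v) - f (x + h *\<^sub>R u) - (f (x + h *\<^sub>R v) - f x)" for u v and h :: real
  define G where "G u v y = frechet_derivative (\<lambda>y. frechet_derivative f (at y) v) (at y) u" for u v y
  have line: "((\<lambda>s. g (a + s *\<^sub>R w)) has_derivative (\<lambda>r. r *\<^sub>R frechet_derivative g (at (a + s *\<^sub>R w)) w)) (at s)"
    if "smooth_on g S" "a + s *\<^sub>R w \<in> S" for g :: "'a \<Rightarrow> complex" and a w s
  proof -
    have l: "((\<lambda>s. a + s *\<^sub>R w) has_derivative (\<lambda>r. r *\<^sub>R w)) (at s)"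
      by (auto intro!: derivative_eq_intros)
    have lin: "linear (frechet_derivative g (at (a + s *\<^sub>R w)))"
      using smooth_on_differentiable[OF that] by (rule linear_frechet_derivative)
    show ?thesis
      using has_derivative_compose[OF l smooth_on_has_derivative[OF that]]
      by (simp add: linear_scale[OF lin])
  qed
  have bound: "\<exists>d>0. \<forall>h. 0 < h \<and> h < d \<longrightarrow> norm (\<Delta> u v h - (h * h) *\<^sub>R G u v x) \<le> e * h * h"
    if e: "e > 0" for u v e
  proof -
    have sv: "smooth_on (\<lambda>y. frechet_derivative f (at y) v) S" using smooth_on_frechet[OF f] .
    have "continuous_on S (G u v)"
      unfolding G_def using smooth_on_continuous smooth_on_frechet f by blast
    then have "isCont (G u v) x" using S x by (simp add: continuous_on_eq_continuous_at)
    then obtain r1 where r1: "r1 > 0" "\<And>y. dist y x < r1 \<Longrightarrow> dist (G u v y) (G u v x) < e"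
      using e unfolding continuous_at_eps_delta by blast
    obtain r2 where r2: "r2 > 0" "ball x r2 \<subseteq> S" using S x openE by blast
    define r where "r = min r1 r2"
    define d where "d = r / (norm u + norm v + 1)"
    have r0: "r > 0" using r1 r2 by (simp add: r_def)
    have nn: "norm u + norm v + 1 > 0" using norm_ge_zero[of u] norm_ge_zero[of v] by linarith
    have d0: "d > 0" using r0 nn by (simp add: d_def)
    have close: "dist (x + s *\<^sub>R u + t *\<^sub>R v) x < r"
      if "0 \<le> s" "s \<le> h" "0 \<le> t" "t \<le> h" "h < d" for s t h
    proof -
      have "norm (s *\<^sub>R u + t *\<^sub>R v) \<le> s * norm u + t * norm v"
        using norm_triangle_ineq[of "s *\<^sub>R u" "t *\<^sub>R v"] that by simp
      also have "\<dots> \<le> h * norm u + h * norm v"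
        using that by (intro add_mono mult_right_mono) auto
      also have "\<dots> \<le> h * (norm u + norm v + 1)" using that by (simp add: algebra_simps)
      also have "\<dots> < r" using that nn by (simp add: d_def field_simps)
      finally show ?thesis by (simp add: dist_norm add.assoc)
    qed
    have inS: "x + s *\<^sub>R u + t *\<^sub>R v \<in> S"
      if "0 \<le> s" "s \<le> h" "0 \<le> t" "t \<le> h" "h < d" for s t h
      using close[OF that] r2 by (auto simp: r_def dist_commute subset_eq)
    have "norm (\<Delta> u v h - (h * h) *\<^sub>R G u v x) \<le> e * h * h" if h: "0 < h" "h < d" for h
    proof -
      define A where "A = G u v x"
      have inner: "norm (frechet_derivative f (at (x + h *\<^sub>R u + t *\<^sub>R v)) v
          - frechet_derivative f (at (x + t *\<^sub>R v)) v - h *\<^sub>R A) \<le> e * h" if t: "0 \<le> t" "t \<le> h" for t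
      proof -
        let ?g = "\<lambda>s. frechet_derivative f (at (x + t *\<^sub>R v + s *\<^sub>R u)) v - s *\<^sub>R A"
        have dv: "(?g has_derivative (\<lambda>r. r *\<^sub>R (G u v (x + t *\<^sub>R v + s *\<^sub>R u) - A))) (at s)"
          if s: "0 \<le> s" "s \<le> h" for s
        proof -
          have "x + t *\<^sub>R v + s *\<^sub>R u \<in> S" using inS[OF s t h(2)] by (simp add: algebra_simps)
          from line[OF sv this] show ?thesis
            unfolding G_def by (auto intro!: derivative_eq_intros simp: algebra_simps)
        qed
        have "continuous_on {0..h} ?g"
          using has_derivative_continuous[OF dv] by (intro continuous_at_imp_continuous_on) simp
        from mvt_general[OF h(1) this, of "\<lambda>s r. r *\<^sub>R (G u v (x + t *\<^sub>R v + s *\<^sub>R u) - A)"] dv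
        obtain s where s: "s \<in> {0<..<h}"
          "norm (?g h - ?g 0) \<le> norm ((h - 0) *\<^sub>R (G u v (x + t *\<^sub>R v + s *\<^sub>R u) - A))"
          by force
        have "dist (x + t *\<^sub>R v + s *\<^sub>R u) x < r1"
          using close[of s h t] s t h by (auto simp: r_def algebra_simps)
        from r1(2)[OF this] have "norm (G u v (x + t *\<^sub>R v + s *\<^sub>R u) - A) \<le> e"
          by (simp add: A_def dist_norm)
        then have "norm ((h - 0) *\<^sub>R (G u v (x + t *\<^sub>R v + s *\<^sub>R u) - A)) \<le> e * h"
          using h by (simp add: mult.commute[of e])
        with s(2) show ?thesis by (simp add: algebra_simps)
      qed
      let ?k = "\<lambda>t. f (x + h *\<^sub>R u + t *\<^sub>R v) - f (x + t *\<^sub>R v) - (t * h) *\<^sub>R A"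
      let ?k' = "\<lambda>t r. r *\<^sub>R (frechet_derivative f (at (x + h *\<^sub>R u + t *\<^sub>R v)) v
          - frechet_derivative f (at (x + t *\<^sub>R v)) v - h *\<^sub>R A)"
      have dv: "(?k has_derivative ?k' t) (at t)" if t: "0 \<le> t" "t \<le> h" for t
      proof -
        have s1: "x + h *\<^sub>R u + t *\<^sub>R v \<in> S" using inS[of h h t] t h by auto
        have s2: "x + t *\<^sub>R v \<in> S" using inS[of 0 h t] t h by auto
        have lin: "((\<lambda>t. (t * h) *\<^sub>R A) has_derivative (\<lambda>r. (r * h) *\<^sub>R A)) (at t)"
          by (auto intro!: derivative_eq_intros)
        show ?thesis
          by (rule has_derivative_eq_rhs[OF has_derivative_diff[OF
                has_derivative_diff[OF line[OF f s1] line[OF f s2]] lin]])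
             (simp add: fun_eq_iff algebra_simps)
      qed
      have "continuous_on {0..h} ?k"
        using has_derivative_continuous[OF dv] by (intro continuous_at_imp_continuous_on) simp
      from mvt_general[OF h(1) this, of ?k'] dv
      obtain t where t: "t \<in> {0<..<h}" "norm (?k h - ?k 0) \<le> norm (?k' t (h - 0))"
        by force
      have "norm (?k' t (h - 0)) \<le> h * (e * h)"
        using inner[of t] t h by simp
      with t(2) show ?thesis by (simp add: \<Delta>_def A_def algebra_simps)
    qed
    then show ?thesis using d0 by blast
  qed
  have "norm (G u v x - G v u x) \<le> e" if e: "e > 0" for e
  proof -
    obtain d1 where d1: "d1 > 0" "\<And>h. 0 < h \<Longrightarrow> h < d1 \<Longrightarrow> norm (\<Delta> u v h - (h * h) *\<^sub>R G u v x) \<le> e / 2 * h * h"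
      using bound[of "e/2" u v] e by auto
    obtain d2 where d2: "d2 > 0" "\<And>h. 0 < h \<Longrightarrow> h < d2 \<Longrightarrow> norm (\<Delta> v u h - (h * h) *\<^sub>R G v u x) \<le> e / 2 * h * h"
      using bound[of "e/2" v u] e by auto
    define h where "h = min d1 d2 / 2"
    have h: "0 < h" "h < d1" "h < d2" using d1(1) d2(1) by (auto simp: h_def)
    have sym: "\<Delta> v u h = \<Delta> u v h" by (simp add: \<Delta>_def algebra_simps)
    have "norm ((h * h) *\<^sub>R (G u v x - G v u x)) =
        norm ((\<Delta> v u h - (h * h) *\<^sub>R G v u x) - (\<Delta> u v h - (h * h) *\<^sub>R G u v x))"
      by (simp add: sym algebra_simps)
    also have "\<dots> \<le> e / 2 * h * h + e / 2 * h * h"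
      by (rule order_trans[OF norm_triangle_ineq4 add_mono[OF d2(2)[OF h(1,3)] d1(2)[OF h(1,2)]]])
    finally have "(h * h) * norm (G u v x - G v u x) \<le> (h * h) * e"
      unfolding norm_scaleR using h(1) by (simp add: algebra_simps abs_mult)
    then show ?thesis using h(1) by (simp add: mult_le_cancel_left_pos)
  qed
  then have "norm (G u v x - G v u x) \<le> 0" by (rule field_le_epsilon) auto
  then show ?thesis by (simp add: G_def)
qed

section \<open>Left invariant vector fields on the general linear group\<close>

lemma GL3_det: "g \<in> GL3 \<longleftrightarrow> det g \<noteq> 0"
  by (simp add: GL3_def invertible_det_nz)

lemma open_GL3: "open GL3"
proof -
  have "GL3 = {g. det g \<noteq> 0}" by (auto simp: GL3_det)
  moreover have "open {g::mat3. det g \<noteq> 0}"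
    unfolding det_3 by (intro open_Collect_neq continuous_intros)
  ultimately show ?thesis by simp
qed

lemma GL3_mult [simp]: "g ** h \<in> GL3 \<longleftrightarrow> g \<in> GL3 \<and> h \<in> GL3"
  by (simp add: GL3_det det_mul)

lemma GL3_one [simp]: "mat 1 \<in> GL3"
  by (simp add: GL3_det)

lemma matrix_inv_mult:
  assumes "g \<in> GL3"
  shows "g ** matrix_inv g = mat 1" "matrix_inv g ** g = mat 1"
  using assms someI_ex[of "\<lambda>A'. g ** A' = mat 1 \<and> A' ** g = mat 1"]
  by (auto simp: GL3_def invertible_def matrix_inv_def)

lemma matrix_inv_GL3 [simp]: "g \<in> GL3 \<Longrightarrow> matrix_inv g \<in> GL3"
  using matrix_inv_mult[of g] GL3_mult GL3_one by metis

lemma bounded_linear_mult_right: "bounded_linear (\<lambda>g::mat3. g ** X)"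
  unfolding linear_conv_bounded_linear[symmetric]
  by (rule linearI)
     (simp_all add: vec_eq_iff matrix_matrix_mult_def sum_3 algebra_simps)

lemma bounded_linear_mult_left: "bounded_linear (\<lambda>g::mat3. X ** g)"
  unfolding linear_conv_bounded_linear[symmetric]
  by (rule linearI)
     (simp_all add: vec_eq_iff matrix_matrix_mult_def sum_3 algebra_simps)

lemmas mult_right_scaleR = linear_scale[OF bounded_linear.linear[OF bounded_linear_mult_left]]

definition E :: "3 \<Rightarrow> 3 \<Rightarrow> mat3" where
  "E i j = axis i (axis j 1)"

lemma E_nth: "E i j $ k $ l = (if k = i \<and> l = j then 1 else 0)"
  by (simp add: E_def axis_def)

lemma E_mult: "E i j ** E k l = (if j = k then E i l else 0)"
proof -
  have "j = 1 \<or> j = 2 \<or> j = 3" by (rule exhaust_3)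
  then show ?thesis
    by (auto simp: vec_eq_iff E_nth matrix_matrix_mult_def sum_3)
qed

lemma matrix_expand: "(W::mat3) = (\<Sum>i\<in>UNIV. \<Sum>j\<in>UNIV. (W $ i $ j) *\<^sub>R E i j)"
  by (simp add: vec_eq_iff forall_3 sum_3 E_nth)

lemma frechet_derivative_expand:
  fixes f :: "mat3 \<Rightarrow> complex"
  assumes "f differentiable (at g)"
  shows "frechet_derivative f (at g) W =
    (\<Sum>i\<in>UNIV. \<Sum>j\<in>UNIV. of_real (W $ i $ j) * frechet_derivative f (at g) (E i j))"
proof -
  have lin: "linear (frechet_derivative f (at g))"
    using assms by (rule linear_frechet_derivative)
  show ?thesis
    by (subst matrix_expand[of W])
       (simp add: linear_sum[OF lin] linear_scale[OF lin] scaleR_conv_of_real[where 'a=complex])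
qed

text \<open>The derivative of the right translation action: \<open>rd X f\<close> is the derivative of \<open>f\<close> along the
  left invariant vector field given by \<open>X\<close>. Values outside the group are set to zero, so that
  identities between iterated derivatives are equations between functions.\<close>

definition rd :: "mat3 \<Rightarrow> (mat3 \<Rightarrow> complex) \<Rightarrow> mat3 \<Rightarrow> complex" where
  "rd X f = (\<lambda>g. if g \<in> GL3 then frechet_derivative f (at g) (g ** X) else 0)"

lemma rd_outside: "g \<notin> GL3 \<Longrightarrow> rd X f g = 0"
  by (simp add: rd_def)

lemma smooth_on_entry: "smooth_on (\<lambda>g::mat3. complex_of_real ((g ** Y) $ i $ j)) S"
proof (rule smooth_on_bounded_linear)
  have "bounded_linear (\<lambda>g::mat3. (g ** Y) $ i)"
    using bounded_linear_compose[OF bounded_linear_vec_nth bounded_linear_mult_right] .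
  then show "bounded_linear (\<lambda>g::mat3. complex_of_real ((g ** Y) $ i $ j))"
    using bounded_linear_compose[OF bounded_linear_of_real
       bounded_linear_compose[OF bounded_linear_vec_nth]] by blast
qed

lemma smooth_rd:
  assumes "smooth_on f GL3"
  shows "smooth_on (rd X f) GL3"
proof (rule smooth_on_cong[OF open_GL3])
  show "smooth_on (\<lambda>g. \<Sum>i\<in>UNIV. \<Sum>j\<in>UNIV.
      of_real ((g ** X) $ i $ j) * frechet_derivative f (at g) (E i j)) GL3"
    by (intro smooth_on_sum smooth_on_mult open_GL3 smooth_on_entry smooth_on_frechet assms)
  show "(\<Sum>i\<in>UNIV. \<Sum>j\<in>UNIV.
      of_real ((g ** X) $ i $ j) * frechet_derivative f (at g) (E i j)) = rd X f g"
    if "g \<in> GL3" for g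
    using frechet_derivative_expand[OF smooth_on_differentiable[OF assms that], of "g ** X"] that
    by (simp only: rd_def if_True)
qed

lemma smooth_rd_power: "smooth_on f GL3 \<Longrightarrow> smooth_on ((rd X ^^ n) f) GL3"
  by (induction n) (auto intro: smooth_rd)

lemma rd_add_vec:
  assumes "smooth_on f GL3"
  shows "rd (X + Y) f g = rd X f g + rd Y f g"
  using linear_add[OF linear_frechet_derivative[OF smooth_on_differentiable[OF assms]]]
  by (simp add: rd_def matrix_add_ldistrib)

lemma rd_scaleR_vec:
  assumes "smooth_on f GL3"
  shows "rd (c *\<^sub>R X) f g = of_real c * rd X f g"
  using linear_scale[OF linear_frechet_derivative[OF smooth_on_differentiable[OF assms]]]
  by (simp add: rd_def mult_right_scaleR scaleR_conv_of_real[where 'a=complex])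

lemma rd_diff_vec:
  assumes "smooth_on f GL3"
  shows "rd (X - Y) f g = rd X f g - rd Y f g"
  using rd_add_vec[OF assms, of X "(-1) *\<^sub>R Y" g] rd_scaleR_vec[OF assms, of "-1" Y g]
  by simp

lemma rd_zero_vec: "smooth_on f GL3 \<Longrightarrow> rd 0 f g = 0"
  using rd_diff_vec[of f 0 0 g] by simp

lemma rd_sum:
  assumes "\<And>i. i \<in> I \<Longrightarrow> smooth_on (f i) GL3"
  shows "rd X (\<lambda>g. \<Sum>i\<in>I. c i * f i g) = (\<lambda>g. \<Sum>i\<in>I. c i * rd X (f i) g)"
proof
  fix g
  have "((\<lambda>g. \<Sum>i\<in>I. c i * f i g) has_derivative
      (\<lambda>v. \<Sum>i\<in>I. c i * frechet_derivative (f i) (at g) v)) (at g)" if "g \<in> GL3"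
    using smooth_on_has_derivative[OF assms that]
    by (intro has_derivative_sum has_derivative_mult_right)
  then show "rd X (\<lambda>g. \<Sum>i\<in>I. c i * f i g) g = (\<Sum>i\<in>I. c i * rd X (f i) g)"
    by (auto simp: rd_def frechet_derivative_eq)
qed

lemma rd_cmult:
  "smooth_on f GL3 \<Longrightarrow> rd X (\<lambda>g. c * f g) = (\<lambda>g. c * rd X f g)"
  using rd_sum[of "{()}" "\<lambda>_. f" X "\<lambda>_. c"] by simp

lemma rd_power_cmult:
  "smooth_on f GL3 \<Longrightarrow> (rd X ^^ n) (\<lambda>g. c * f g) = (\<lambda>g. c * (rd X ^^ n) f g)"
  by (induction n) (simp_all add: rd_cmult smooth_rd_power)

lemma sum_swap_pairs:
  "(\<Sum>k\<in>A. \<Sum>l\<in>B. \<Sum>i\<in>C. \<Sum>j\<in>D. G k l i j) = (\<Sum>i\<in>C. \<Sum>j\<in>D. \<Sum>k\<in>A. \<Sum>l\<in>B. G k l i j)"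
proof -
  have "(\<Sum>k\<in>A. \<Sum>l\<in>B. \<Sum>i\<in>C. \<Sum>j\<in>D. G k l i j) = (\<Sum>k\<in>A. \<Sum>i\<in>C. \<Sum>l\<in>B. \<Sum>j\<in>D. G k l i j)"
    by (rule sum.cong[OF refl], rule sum.swap)
  also have "\<dots> = (\<Sum>i\<in>C. \<Sum>k\<in>A. \<Sum>j\<in>D. \<Sum>l\<in>B. G k l i j)"
    by (subst sum.swap) (rule sum.cong[OF refl], rule sum.cong[OF refl], rule sum.swap)
  also have "\<dots> = (\<Sum>i\<in>C. \<Sum>j\<in>D. \<Sum>k\<in>A. \<Sum>l\<in>B. G k l i j)"
    by (rule sum.cong[OF refl], rule sum.swap)
  finally show ?thesis .
qed

text \<open>By the product rule the second derivative is the Hessian of \<open>f\<close> plus the first derivative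
  in the direction of the matrix product. The Hessian is symmetric, so the commutator of two
  left invariant fields comes from the commutator of the matrices.\<close>

lemma rd_commutator:
  assumes f: "smooth_on f GL3"
  shows "rd X (rd Y f) g = rd Y (rd X f) g + rd (X ** Y - Y ** X) f g"
proof (cases "g \<in> GL3")
  case g: True
  let ?F = "\<lambda>k l h. frechet_derivative f (at h) (E k l)"
  have sF: "smooth_on (?F k l) GL3" for k l using smooth_on_frechet[OF f] .
  define H where "H i j k l = frechet_derivative (?F k l) (at g) (E i j)" for i j k l
  have Hsym: "H i j k l = H k l i j" for i j k l
    unfolding H_def by (rule frechet_derivative_commute[OF open_GL3 f g])
  have second: "rd X (rd Y f) g = frechet_derivative f (at g) (g ** X ** Y) +
      (\<Sum>k\<in>UNIV. \<Sum>l\<in>UNIV. \<Sum>i\<in>UNIV. \<Sum>j\<in>UNIV.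
         of_real ((g ** Y) $ k $ l) * of_real ((g ** X) $ i $ j) * H i j k l)" for X Y
  proof -
    have entry: "((\<lambda>h. complex_of_real ((h ** Y) $ k $ l)) has_derivative
        (\<lambda>w. of_real ((w ** Y) $ k $ l))) (at g)" for k l
      by (intro has_derivative_of_real bounded_linear.has_derivative[OF bounded_linear_vec_nth]
          bounded_linear_imp_has_derivative[OF bounded_linear_mult_right])
    have hd: "((\<lambda>h. \<Sum>k\<in>UNIV. \<Sum>l\<in>UNIV. of_real ((h ** Y) $ k $ l) * ?F k l h) has_derivative
       (\<lambda>w. \<Sum>k\<in>UNIV. \<Sum>l\<in>UNIV. of_real ((g ** Y) $ k $ l) * frechet_derivative (?F k l) (at g) w
           + of_real ((w ** Y) $ k $ l) * ?F k l g)) (at g)"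
      by (intro has_derivative_sum has_derivative_mult entry smooth_on_has_derivative[OF sF g])
    have "(rd Y f has_derivative
       (\<lambda>w. \<Sum>k\<in>UNIV. \<Sum>l\<in>UNIV. of_real ((g ** Y) $ k $ l) * frechet_derivative (?F k l) (at g) w
           + of_real ((w ** Y) $ k $ l) * ?F k l g)) (at g)"
    proof (rule has_derivative_transform_within_open[OF hd open_GL3 g])
      fix h :: mat3 assume "h \<in> GL3"
      then show "(\<Sum>k\<in>UNIV. \<Sum>l\<in>UNIV. of_real ((h ** Y) $ k $ l) * ?F k l h) = rd Y f h"
        using frechet_derivative_expand[OF smooth_on_differentiable[OF f], of h "h ** Y"]
        by (simp only: rd_def if_True)
    qed
    from frechet_derivative_eq[OF this, of "g ** X"]
    have "rd X (rd Y f) g = (\<Sum>k\<in>UNIV. \<Sum>l\<in>UNIV. of_real ((g ** Y) $ k $ l) * frechet_derivative (?F k l) (at g) (g ** X)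
           + of_real ((g ** X ** Y) $ k $ l) * ?F k l g)"
      using g by (simp add: rd_def)
    also have "\<dots> = (\<Sum>k\<in>UNIV. \<Sum>l\<in>UNIV. of_real ((g ** Y) $ k $ l) * frechet_derivative (?F k l) (at g) (g ** X))
        + frechet_derivative f (at g) (g ** X ** Y)"
      by (subst frechet_derivative_expand[OF smooth_on_differentiable[OF f g], of "g ** X ** Y"])
         (simp add: sum.distrib)
    also have "(\<Sum>k\<in>UNIV. \<Sum>l\<in>UNIV. of_real ((g ** Y) $ k $ l) * frechet_derivative (?F k l) (at g) (g ** X))
       = (\<Sum>k\<in>UNIV. \<Sum>l\<in>UNIV. \<Sum>i\<in>UNIV. \<Sum>j\<in>UNIV.
         of_real ((g ** Y) $ k $ l) * of_real ((g ** X) $ i $ j) * H i j k l)"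
      by (intro sum.cong refl,
          subst frechet_derivative_expand[OF smooth_on_differentiable[OF sF g], of _ _ "g ** X"])
         (simp add: sum_distrib_left mult.assoc H_def)
    finally show ?thesis by simp
  qed
  have "(\<Sum>k\<in>UNIV. \<Sum>l\<in>UNIV. \<Sum>i\<in>UNIV. \<Sum>j\<in>UNIV.
         complex_of_real ((g ** Y) $ k $ l) * of_real ((g ** X) $ i $ j) * H i j k l) =
        (\<Sum>k\<in>UNIV. \<Sum>l\<in>UNIV. \<Sum>i\<in>UNIV. \<Sum>j\<in>UNIV.
         of_real ((g ** X) $ k $ l) * of_real ((g ** Y) $ i $ j) * H i j k l)"
    by (subst sum_swap_pairs) (simp add: Hsym mult.commute)
  then have "rd X (rd Y f) g - rd Y (rd X f) g =
      frechet_derivative f (at g) (g ** X ** Y) - frechet_derivative f (at g) (g ** Y ** X)"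
    by (simp add: second)
  also have "\<dots> = rd (X ** Y - Y ** X) f g"
    using g rd_diff_vec[OF f, of "X ** Y" "Y ** X" g] by (simp add: rd_def matrix_mul_assoc)
  finally show ?thesis by (simp only: diff_eq_eq add.commute)
qed (simp add: rd_outside)

text \<open>If \<open>X\<close> is an eigenvector for conjugation by \<open>p\<close>, then \<open>rd X\<close> maps eigenfunctions of the right
  translation by \<open>p\<close> to eigenfunctions. This is how a monomial in root vectors changes the character
  of the torus, including its component group.\<close>

lemma rd_right_translate:
  assumes f: "smooth_on f GL3" and p: "p \<in> GL3" and g: "g \<in> GL3"
    and eq: "\<And>g. g \<in> GL3 \<Longrightarrow> f (g ** p) = \<kappa> * f g"
    and X: "p ** X = s *\<^sub>R (X ** p)"
  shows "rd X f (g ** p) = of_real s * \<kappa> * rd X f g"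
proof -
  have gp: "g ** p \<in> GL3" using p g by simp
  have "((\<lambda>h. f (h ** p)) has_derivative (\<lambda>w. frechet_derivative f (at (g ** p)) (w ** p))) (at g)"
    using has_derivative_compose[OF bounded_linear_imp_has_derivative[OF bounded_linear_mult_right]
        smooth_on_has_derivative[OF f gp]] .
  from has_derivative_transform_within_open[OF this open_GL3 g eq]
  have "((\<lambda>h. \<kappa> * f h) has_derivative (\<lambda>w. frechet_derivative f (at (g ** p)) (w ** p))) (at g)"
    by blast
  from has_derivative_unique[OF this has_derivative_mult_right[OF smooth_on_has_derivative[OF f g]]]
  have "frechet_derivative f (at (g ** p)) (g ** X ** p) = \<kappa> * frechet_derivative f (at g) (g ** X)"
    by meson
  moreover have "g ** p ** X = s *\<^sub>R (g ** X ** p)"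
    using X by (metis matrix_mul_assoc mult_right_scaleR)
  ultimately show ?thesis
    using g gp p linear_scale[OF linear_frechet_derivative[OF smooth_on_differentiable[OF f gp]]]
    by (simp add: rd_def scaleR_conv_of_real[where 'a=complex])
qed

lemma smooth_left_transl:
  assumes "smooth_on f GL3" "h \<in> GL3"
  shows "smooth_on (left_transl h f) GL3"
  unfolding left_transl_def
  using smooth_on_compose_affine[OF bounded_linear_mult_left[of "matrix_inv h"] open_GL3, of 0 GL3 f] assms
  by simp

lemma rd_left_transl:
  assumes f: "smooth_on f GL3" and h: "h \<in> GL3"
  shows "rd X (left_transl h f) = left_transl h (rd X f)"
proof
  fix g
  show "rd X (left_transl h f) g = left_transl h (rd X f) g"
  proof (cases "g \<in> GL3")
    case True
    then have "matrix_inv h ** g \<in> GL3" using h by simp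
    note frechet_derivative_eq[OF has_derivative_compose[OF
        bounded_linear_imp_has_derivative[OF bounded_linear_mult_left]
        smooth_on_has_derivative[OF f this]], of "g ** X"]
    then show ?thesis using True h
      by (simp add: rd_def left_transl_def matrix_mul_assoc)
  qed (simp add: rd_def left_transl_def)
qed

lemma rd_along_curve:
  assumes f: "smooth_on f GL3" and c: "(c has_derivative c') (at t)" "c t \<in> GL3"
    and X: "c' v = c t ** X"
  shows "frechet_derivative (\<lambda>t. f (c t)) (at t) v = rd X f (c t)"
  using frechet_derivative_eq[OF has_derivative_compose[OF c(1) smooth_on_has_derivative[OF f c(2)]], of v]
  by (simp add: rd_def X c(2))

section \<open>The infinitesimal action on the principal series\<close>

lemma diag_one: "diag 1 = mat 1"
  by (simp add: diag_def mat_def vec_eq_iff)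

lemma diag_GL3: "diag v \<in> GL3 \<longleftrightarrow> (\<forall>j. v $ j \<noteq> 0)"
  by (auto simp: GL3_det det_3 diag_def forall_3)

lemma upper_unip_GL3: "n \<in> upper_unip \<Longrightarrow> n \<in> GL3"
  by (auto simp: upper_unip_def GL3_det det_3)

lemma one_upper_unip: "mat 1 \<in> upper_unip"
proof -
  have "(mat 1 :: mat3) = vector [vector [1, 0, 0], vector [0, 1, 0], vector [0, 0, 1]]"
    by (simp add: vec_eq_iff forall_3 mat_def)
  then show ?thesis unfolding upper_unip_def by blast
qed

lemma principal_series_smooth: "f \<in> principal_series \<xi> \<mu> \<Longrightarrow> smooth_on f GL3"
  by (simp add: principal_series_def)

lemma principal_series_outside: "f \<in> principal_series \<xi> \<mu> \<Longrightarrow> g \<notin> GL3 \<Longrightarrow> f g = 0"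
  by (simp add: principal_series_def)

lemma principal_series_equivariant:
  assumes "f \<in> principal_series \<xi> \<mu>" "g \<in> GL3" "n \<in> upper_unip"
    "\<And>j. m $ j = 1 \<or> m $ j = -1" "\<And>j. a $ j > 0"
  shows "f (g ** diag m ** diag a ** n) =
          (\<Prod>j\<in>UNIV. complex_of_real (sign_char (\<xi> $ j) (m $ j))) *
          (\<Prod>j\<in>UNIV. complex_of_real (a $ j) powr (- (\<mu> $ j))) * f g"
  using assms unfolding principal_series_def by blast

lemma sign_char_one [simp]: "sign_char e 1 = 1"
  by (simp add: sign_char_def)

lemma principal_series_sign:
  assumes "f \<in> principal_series \<xi> \<mu>" "g \<in> GL3" "\<And>j. m $ j = 1 \<or> m $ j = -1"
  shows "f (g ** diag m) = (\<Prod>j\<in>UNIV. complex_of_real (sign_char (\<xi> $ j) (m $ j))) * f g"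
  using principal_series_equivariant[OF assms(1,2) one_upper_unip assms(3), of 1]
  by (simp add: diag_one)

lemma principal_series_pos:
  assumes "f \<in> principal_series \<xi> \<mu>" "g \<in> GL3" "\<And>j. a $ j > 0"
  shows "f (g ** diag a) = (\<Prod>j\<in>UNIV. complex_of_real (a $ j) powr (- (\<mu> $ j))) * f g"
  using principal_series_equivariant[OF assms(1,2) one_upper_unip _ assms(3), of 1]
  by (simp add: diag_one)

lemma principal_series_unip:
  assumes "f \<in> principal_series \<xi> \<mu>" "g \<in> GL3" "n \<in> upper_unip"
  shows "f (g ** n) = f g"
  using principal_series_equivariant[OF assms(1,2,3), of 1 1]
  by (simp add: diag_one)

lemma principal_seriesI:
  assumes "smooth_on f GL3" "\<And>g. g \<notin> GL3 \<Longrightarrow> f g = 0"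
    "\<And>g m. g \<in> GL3 \<Longrightarrow> (\<And>j. m $ j = 1 \<or> m $ j = -1) \<Longrightarrow>
       f (g ** diag m) = (\<Prod>j\<in>UNIV. complex_of_real (sign_char (\<xi> $ j) (m $ j))) * f g"
    "\<And>g a. g \<in> GL3 \<Longrightarrow> (\<And>j. a $ j > 0) \<Longrightarrow>
       f (g ** diag a) = (\<Prod>j\<in>UNIV. complex_of_real (a $ j) powr (- (\<mu> $ j))) * f g"
    "\<And>g n. g \<in> GL3 \<Longrightarrow> n \<in> upper_unip \<Longrightarrow> f (g ** n) = f g"
  shows "f \<in> principal_series \<xi> \<mu>"
proof -
  have "f (g ** diag m ** diag a ** n) =
          (\<Prod>j\<in>UNIV. complex_of_real (sign_char (\<xi> $ j) (m $ j))) *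
          (\<Prod>j\<in>UNIV. complex_of_real (a $ j) powr (- (\<mu> $ j))) * f g"
    if g: "g \<in> GL3" and n: "n \<in> upper_unip" and m: "\<forall>j. m $ j = 1 \<or> m $ j = -1" and a: "\<forall>j. a $ j > 0"
    for g n m a
  proof -
    have m': "diag m \<in> GL3" unfolding diag_GL3 using m by (metis neg_equal_0_iff_equal zero_neq_one)
    have a': "diag a \<in> GL3" unfolding diag_GL3 using a by (metis less_irrefl)
    have "f (g ** diag m ** diag a ** n) = f (g ** diag m ** diag a)"
      using assms(5)[OF _ n, of "g ** diag m ** diag a"] g m' a' by simp
    also have "\<dots> = (\<Prod>j\<in>UNIV. complex_of_real (a $ j) powr (- (\<mu> $ j))) * f (g ** diag m)"
      using assms(4)[of "g ** diag m" a] g m' a by simp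
    also have "f (g ** diag m) = (\<Prod>j\<in>UNIV. complex_of_real (sign_char (\<xi> $ j) (m $ j))) * f g"
      using assms(3)[OF g, of m] m by simp
    finally show ?thesis by (simp add: mult_ac)
  qed
  then show ?thesis using assms(1,2) unfolding principal_series_def by blast
qed

text \<open>The line \<open>t \<mapsto> 1 + t X\<close> has the same tangent at \<open>0\<close> as the one-parameter group of \<open>X\<close>. For matrix
  units \<open>X\<close> on or above the diagonal it runs inside the diagonal or the unipotent matrices, so that the
  equivariance of a principal series function can be differentiated along it.\<close>

lemma rd_one_parameter:
  assumes f: "smooth_on f GL3" and g: "g \<in> GL3" and r: "0 < r"
    and eq: "\<And>t. \<bar>t\<bar> < r \<Longrightarrow> f (g ** (mat 1 + t *\<^sub>R X)) = \<phi> t * f g"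
    and \<phi>: "(\<phi> has_vector_derivative \<phi>') (at 0)"
  shows "rd X f g = \<phi>' * f g"
proof -
  let ?c = "\<lambda>t::real. g + t *\<^sub>R (g ** X)"
  have c: "(?c has_derivative (\<lambda>t. t *\<^sub>R (g ** X))) (at 0)"
    by (auto intro!: derivative_eq_intros)
  have "frechet_derivative (\<lambda>t. f (?c t)) (at 0) 1 = rd X f (?c 0)"
    using rd_along_curve[OF f c, of 1 X] g by simp
  moreover have "((\<lambda>t. f (?c t)) has_derivative (\<lambda>t. t *\<^sub>R (\<phi>' * f g))) (at 0)"
  proof (rule has_derivative_transform_within_open[of "\<lambda>t. \<phi> t * f g" _ _ _ "{-r<..<r}"])
    show "((\<lambda>t. \<phi> t * f g) has_derivative (\<lambda>t. t *\<^sub>R (\<phi>' * f g))) (at 0)"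
      using has_vector_derivative_mult_left[OF \<phi>, of "f g"] by (simp add: has_vector_derivative_def)
    show "\<phi> t * f g = f (?c t)" if "t \<in> {-r<..<r}" for t
      using eq[of t] that by (simp add: matrix_add_ldistrib mult_right_scaleR abs_less_iff)
  qed (use r in auto)
  ultimately show ?thesis by (simp add: frechet_derivative_eq)
qed

lemma rd_diagonal:
  assumes f: "f \<in> principal_series \<xi> \<mu>"
  shows "rd (E i i) f = (\<lambda>g. - \<mu> $ i * f g)"
proof
  fix g
  show "rd (E i i) f g = - \<mu> $ i * f g"
  proof (cases "g \<in> GL3")
    case True
    let ?a = "\<lambda>t::real. \<chi> j. if j = i then 1 + t else 1"
    show ?thesis
    proof (rule rd_one_parameter[OF principal_series_smooth[OF f] True zero_less_one])
      fix t :: real assume t: "\<bar>t\<bar> < 1"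
      have "mat 1 + t *\<^sub>R E i i = diag (?a t)"
        by (simp add: vec_eq_iff mat_def diag_def E_nth)
      moreover have "f (g ** diag (?a t)) = (\<Prod>j\<in>UNIV. complex_of_real (?a t $ j) powr (- (\<mu> $ j))) * f g"
        by (rule principal_series_pos[OF f True]) (use t in auto)
      moreover have "(\<Prod>j\<in>UNIV. complex_of_real (?a t $ j) powr (- (\<mu> $ j))) =
          (\<Prod>j\<in>UNIV. if j = i then of_real (1 + t) powr (- (\<mu> $ j)) else 1)"
        by (rule prod.cong) auto
      ultimately show "f (g ** (mat 1 + t *\<^sub>R E i i)) = of_real (1 + t) powr (- (\<mu> $ i)) * f g"
        by (simp add: prod.delta)
    next
      have "((\<lambda>z. (1 + z) powr (- (\<mu> $ i))) has_field_derivative - \<mu> $ i) (at (of_real 0))"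
        by (auto intro!: derivative_eq_intros)
      from has_vector_derivative_real_field[OF this]
      show "((\<lambda>t. of_real (1 + t) powr (- (\<mu> $ i))) has_vector_derivative - \<mu> $ i) (at 0)"
        by simp
    qed
  qed (simp add: rd_outside principal_series_outside[OF f])
qed

lemma rd_upper:
  assumes f: "f \<in> principal_series \<xi> \<mu>" and ij: "(i, j) \<in> {(1, 2), (2, 3), (1, 3)}"
  shows "rd (E i j) f = (\<lambda>g. 0)"
proof
  fix g
  show "rd (E i j) f g = 0"
  proof (cases "g \<in> GL3")
    case True
    have "mat 1 + t *\<^sub>R E i j \<in> upper_unip" for t
    proof -
      have "mat 1 + t *\<^sub>R E i j = vector [vector [1, if j = 2 then t else 0, if i = 1 \<and> j = 3 then t else 0],
         vector [0, 1, if i = 2 then t else 0], vector [0, 0, 1]]"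
        using ij by (auto simp: vec_eq_iff forall_3 mat_def E_nth)
      then show ?thesis unfolding upper_unip_def by blast
    qed
    then have "f (g ** (mat 1 + t *\<^sub>R E i j)) = 1 * f g" for t
      using principal_series_unip[OF f True] by simp
    from rd_one_parameter[OF principal_series_smooth[OF f] True zero_less_one this has_vector_derivative_const]
    show ?thesis by simp
  qed (simp add: rd_outside)
qed

text \<open>Conversely, a function which is killed by the strictly upper triangular matrices is constant
  along the path \<open>t \<mapsto> g n(t)\<close>, because the logarithmic derivative of \<open>n(t)\<close> is strictly upper
  triangular.\<close>

lemma unip_invariant:
  assumes f: "smooth_on f GL3" and g: "g \<in> GL3" and n: "n \<in> upper_unip"
    and k: "rd (E 1 2) f = (\<lambda>g. 0)" "rd (E 2 3) f = (\<lambda>g. 0)" "rd (E 1 3) f = (\<lambda>g. 0)"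
  shows "f (g ** n) = f g"
proof -
  obtain x y z where n: "n = vector [vector [1, x, y], vector [0, 1, z], vector [0, 0, 1]]"
    using n unfolding upper_unip_def by blast
  define N where "N = x *\<^sub>R E 1 2 + y *\<^sub>R E 1 3 + z *\<^sub>R E 2 3"
  let ?n = "\<lambda>t::real. mat 1 + t *\<^sub>R N"
  let ?c = "\<lambda>t. g ** mat 1 + t *\<^sub>R (g ** N)"
  have n1: "?n 1 = n" by (simp add: n N_def vec_eq_iff forall_3 mat_def E_nth)
  have cn: "?c t = g ** ?n t" for t by (simp add: matrix_add_ldistrib mult_right_scaleR)
  have cG: "?c t \<in> GL3" for t
  proof -
    have "?n t \<in> GL3" by (simp add: GL3_det det_3 N_def mat_def E_nth)
    then show ?thesis unfolding cn using g by simp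
  qed
  have zero: "((\<lambda>t. f (?c t)) has_derivative (\<lambda>h. 0)) (at t)" for t
  proof -
    \<comment> \<open>\<open>?X\<close> is the product of the inverse of \<open>n(t)\<close> with its derivative \<open>N\<close>.\<close>
    let ?X = "x *\<^sub>R E 1 2 + z *\<^sub>R E 2 3 + (y - t * x * z) *\<^sub>R E 1 3"
    have c: "(?c has_derivative (\<lambda>h. h *\<^sub>R (g ** N))) (at t)"
      by (auto intro!: derivative_eq_intros)
    have "?n t ** ?X = N"
      by (simp add: N_def vec_eq_iff forall_3 mat_def E_nth matrix_matrix_mult_def sum_3 algebra_simps)
    then have "g ** N = ?c t ** ?X" unfolding cn by (metis matrix_mul_assoc)
    then have "frechet_derivative (\<lambda>t. f (?c t)) (at t) 1 = rd ?X f (?c t)"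
      by (intro rd_along_curve[OF f c cG]) simp
    also have "\<dots> = 0" using k by (simp add: rd_add_vec[OF f] rd_scaleR_vec[OF f])
    finally have d0: "frechet_derivative (\<lambda>t. f (?c t)) (at t) 1 = 0" .
    have hd: "((\<lambda>t. f (?c t)) has_derivative frechet_derivative (\<lambda>t. f (?c t)) (at t)) (at t)"
      using has_derivative_compose[OF c smooth_on_has_derivative[OF f cG]]
      by (auto intro!: has_derivative_frechet simp: differentiable_def)
    have "frechet_derivative (\<lambda>t. f (?c t)) (at t) h = 0" for h
      using linear_scale[OF has_derivative_linear[OF hd], of h 1] d0 by simp
    then have "frechet_derivative (\<lambda>t. f (?c t)) (at t) = (\<lambda>h. 0)" by (rule ext)
    then show ?thesis using hd by (simp only:)
  qed
  have "f (?c 1) = f (?c 0)"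
    by (rule has_derivative_zero_unique[of UNIV "\<lambda>t. f (?c t)"]) (use zero in auto)
  then show ?thesis using cn[of 1] n1 by simp
qed

section \<open>Commutation relations and monomials in the root vectors\<close>

lemma rd_lin:
  assumes "smooth_on f GL3" "smooth_on h GL3"
  shows "rd X (\<lambda>g. p * f g + q * h g) = (\<lambda>g. p * rd X f g + q * rd X h g)"
  using rd_sum[of UNIV "\<lambda>b. if b then f else h" X "\<lambda>b. if b then p else q"] assms
  by (simp add: UNIV_bool add.commute)

lemma rd_power_lin:
  assumes "smooth_on f GL3" "smooth_on h GL3"
  shows "(rd X ^^ n) (\<lambda>g. p * f g + q * h g) = (\<lambda>g. p * (rd X ^^ n) f g + q * (rd X ^^ n) h g)"
  by (induction n) (simp_all add: rd_lin smooth_rd_power assms)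

lemma rd_power_zero: "(rd X ^^ n) (\<lambda>g. 0) = (\<lambda>g. 0)"
  using rd_power_cmult[OF smooth_on_const, of n X 0 0] by simp

lemma rd_commute:
  assumes "smooth_on f GL3" "X ** Y = Y ** X"
  shows "rd X (rd Y f) = rd Y (rd X f)"
  using rd_commutator[OF assms(1), of X Y] assms by (auto simp: rd_zero_vec)

lemma rd_power_commute:
  assumes "smooth_on f GL3" "X ** Y = Y ** X"
  shows "rd X ((rd Y ^^ n) f) = (rd Y ^^ n) (rd X f)"
  by (induction n) (simp_all add: rd_commute[OF _ assms(2)] smooth_rd_power assms)

lemma rd_weight:
  assumes f: "smooth_on f GL3" and H: "H ** X - X ** H = s *\<^sub>R X" and w: "rd H f = (\<lambda>g. \<kappa> * f g)"
  shows "rd H ((rd X ^^ n) f) = (\<lambda>g. (\<kappa> + of_nat n * of_real s) * (rd X ^^ n) f g)"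
proof (induction n)
  case (Suc n)
  have s: "smooth_on ((rd X ^^ n) f) GL3" using f by (rule smooth_rd_power)
  have "rd H (rd X ((rd X ^^ n) f)) g = rd X (rd H ((rd X ^^ n) f)) g + of_real s * rd X ((rd X ^^ n) f) g" for g
    by (simp add: rd_commutator[OF s, of H X] H rd_scaleR_vec[OF s])
  moreover have "rd X (rd H ((rd X ^^ n) f)) g = (\<kappa> + of_nat n * of_real s) * rd X ((rd X ^^ n) f) g" for g
    by (simp only: Suc rd_cmult[OF s])
  ultimately show ?case by (auto simp: algebra_simps)
qed (simp add: w)

text \<open>Since \<open>W\<close> commutes with \<open>Y\<close>, each of the \<open>n\<close> places at which \<open>X\<close> passes a factor \<open>Y\<close> contributes the
  same term.\<close>

lemma rd_commutator_power:
  assumes h: "smooth_on h GL3" and XY: "X ** Y - Y ** X = s *\<^sub>R W" and WY: "W ** Y = Y ** W"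
  shows "rd X ((rd Y ^^ n) h) =
    (\<lambda>g. (rd Y ^^ n) (rd X h) g + of_nat n * of_real s * (rd Y ^^ (n - 1)) (rd W h) g)"
proof (induction n)
  case (Suc n)
  have sm: "smooth_on ((rd Y ^^ n) h) GL3" using h by (rule smooth_rd_power)
  have W: "rd W ((rd Y ^^ n) h) = (rd Y ^^ n) (rd W h)"
    by (rule rd_power_commute[OF h WY])
  have "rd X ((rd Y ^^ Suc n) h) g =
      (rd Y ^^ Suc n) (rd X h) g + of_nat (Suc n) * of_real s * (rd Y ^^ n) (rd W h) g" for g
  proof -
    have "rd X ((rd Y ^^ Suc n) h) g = rd Y (rd X ((rd Y ^^ n) h)) g + of_real s * (rd Y ^^ n) (rd W h) g"
      by (simp add: rd_commutator[OF sm, of X Y] XY rd_scaleR_vec[OF sm] W)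
    also have "rd Y (rd X ((rd Y ^^ n) h)) = rd Y (\<lambda>g. 1 * (rd Y ^^ n) (rd X h) g + (of_nat n * of_real s) * (rd Y ^^ (n - 1)) (rd W h) g)"
      using Suc by simp
    also have "\<dots> = (\<lambda>g. (rd Y ^^ Suc n) (rd X h) g + (of_nat n * of_real s) * rd Y ((rd Y ^^ (n - 1)) (rd W h)) g)"
      by (subst rd_lin) (simp_all add: smooth_rd_power smooth_rd h)
    also have "\<dots> g = (rd Y ^^ Suc n) (rd X h) g + (of_nat n * of_real s) * (rd Y ^^ n) (rd W h) g"
      by (cases n) simp_all
    finally show ?thesis by (simp add: algebra_simps)
  qed
  then show ?case by auto
qed simp

text \<open>The identity \<open>[e, f\<^sup>n] = n f\<^sup>n\<^sup>-\<^sup>1 (h - (n - 1))\<close> in \<open>sl\<^sub>2\<close>.\<close>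

lemma rd_sl2:
  assumes h: "smooth_on h GL3" and ij: "i \<noteq> j"
    and i: "rd (E i i) h = (\<lambda>g. \<kappa> * h g)" and j: "rd (E j j) h = (\<lambda>g. \<kappa>' * h g)"
  shows "rd (E i j) ((rd (E j i) ^^ n) h) = (\<lambda>g. (rd (E j i) ^^ n) (rd (E i j) h) g +
    of_nat n * (\<kappa> - \<kappa>' - of_nat n + 1) * (rd (E j i) ^^ (n - 1)) h g)"
proof (induction n)
  case (Suc n)
  let ?Y = "E j i" let ?k = "(rd ?Y ^^ n) h"
  have sm: "smooth_on ?k GL3" using h by (rule smooth_rd_power)
  have wi: "rd (E i i) ?k = (\<lambda>g. (\<kappa> + of_nat n * of_real (-1)) * ?k g)"
    by (rule rd_weight[OF h _ i]) (use ij in \<open>simp add: E_mult\<close>)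
  have wj: "rd (E j j) ?k = (\<lambda>g. (\<kappa>' + of_nat n * of_real 1) * ?k g)"
    by (rule rd_weight[OF h _ j]) (use ij in \<open>simp add: E_mult\<close>)
  have "rd (E i j) ((rd ?Y ^^ Suc n) h) g = (rd ?Y ^^ Suc n) (rd (E i j) h) g +
      of_nat (Suc n) * (\<kappa> - \<kappa>' - of_nat (Suc n) + 1) * ?k g" for g
  proof -
    have "rd (E i j) ((rd ?Y ^^ Suc n) h) g = rd ?Y (rd (E i j) ?k) g + rd (E i i) ?k g - rd (E j j) ?k g"
      using rd_commutator[OF sm, of "E i j" ?Y g] by (simp add: E_mult rd_diff_vec[OF sm])
    also have "rd ?Y (rd (E i j) ?k) = rd ?Y (\<lambda>g. 1 * (rd ?Y ^^ n) (rd (E i j) h) g +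
        (of_nat n * (\<kappa> - \<kappa>' - of_nat n + 1)) * (rd ?Y ^^ (n - 1)) h g)"
      using Suc by simp
    also have "\<dots> = (\<lambda>g. (rd ?Y ^^ Suc n) (rd (E i j) h) g +
        (of_nat n * (\<kappa> - \<kappa>' - of_nat n + 1)) * rd ?Y ((rd ?Y ^^ (n - 1)) h) g)"
      by (subst rd_lin) (simp_all add: smooth_rd_power smooth_rd h)
    also have "\<dots> g = (rd ?Y ^^ Suc n) (rd (E i j) h) g + of_nat n * (\<kappa> - \<kappa>' - of_nat n + 1) * ?k g"
      by (cases n) simp_all
    finally show ?thesis by (simp add: wi wj algebra_simps)
  qed
  then show ?case by auto
qed simp

text \<open>The Poincare-Birkhoff-Witt monomials in the negative root vectors. The fields of \<open>E 3 1\<close> and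
  \<open>E 3 2\<close> are coordinate fields in the chart, and the one of \<open>E 2 1\<close> has a coefficient which is
  constant along it; with \<open>E 2 1\<close> on the left the coefficients are never differentiated.\<close>

definition lowering :: "nat \<Rightarrow> nat \<Rightarrow> nat \<Rightarrow> (mat3 \<Rightarrow> complex) \<Rightarrow> mat3 \<Rightarrow> complex" where
  "lowering a b c f = (rd (E 2 1) ^^ a) ((rd (E 3 1) ^^ b) ((rd (E 3 2) ^^ c) f))"

lemma smooth_lowering: "smooth_on f GL3 \<Longrightarrow> smooth_on (lowering a b c f) GL3"
  by (simp add: lowering_def smooth_rd_power)

lemma rd_power_left_transl:
  "smooth_on f GL3 \<Longrightarrow> h \<in> GL3 \<Longrightarrow> (rd X ^^ n) (left_transl h f) = left_transl h ((rd X ^^ n) f)"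
  by (induction n) (simp_all add: rd_left_transl smooth_rd_power)

lemma lowering_left_transl:
  "smooth_on f GL3 \<Longrightarrow> h \<in> GL3 \<Longrightarrow> lowering a b c (left_transl h f) = left_transl h (lowering a b c f)"
  by (simp add: lowering_def rd_power_left_transl smooth_rd_power)

lemma lowering_outside:
  assumes "\<And>g. g \<notin> GL3 \<Longrightarrow> f g = 0" "g \<notin> GL3"
  shows "lowering a b c f g = 0"
proof -
  have *: "(rd X ^^ n) h g = 0" if "h g = 0" for X n h
    using that assms(2) by (cases n) (auto simp: rd_outside)
  show ?thesis unfolding lowering_def by (intro * assms)
qed

lemma rd_power_right_translate:
  assumes f: "smooth_on f GL3" and p: "p \<in> GL3"
    and eq: "\<And>g. g \<in> GL3 \<Longrightarrow> f (g ** p) = \<kappa> * f g"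
    and X: "p ** X = s *\<^sub>R (X ** p)"
  shows "g \<in> GL3 \<Longrightarrow> (rd X ^^ n) f (g ** p) = of_real s ^ n * \<kappa> * (rd X ^^ n) f g"
proof (induction n arbitrary: g)
  case (Suc n)
  show ?case
    using rd_right_translate[OF smooth_rd_power[OF f] p Suc.prems Suc.IH X] by (simp add: mult.assoc)
qed (simp add: eq)

lemma lowering_diag:
  assumes f: "smooth_on f GL3" and v: "\<And>j. v $ j \<noteq> 0"
    and eq: "\<And>g. g \<in> GL3 \<Longrightarrow> f (g ** diag v) = \<kappa> * f g" and g: "g \<in> GL3"
  shows "lowering a b c f (g ** diag v) =
    of_real ((v $ 2 / v $ 1) ^ a * (v $ 3 / v $ 1) ^ b * (v $ 3 / v $ 2) ^ c) * \<kappa> * lowering a b c f g"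
proof -
  have p: "diag v \<in> GL3" using v by (simp add: diag_GL3)
  have X: "diag v ** E i j = (v $ i / v $ j) *\<^sub>R (E i j ** diag v)" for i j
    using v exhaust_3[of i] exhaust_3[of j]
    by (auto simp: vec_eq_iff matrix_matrix_mult_def sum_3 diag_def E_nth)
  note c = rd_power_right_translate[OF f p eq X, of _ c 3 2]
  note b = rd_power_right_translate[OF smooth_rd_power[OF f] p c X, of _ b 3 1]
  note a = rd_power_right_translate[OF smooth_rd_power[OF smooth_rd_power[OF f]] p b X, of _ a 2 1]
  show ?thesis using a[of g] g by (simp add: lowering_def mult_ac)
qed

context
  fixes f \<xi> \<mu>
  assumes f: "f \<in> principal_series \<xi> \<mu>"
begin

lemma smooth_vector: "smooth_on f GL3"
  using f by (rule principal_series_smooth)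

lemma lowering_inner_weight:
  "rd (E 1 1) ((rd (E 3 1) ^^ b) ((rd (E 3 2) ^^ c) f)) =
     (\<lambda>g. (- \<mu> $ 1 - of_nat b) * (rd (E 3 1) ^^ b) ((rd (E 3 2) ^^ c) f) g)"
  "rd (E 2 2) ((rd (E 3 1) ^^ b) ((rd (E 3 2) ^^ c) f)) =
     (\<lambda>g. (- \<mu> $ 2 - of_nat c) * (rd (E 3 1) ^^ b) ((rd (E 3 2) ^^ c) f) g)"
  "rd (E 3 3) ((rd (E 3 1) ^^ b) ((rd (E 3 2) ^^ c) f)) =
     (\<lambda>g. (- \<mu> $ 3 + of_nat b + of_nat c) * (rd (E 3 1) ^^ b) ((rd (E 3 2) ^^ c) f) g)"
proof -
  have c: "rd (E i i) ((rd (E 3 2) ^^ c) f) = (\<lambda>g. (- \<mu> $ i + of_nat c * of_real s) * (rd (E 3 2) ^^ c) f g)"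
    if "E i i ** E 3 2 - E 3 2 ** E i i = s *\<^sub>R E 3 2" for i s
    by (rule rd_weight[OF smooth_vector that rd_diagonal[OF f]])
  have b: "rd (E i i) ((rd (E 3 1) ^^ b) ((rd (E 3 2) ^^ c) f)) =
      (\<lambda>g. (- \<mu> $ i + of_nat c * of_real s + of_nat b * of_real t) * (rd (E 3 1) ^^ b) ((rd (E 3 2) ^^ c) f) g)"
    if "E i i ** E 3 2 - E 3 2 ** E i i = s *\<^sub>R E 3 2" "E i i ** E 3 1 - E 3 1 ** E i i = t *\<^sub>R E 3 1" for i s t
    by (rule rd_weight[OF smooth_rd_power[OF smooth_vector] that(2) c[OF that(1)]])
  show "rd (E 1 1) ((rd (E 3 1) ^^ b) ((rd (E 3 2) ^^ c) f)) =
     (\<lambda>g. (- \<mu> $ 1 - of_nat b) * (rd (E 3 1) ^^ b) ((rd (E 3 2) ^^ c) f) g)"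
    using b[of 1 0 "-1"] by (simp add: E_mult)
  show "rd (E 2 2) ((rd (E 3 1) ^^ b) ((rd (E 3 2) ^^ c) f)) =
     (\<lambda>g. (- \<mu> $ 2 - of_nat c) * (rd (E 3 1) ^^ b) ((rd (E 3 2) ^^ c) f) g)"
    using b[of 2 "-1" 0] by (simp add: E_mult)
  show "rd (E 3 3) ((rd (E 3 1) ^^ b) ((rd (E 3 2) ^^ c) f)) =
     (\<lambda>g. (- \<mu> $ 3 + of_nat b + of_nat c) * (rd (E 3 1) ^^ b) ((rd (E 3 2) ^^ c) f) g)"
    using b[of 3 1 1] by (simp add: E_mult algebra_simps)
qed

lemma lowering_weight:
  "rd (E 1 1) (lowering a b c f) = (\<lambda>g. (- \<mu> $ 1 - of_nat (a + b)) * lowering a b c f g)"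
  "rd (E 3 3) (lowering a b c f) = (\<lambda>g. (- \<mu> $ 3 + of_nat (b + c)) * lowering a b c f g)"
  "rd (E 2 2) (lowering a b c f) = (\<lambda>g. (- \<mu> $ 2 + of_nat a - of_nat c) * lowering a b c f g)"
proof -
  let ?k = "(rd (E 3 1) ^^ b) ((rd (E 3 2) ^^ c) f)"
  have L: "rd (E i i) (lowering a b c f) = (\<lambda>g. \<kappa>' * lowering a b c f g)"
    if "rd (E i i) ?k = (\<lambda>g. \<kappa> * ?k g)" "E i i ** E 2 1 - E 2 1 ** E i i = s *\<^sub>R E 2 1"
      "\<kappa> + of_nat a * of_real s = \<kappa>'" for i s \<kappa> \<kappa>'
    using rd_weight[OF smooth_rd_power[OF smooth_rd_power[OF smooth_vector]] that(2,1), of a] that(3)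
    by (simp add: lowering_def)
  show "rd (E 1 1) (lowering a b c f) = (\<lambda>g. (- \<mu> $ 1 - of_nat (a + b)) * lowering a b c f g)"
    by (rule L[OF lowering_inner_weight(1), of "-1"]) (simp_all add: E_mult)
  show "rd (E 3 3) (lowering a b c f) = (\<lambda>g. (- \<mu> $ 3 + of_nat (b + c)) * lowering a b c f g)"
    by (rule L[OF lowering_inner_weight(3), of 0]) (simp_all add: E_mult)
  show "rd (E 2 2) (lowering a b c f) = (\<lambda>g. (- \<mu> $ 2 + of_nat a - of_nat c) * lowering a b c f g)"
    by (rule L[OF lowering_inner_weight(2), of 1]) (simp_all add: E_mult)
qed

text \<open>The positive root vectors act on a monomial as in a Verma module. In \<open>raise_12\<close> the first term is
  the \<open>sl\<^sub>2\<close> formula for the pair \<open>E 1 2\<close>, \<open>E 2 1\<close> on a vector whose weight is shifted by the other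
  factors; the second term comes from \<open>[E 1 2, E 3 1] = - E 3 2\<close>. In \<open>raise_23\<close> the commutator
  \<open>[E 2 3, E 3 1] = E 2 1\<close> takes this role.\<close>

lemma raise_12:
  "rd (E 1 2) (lowering a b c f) = (\<lambda>g.
     of_nat a * (\<mu> $ 2 - \<mu> $ 1 - of_nat b + of_nat c - of_nat a + 1) * lowering (a - 1) b c f g
     - of_nat b * lowering a (b - 1) (c + 1) f g)"
proof -
  let ?w = "(rd (E 3 2) ^^ c) f" let ?k = "(rd (E 3 1) ^^ b) ?w"
  have smw: "smooth_on ?w GL3" "smooth_on ?k GL3" by (intro smooth_rd_power smooth_vector)+
  have "rd (E 1 2) ?w = (\<lambda>g. 0)"
    using rd_power_commute[OF smooth_vector, of "E 1 2" "E 3 2" c]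
    by (simp add: E_mult rd_upper[OF f] rd_power_zero)
  then have k: "rd (E 1 2) ?k = (\<lambda>g. - of_nat b * (rd (E 3 1) ^^ (b - 1)) (rd (E 3 2) ?w) g + 0 * ?k g)"
    using rd_commutator_power[OF smw(1), of "E 1 2" "E 3 1" "-1" "E 3 2" b]
    by (simp add: E_mult rd_power_zero)
  have "rd (E 1 2) (lowering a b c f) = (\<lambda>g. (rd (E 2 1) ^^ a) (rd (E 1 2) ?k) g +
      of_nat a * (- \<mu> $ 1 - of_nat b - (- \<mu> $ 2 - of_nat c) - of_nat a + 1) * (rd (E 2 1) ^^ (a - 1)) ?k g)"
    unfolding lowering_def by (rule rd_sl2[OF smw(2) _ lowering_inner_weight(1,2)]) simp
  also have "(rd (E 2 1) ^^ a) (rd (E 1 2) ?k) = (\<lambda>g. - of_nat b * lowering a (b - 1) (c + 1) f g)"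
    unfolding k by (subst rd_power_lin) (simp_all add: smw smooth_rd_power smooth_rd lowering_def)
  finally show ?thesis by (simp add: lowering_def algebra_simps)
qed

lemma raise_23:
  "rd (E 2 3) (lowering a b c f) = (\<lambda>g.
     of_nat b * lowering (a + 1) (b - 1) c f g
     + of_nat c * (\<mu> $ 3 - \<mu> $ 2 - of_nat c + 1) * lowering a b (c - 1) f g)"
proof -
  let ?w = "(rd (E 3 2) ^^ c) f" let ?k = "(rd (E 3 1) ^^ b) ?w"
  have smw: "smooth_on ?w GL3" "smooth_on ?k GL3" by (intro smooth_rd_power smooth_vector)+
  have w: "rd (E 2 3) ?w = (\<lambda>g. of_nat c * (\<mu> $ 3 - \<mu> $ 2 - of_nat c + 1) * (rd (E 3 2) ^^ (c - 1)) f g)"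
    using rd_sl2[OF smooth_vector _ rd_diagonal[OF f] rd_diagonal[OF f], of 2 3 c]
    by (simp add: rd_upper[OF f] rd_power_zero algebra_simps)
  have comm: "rd (E 2 1) ((rd (E 3 1) ^^ n) h) = (rd (E 3 1) ^^ n) (rd (E 2 1) h)" if "smooth_on h GL3" for n h
    by (rule rd_power_commute[OF that]) (simp add: E_mult)
  have "rd (E 2 3) ?k = (\<lambda>g. (rd (E 3 1) ^^ b) (rd (E 2 3) ?w) g +
       of_nat b * (rd (E 3 1) ^^ (b - 1)) (rd (E 2 1) ?w) g)"
    using rd_commutator_power[OF smw(1), of "E 2 3" "E 3 1" 1 "E 2 1" b] by (simp add: E_mult)
  also have "(rd (E 3 1) ^^ b) (rd (E 2 3) ?w) =
      (\<lambda>g. of_nat c * (\<mu> $ 3 - \<mu> $ 2 - of_nat c + 1) * (rd (E 3 1) ^^ b) ((rd (E 3 2) ^^ (c - 1)) f) g)"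
    unfolding w by (rule rd_power_cmult) (intro smooth_rd_power smooth_vector)
  finally have k: "rd (E 2 3) ?k = (\<lambda>g. of_nat c * (\<mu> $ 3 - \<mu> $ 2 - of_nat c + 1) *
       (rd (E 3 1) ^^ b) ((rd (E 3 2) ^^ (c - 1)) f) g +
       of_nat b * rd (E 2 1) ((rd (E 3 1) ^^ (b - 1)) ?w) g)"
    by (simp add: comm smw)
  have "rd (E 2 3) (lowering a b c f) = (rd (E 2 1) ^^ a) (rd (E 2 3) ?k)"
    unfolding lowering_def by (rule rd_power_commute[OF smw(2)]) (simp add: E_mult)
  also have "\<dots> = (\<lambda>g. of_nat c * (\<mu> $ 3 - \<mu> $ 2 - of_nat c + 1) *
       (rd (E 2 1) ^^ a) ((rd (E 3 1) ^^ b) ((rd (E 3 2) ^^ (c - 1)) f)) g +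
       of_nat b * (rd (E 2 1) ^^ a) (rd (E 2 1) ((rd (E 3 1) ^^ (b - 1)) ?w)) g)"
    unfolding k by (rule rd_power_lin) (intro smooth_rd_power smooth_rd smooth_vector)+
  finally show ?thesis by (simp add: lowering_def funpow_swap1 add.commute)
qed

end

section \<open>Invariant operators in the charts\<close>

definition chart :: "mat3 \<Rightarrow> (mat3 \<Rightarrow> complex) \<Rightarrow> real^3 \<Rightarrow> complex" where
  "chart g h = (\<lambda>x. h (g ** lower_unip x))"

definition nilpotent :: "real^3 \<Rightarrow> mat3" where
  "nilpotent x = (x $ 1) *\<^sub>R E 2 1 + (x $ 2) *\<^sub>R E 3 1 + (x $ 3) *\<^sub>R E 3 2"

lemma lower_unip_nilpotent: "lower_unip x = mat 1 + nilpotent x"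
  by (simp add: lower_unip_def nilpotent_def vec_eq_iff forall_3 mat_def E_nth)

lemma lower_unip_GL3 [simp]: "lower_unip x \<in> GL3"
  by (simp add: GL3_det det_3 lower_unip_def)

lemma lower_unip_zero [simp]: "lower_unip 0 = mat 1"
  by (simp add: lower_unip_nilpotent nilpotent_def)

lemma bounded_linear_nilpotent: "bounded_linear nilpotent"
  unfolding linear_conv_bounded_linear[symmetric]
  by (rule linearI) (simp_all add: nilpotent_def vec_eq_iff forall_3 E_nth)

lemma chart_affine: "chart g h = (\<lambda>x. h (g + g ** nilpotent x))"
  by (simp add: chart_def lower_unip_nilpotent matrix_add_ldistrib)

lemma bounded_linear_chart: "bounded_linear (\<lambda>x. g ** nilpotent x)"
  using bounded_linear_compose[OF bounded_linear_mult_left bounded_linear_nilpotent] .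

lemma smooth_chart:
  assumes "smooth_on h GL3" "g \<in> GL3"
  shows "smooth_on (chart g h) UNIV"
proof -
  have "g + g ** nilpotent x \<in> GL3" for x
    using GL3_mult[of g "lower_unip x"] lower_unip_GL3[of x] assms(2)
    by (simp add: lower_unip_nilpotent matrix_add_ldistrib del: lower_unip_GL3)
  then show ?thesis unfolding chart_affine
    by (intro smooth_on_compose_affine[OF bounded_linear_chart open_UNIV _ assms(1)])
qed

lemma chart_derivative:
  assumes h: "smooth_on h GL3" and g: "g \<in> GL3"
  shows "frechet_derivative (chart g h) (at x) v =
    of_real (v $ 1) * chart g (rd (E 2 1) h) x + of_real (v $ 2 - x $ 3 * v $ 1) * chart g (rd (E 3 1) h) x
    + of_real (v $ 3) * chart g (rd (E 3 2) h) x"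
proof -
  let ?X = "(v $ 1) *\<^sub>R E 2 1 + (v $ 2 - x $ 3 * v $ 1) *\<^sub>R E 3 1 + (v $ 3) *\<^sub>R E 3 2"
  have c: "((\<lambda>x. g ** lower_unip x) has_derivative (\<lambda>x. g ** nilpotent x)) (at x)"
    using has_derivative_add[OF has_derivative_const[of g] bounded_linear_imp_has_derivative[OF bounded_linear_chart]]
    by (simp add: lower_unip_nilpotent matrix_add_ldistrib)
  have "nilpotent v = lower_unip x ** ?X"
    by (simp add: nilpotent_def lower_unip_def vec_eq_iff forall_3 E_nth matrix_matrix_mult_def sum_3)
  then have "g ** nilpotent v = g ** lower_unip x ** ?X" by (metis matrix_mul_assoc)
  from rd_along_curve[OF h c _ this] g
  have "frechet_derivative (chart g h) (at x) v = rd ?X h (g ** lower_unip x)"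
    by (simp add: chart_def)
  then show ?thesis by (simp add: rd_add_vec[OF h] rd_scaleR_vec[OF h] chart_def)
qed

lemma partial_chart:
  assumes "smooth_on h GL3" "g \<in> GL3"
  shows "partial 1 (chart g h) = (\<lambda>x. chart g (rd (E 2 1) h) x - of_real (x $ 3) * chart g (rd (E 3 1) h) x)"
    and "partial 2 (chart g h) = chart g (rd (E 3 1) h)"
    and "partial 3 (chart g h) = chart g (rd (E 3 2) h)"
  by (simp_all add: fun_eq_iff partial_def chart_derivative[OF assms] axis_def)

lemma partial_power_chart:
  assumes "smooth_on h GL3" "g \<in> GL3"
  shows "(partial 2 ^^ n) (chart g h) = chart g ((rd (E 3 1) ^^ n) h)"
    and "(partial 3 ^^ n) (chart g h) = chart g ((rd (E 3 2) ^^ n) h)"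
  by (induction n) (simp_all add: partial_chart smooth_rd_power assms)

lemma smooth_partial: "smooth_on \<phi> UNIV \<Longrightarrow> smooth_on (partial i \<phi>) UNIV"
  unfolding partial_def by (rule smooth_on_frechet)

lemma smooth_partial_power: "smooth_on \<phi> UNIV \<Longrightarrow> smooth_on ((partial i ^^ n) \<phi>) UNIV"
  by (induction n) (auto intro: smooth_partial)

lemma bounded_linear_coord: "bounded_linear (\<lambda>x::real^3. complex_of_real (x $ i))"
  by (rule bounded_linear_compose[OF bounded_linear_of_real bounded_linear_vec_nth])

lemma smooth_coord: "smooth_on (\<lambda>x::real^3. complex_of_real (x $ i)) S"
  by (rule smooth_on_bounded_linear[OF bounded_linear_coord])

lemma partial_add:
  assumes "smooth_on \<phi> UNIV" "smooth_on \<psi> UNIV"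
  shows "partial i (\<lambda>x. \<phi> x + \<psi> x) = (\<lambda>x. partial i \<phi> x + partial i \<psi> x)"
  unfolding partial_def
  by (rule ext, rule frechet_derivative_add) (auto intro: smooth_on_differentiable assms)

lemma partial_mult:
  assumes "smooth_on \<phi> UNIV" "smooth_on \<psi> UNIV"
  shows "partial i (\<lambda>x. \<phi> x * \<psi> x) = (\<lambda>x. \<phi> x * partial i \<psi> x + partial i \<phi> x * \<psi> x)"
  unfolding partial_def
  by (rule ext, rule frechet_derivative_mult) (auto intro: smooth_on_differentiable assms)

lemma partial_coord: "partial i (\<lambda>x. complex_of_real (x $ j)) = (\<lambda>x. if i = j then 1 else 0)"
  unfolding partial_def
  by (auto simp: fun_eq_iff frechet_derivative_eq[OF bounded_linear_imp_has_derivative[OF bounded_linear_coord]] axis_def)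

text \<open>A coordinate other than the one of the derivative behaves like a constant.\<close>

lemma partial_power_add_coord_mult:
  assumes "i \<noteq> j" "smooth_on \<phi> UNIV" "smooth_on \<psi> UNIV"
  shows "(partial i ^^ n) (\<lambda>x. \<phi> x + of_real (x $ j) * \<psi> x) =
    (\<lambda>x. (partial i ^^ n) \<phi> x + of_real (x $ j) * (partial i ^^ n) \<psi> x)"
proof (induction n)
  case (Suc n)
  have "smooth_on ((partial i ^^ n) \<phi>) UNIV" "smooth_on ((partial i ^^ n) \<psi>) UNIV"
    using assms by (auto intro: smooth_partial_power)
  then show ?case
    using Suc assms(1)
    by (simp add: partial_add partial_mult partial_coord smooth_on_mult smooth_coord)
qed simp

text \<open>In the chart \<open>E 2 1\<close> acts by \<open>\<partial>\<^sub>1 + x\<^sub>3 \<partial>\<^sub>2\<close>. The two summands commute, so the powers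
  of this field are given by the binomial formula.\<close>

lemma chart_power:
  assumes g: "g \<in> GL3"
  shows "smooth_on h GL3 \<Longrightarrow> chart g ((rd (E 2 1) ^^ a) h) x =
    (\<Sum>j\<le>a. of_nat (a choose j) * of_real (x $ 3) ^ j * (partial 1 ^^ (a - j)) (chart g ((rd (E 3 1) ^^ j) h)) x)"
proof (induction a arbitrary: h)
  case (Suc a)
  define T where "T j = of_real (x $ 3) ^ j * (partial 1 ^^ (Suc a - j)) (chart g ((rd (E 3 1) ^^ j) h)) x" for j
  have step: "(partial 1 ^^ (a - j)) (chart g ((rd (E 3 1) ^^ j) (rd (E 2 1) h))) x =
     (partial 1 ^^ (Suc a - j)) (chart g ((rd (E 3 1) ^^ j) h)) x +
     of_real (x $ 3) * (partial 1 ^^ (a - j)) (chart g ((rd (E 3 1) ^^ Suc j) h)) x" if "j \<le> a" for j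
  proof -
    let ?k = "(rd (E 3 1) ^^ j) h"
    have sk: "smooth_on ?k GL3" using Suc.prems by (rule smooth_rd_power)
    have "(rd (E 3 1) ^^ j) (rd (E 2 1) h) = rd (E 2 1) ?k"
      by (rule rd_power_commute[OF Suc.prems, symmetric]) (simp add: E_mult)
    moreover have "chart g (rd (E 2 1) ?k) = (\<lambda>x. partial 1 (chart g ?k) x + of_real (x $ 3) * chart g (rd (E 3 1) ?k) x)"
      by (simp add: partial_chart[OF sk g])
    ultimately have "(partial 1 ^^ (a - j)) (chart g ((rd (E 3 1) ^^ j) (rd (E 2 1) h))) x =
      (partial 1 ^^ (a - j)) (partial 1 (chart g ?k)) x + of_real (x $ 3) * (partial 1 ^^ (a - j)) (chart g (rd (E 3 1) ?k)) x"
      using partial_power_add_coord_mult[of 1 3 "partial 1 (chart g ?k)" "chart g (rd (E 3 1) ?k)" "a - j"]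
      by (simp add: smooth_partial smooth_chart smooth_rd sk g)
    then show ?thesis using that by (simp add: Suc_diff_le funpow_swap1)
  qed
  have "chart g ((rd (E 2 1) ^^ Suc a) h) x = chart g ((rd (E 2 1) ^^ a) (rd (E 2 1) h)) x"
    by (simp add: funpow_swap1)
  also have "\<dots> = (\<Sum>j\<le>a. of_nat (a choose j) * of_real (x $ 3) ^ j *
      (partial 1 ^^ (a - j)) (chart g ((rd (E 3 1) ^^ j) (rd (E 2 1) h))) x)"
    by (rule Suc.IH[OF smooth_rd[OF Suc.prems]])
  also have "\<dots> = (\<Sum>j\<le>a. of_nat (a choose j) * T j + of_nat (a choose j) * T (Suc j))"
    by (intro sum.cong refl) (simp add: step T_def algebra_simps)
  also have "\<dots> = (\<Sum>j\<le>a. of_nat (a choose j) * T j) + (\<Sum>j\<le>a. of_nat (a choose j) * T (Suc j))"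
    by (rule sum.distrib)
  also have "(\<Sum>j\<le>a. of_nat (a choose j) * T j) = (\<Sum>j\<le>Suc a. of_nat (a choose j) * T j)"
    by simp
  also have "\<dots> = T 0 + (\<Sum>j\<le>a. of_nat (a choose Suc j) * T (Suc j))"
    by (subst sum.atMost_Suc_shift) simp
  also have "\<dots> + (\<Sum>j\<le>a. of_nat (a choose j) * T (Suc j)) = T 0 + (\<Sum>j\<le>a. of_nat (Suc a choose Suc j) * T (Suc j))"
    by (simp add: sum.distrib algebra_simps)
  also have "\<dots> = (\<Sum>j\<le>Suc a. of_nat (Suc a choose j) * T j)"
    by (simp only: sum.atMost_Suc_shift binomial_n_0 of_nat_1 mult_1)
  finally show ?case by (simp add: T_def mult.assoc)
qed simp

lemma chart_lowering:
  assumes f: "smooth_on f GL3" and g: "g \<in> GL3"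
  shows "chart g (lowering a b c f) x =
    (\<Sum>j\<le>a. of_nat (a choose j) * of_real (x $ 3) ^ j *
       multi_partial (vector [a - j, j + b, c]) (chart g f) x)"
proof -
  have "chart g ((rd (E 3 1) ^^ j) ((rd (E 3 1) ^^ b) ((rd (E 3 2) ^^ c) f))) =
      (partial 2 ^^ (j + b)) ((partial 3 ^^ c) (chart g f))" for j
    by (simp add: partial_power_chart f g smooth_rd_power funpow_add)
  then show ?thesis
    unfolding lowering_def by (subst chart_power[OF g])
      (simp_all add: smooth_rd_power f multi_partial_def)
qed

text \<open>At the origin all coefficients but the leading one vanish. Hence the values at one point of an
  arbitrary differential operator are those of a combination of the monomials.\<close>

lemma multi_partial_zero:
  assumes "smooth_on f GL3" "g \<in> GL3"
  shows "multi_partial \<alpha> (chart g f) 0 = lowering (\<alpha> $ 1) (\<alpha> $ 2) (\<alpha> $ 3) f g"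
proof -
  have "chart g (lowering (\<alpha> $ 1) (\<alpha> $ 2) (\<alpha> $ 3) f) 0 =
      (\<Sum>j\<le>\<alpha> $ 1. if j = 0 then multi_partial (vector [\<alpha> $ 1 - j, j + \<alpha> $ 2, \<alpha> $ 3]) (chart g f) 0 else 0)"
    unfolding chart_lowering[OF assms] by (intro sum.cong refl) auto
  also have "\<dots> = multi_partial (vector [\<alpha> $ 1, \<alpha> $ 2, \<alpha> $ 3]) (chart g f) 0"
    by (simp add: sum.delta)
  finally show ?thesis by (simp add: chart_def multi_partial_def)
qed

section \<open>Test functions\<close>

text \<open>After \<open>c\<close> derivatives a factor \<open>x\<^sub>i\<^bsup>k-c\<^esup>\<close> remains; the other factor is only known on the hyperplane
  \<open>x\<^sub>i = 0\<close>, which is enough for evaluation at the origin.\<close>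

lemma partial_power_monomial:
  assumes \<psi>: "smooth_on \<psi> UNIV"
  shows "c \<le> k \<Longrightarrow> \<exists>\<psi>'. smooth_on \<psi>' UNIV \<and>
    (partial i ^^ c) (\<lambda>x. of_real (x $ i) ^ k * \<psi> x) = (\<lambda>x. of_real (x $ i) ^ (k - c) * \<psi>' x) \<and>
    (\<forall>x. x $ i = 0 \<longrightarrow> \<psi>' x = fact k / fact (k - c) * \<psi> x)"
proof (induction c)
  case 0
  then show ?case using \<psi> by auto
next
  case (Suc c)
  then obtain \<psi>' where s: "smooth_on \<psi>' UNIV"
    and eq: "(partial i ^^ c) (\<lambda>x. of_real (x $ i) ^ k * \<psi> x) = (\<lambda>x. of_real (x $ i) ^ (k - c) * \<psi>' x)"
    and v: "\<And>x. x $ i = 0 \<Longrightarrow> \<psi>' x = fact k / fact (k - c) * \<psi> x"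
    by auto
  define m where "m = k - Suc c"
  have m: "k - c = Suc m" using Suc.prems by (simp add: m_def)
  have pw: "partial i (\<lambda>x. complex_of_real (x $ i) ^ n) = (\<lambda>x. of_nat n * of_real (x $ i) ^ (n - 1))" for n
  proof (induction n)
    case (Suc n)
    have "partial i (\<lambda>x. complex_of_real (x $ i) ^ Suc n) =
        (\<lambda>x. of_real (x $ i) * (of_nat n * of_real (x $ i) ^ (n - 1)) + of_real (x $ i) ^ n)"
      by (simp add: partial_mult smooth_coord smooth_on_power partial_coord Suc)
    then show ?case by (cases n) (simp_all add: fun_eq_iff algebra_simps)
  qed (simp add: partial_def)
  let ?\<psi> = "\<lambda>x. of_nat (Suc m) * \<psi>' x + of_real (x $ i) * partial i \<psi>' x"
  have "(partial i ^^ Suc c) (\<lambda>x. of_real (x $ i) ^ k * \<psi> x) = (\<lambda>x. of_real (x $ i) ^ m * ?\<psi> x)"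
  proof -
    have "(partial i ^^ Suc c) (\<lambda>x. of_real (x $ i) ^ k * \<psi> x) = partial i (\<lambda>x. of_real (x $ i) ^ Suc m * \<psi>' x)"
      by (simp only: funpow.simps o_apply eq m)
    also have "\<dots> = (\<lambda>x. of_real (x $ i) ^ Suc m * partial i \<psi>' x + (of_nat (Suc m) * of_real (x $ i) ^ m) * \<psi>' x)"
      by (subst partial_mult[OF smooth_on_power[OF open_UNIV smooth_coord] s]) (simp only: pw diff_Suc_1)
    finally show ?thesis by (simp add: fun_eq_iff algebra_simps)
  qed
  moreover have "smooth_on ?\<psi> UNIV"
    by (intro smooth_on_add smooth_on_mult smooth_coord smooth_partial s smooth_on_const open_UNIV)
  moreover have "?\<psi> x = fact k / fact m * \<psi> x" if "x $ i = 0" for x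
    using that v[OF that] by (simp add: m del: of_nat_Suc)
  ultimately show ?case unfolding m_def by blast
qed

lemma partial_power_monomial_at_zero:
  assumes "smooth_on \<psi> UNIV" "c \<le> k" "x $ i = 0"
  shows "(partial i ^^ c) (\<lambda>x. of_real (x $ i) ^ k * \<psi> x) x = (if c = k then fact k * \<psi> x else 0)"
  using partial_power_monomial[OF assms(1,2), of i] assms(2,3) by (auto simp: fun_eq_iff)

text \<open>A derivative along a slice only depends on the restriction to the slice.\<close>

lemma partial_slice:
  assumes \<phi>: "smooth_on \<phi> UNIV" and \<psi>: "smooth_on \<psi> UNIV"
    and S: "\<And>x t. x \<in> S \<Longrightarrow> x + t *\<^sub>R axis i 1 \<in> S"
    and eq: "\<And>x. x \<in> S \<Longrightarrow> \<phi> x = \<psi> x" and x: "x \<in> S"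
  shows "partial i \<phi> x = partial i \<psi> x"
proof -
  have l: "((\<lambda>t::real. x + t *\<^sub>R axis i 1) has_derivative (\<lambda>t. t *\<^sub>R axis i 1)) (at 0)"
    by (auto intro!: derivative_eq_intros)
  have d: "((\<lambda>t. \<theta> (x + t *\<^sub>R axis i 1)) has_derivative (\<lambda>t. frechet_derivative \<theta> (at x) (t *\<^sub>R axis i 1))) (at 0)"
    if "smooth_on \<theta> UNIV" for \<theta> :: "real^3 \<Rightarrow> complex"
    using has_derivative_compose[OF l smooth_on_has_derivative[OF that]] by simp
  have e: "(\<lambda>t. \<phi> (x + t *\<^sub>R axis i 1)) = (\<lambda>t. \<psi> (x + t *\<^sub>R axis i 1))"
    by (rule ext, rule eq, rule S, rule x)
  have "(\<lambda>t. frechet_derivative \<phi> (at x) (t *\<^sub>R axis i 1)) = (\<lambda>t. frechet_derivative \<psi> (at x) (t *\<^sub>R axis i 1))"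
    using d[OF \<phi>] d[OF \<psi>] unfolding e by (rule has_derivative_unique)
  from fun_cong[OF this, of 1] show ?thesis unfolding partial_def by simp
qed

lemma partial_power_slice:
  assumes \<phi>: "smooth_on \<phi> UNIV" and \<psi>: "smooth_on \<psi> UNIV"
    and S: "\<And>x t. x \<in> S \<Longrightarrow> x + t *\<^sub>R axis i 1 \<in> S"
    and eq: "\<And>x. x \<in> S \<Longrightarrow> \<phi> x = \<psi> x"
  shows "x \<in> S \<Longrightarrow> (partial i ^^ n) \<phi> x = (partial i ^^ n) \<psi> x"
proof (induction n arbitrary: x)
  case (Suc n)
  show ?case
    using partial_slice[OF smooth_partial_power[OF \<phi>] smooth_partial_power[OF \<psi>] S Suc.IH Suc.prems]
    by simp
qed (simp add: eq)

lemma partial_power_zero: "(partial i ^^ n) (\<lambda>x. 0) = (\<lambda>x. 0)"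
  by (induction n) (simp_all add: partial_def)

text \<open>The derivatives are taken in the order \<open>x\<^sub>3\<close>, \<open>x\<^sub>2\<close>, \<open>x\<^sub>1\<close>, and after each of the first two only the
  restriction to a coordinate subspace matters for the rest. A lexicographic comparison of the
  exponents in this order therefore decides whether the derivative at the origin vanishes, for every
  cofactor \<open>h\<close>.\<close>

lemma multi_partial_monomial:
  assumes h: "smooth_on h UNIV"
    and lex: "\<alpha> $ 3 < k \<or> \<alpha> $ 3 = k \<and> (\<alpha> $ 2 < j \<or> \<alpha> $ 2 = j \<and> \<alpha> $ 1 \<le> i)"
  shows "multi_partial \<alpha> (\<lambda>x. of_real (x $ 1) ^ i * of_real (x $ 2) ^ j * of_real (x $ 3) ^ k * h x) 0 =
    (if \<alpha> $ 1 = i \<and> \<alpha> $ 2 = j \<and> \<alpha> $ 3 = k then fact i * fact j * fact k * h 0 else 0)"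
proof -
  define h1 where "h1 = (\<lambda>x. fact j * fact k * h x)"
  define h2 where "h2 = (\<lambda>x::real^3. of_real (x $ 1) ^ i * (fact k * h x))"
  define h3 where "h3 = (\<lambda>x::real^3. of_real (x $ 1) ^ i * of_real (x $ 2) ^ j * h x)"
  have s1: "smooth_on h1 UNIV" and s2: "smooth_on h2 UNIV" and s3: "smooth_on h3 UNIV"
    unfolding h1_def h2_def h3_def
    by (intro smooth_on_mult smooth_on_power smooth_coord h smooth_on_const open_UNIV)+
  let ?F = "\<lambda>x. of_real (x $ 1) ^ i * of_real (x $ 2) ^ j * of_real (x $ 3) ^ k * h x"
  have F: "?F = (\<lambda>x. of_real (x $ 3) ^ k * h3 x)" by (simp add: h3_def fun_eq_iff)
  define F3 where "F3 = (partial 3 ^^ (\<alpha> $ 3)) (\<lambda>x. of_real (x $ 3) ^ k * h3 x)"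
  define G3 where "G3 = (\<lambda>x. if \<alpha> $ 3 = k then of_real (x $ 2) ^ j * h2 x else (0::complex))"
  have sF3: "smooth_on F3 UNIV" unfolding F3_def
    by (intro smooth_partial_power smooth_on_mult smooth_on_power smooth_coord s3 open_UNIV)
  have sG3: "smooth_on G3 UNIV" unfolding G3_def
    by (cases "\<alpha> $ 3 = k") (auto intro!: smooth_on_mult smooth_on_power smooth_coord s2)
  have FG3: "F3 x = G3 x" if "x \<in> {x. x $ 3 = 0}" for x
    using partial_power_monomial_at_zero[OF s3, of "\<alpha> $ 3" k x 3] lex that
    by (auto simp: F3_def G3_def h2_def h3_def)
  have eq2: "(partial 2 ^^ (\<alpha> $ 2)) F3 x = (partial 2 ^^ (\<alpha> $ 2)) G3 x" if "x \<in> {x. x $ 3 = 0}" for x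
    by (rule partial_power_slice[OF sF3 sG3 _ FG3 that]) (auto simp: axis_def)
  define F2 where "F2 = (partial 2 ^^ (\<alpha> $ 2)) F3"
  define G2 where "G2 = (\<lambda>x. if \<alpha> $ 3 = k \<and> \<alpha> $ 2 = j then of_real (x $ 1) ^ i * h1 x else (0::complex))"
  have sF2: "smooth_on F2 UNIV" unfolding F2_def by (intro smooth_partial_power sF3)
  have sG2: "smooth_on G2 UNIV" unfolding G2_def
    by (cases "\<alpha> $ 3 = k \<and> \<alpha> $ 2 = j") (auto intro!: smooth_on_mult smooth_on_power smooth_coord s1)
  have FG2: "F2 x = G2 x" if "x \<in> {x. x $ 2 = 0 \<and> x $ 3 = 0}" for x
    using partial_power_monomial_at_zero[OF s2, of "\<alpha> $ 2" j x 2] lex that eq2[of x]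
    by (auto simp: F2_def G2_def G3_def h1_def h2_def partial_power_zero)
  have "(partial 1 ^^ (\<alpha> $ 1)) F2 0 = (partial 1 ^^ (\<alpha> $ 1)) G2 0"
  proof (rule partial_power_slice[OF sF2 sG2])
    show "x + t *\<^sub>R axis 1 1 \<in> {x. x $ 2 = 0 \<and> x $ 3 = 0}" if "x \<in> {x. x $ 2 = 0 \<and> x $ 3 = 0}" for x :: "real^3" and t
      using that by (simp add: axis_def)
    show "0 \<in> {x::real^3. x $ 2 = 0 \<and> x $ 3 = 0}" by simp
  qed (rule FG2)
  also have "\<dots> = (if \<alpha> $ 1 = i \<and> \<alpha> $ 2 = j \<and> \<alpha> $ 3 = k then fact i * fact j * fact k * h 0 else 0)"
    using partial_power_monomial_at_zero[OF s1, of "\<alpha> $ 1" i 0 1] lex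
    by (auto simp: G2_def h1_def partial_power_zero)
  finally show ?thesis unfolding multi_partial_def F F2_def F3_def .
qed

lemma exists_nat_parity: "\<exists>n::nat. of_nat (n + m) = (e::bit)"
proof (cases "of_nat m = e")
  case True
  then show ?thesis by (intro exI[of _ 0]) simp
next
  case False
  then have "of_nat (1 + m) = e" by (cases e; cases "of_nat m :: bit") simp_all
  then show ?thesis by blast
qed

lemma sign_char_power:
  assumes "m = 1 \<or> m = -1"
  shows "sign_char (of_nat n) m = m ^ n"
  using assms by (induction n) (auto simp: sign_char_def split: if_splits)

lemma powr_homogeneous:
  assumes "r > 0" "q > 0"
  shows "complex_of_real r ^ n * (of_real r ^ 2 * of_real q) powr s = of_real r powr (of_nat n + 2 * s) * of_real q powr s"
proof -
  have "(of_real r ^ 2 * of_real q) powr s = ((of_real r * of_real r) powr s) * of_real q powr s"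
    using assms by (subst powr_times_real) (simp_all add: power2_eq_square flip: of_real_mult)
  also have "(complex_of_real r * of_real r) powr s = of_real r powr (2 * s)"
    using assms by (subst powr_times_real) (simp_all add: powr_add[symmetric])
  finally show ?thesis using assms by (simp add: powr_add powr_nat')
qed

definition minor12 :: "mat3 \<Rightarrow> real" where "minor12 g = g$1$1 * g$2$2 - g$2$1 * g$1$2"
definition minor13 :: "mat3 \<Rightarrow> real" where "minor13 g = g$1$1 * g$3$2 - g$3$1 * g$1$2"
definition minor23 :: "mat3 \<Rightarrow> real" where "minor23 g = g$2$1 * g$3$2 - g$3$1 * g$2$2"
definition col_sq :: "mat3 \<Rightarrow> real" where "col_sq g = (g$1$1)\<^sup>2 + (g$2$1)\<^sup>2 + (g$3$1)\<^sup>2"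
definition minor_sq :: "mat3 \<Rightarrow> real" where "minor_sq g = (minor12 g)\<^sup>2 + (minor13 g)\<^sup>2 + (minor23 g)\<^sup>2"

lemmas minor_defs = minor12_def minor13_def minor23_def

lemma sum_sq3_pos: "x \<noteq> 0 \<or> y \<noteq> 0 \<or> z \<noteq> 0 \<Longrightarrow> x\<^sup>2 + y\<^sup>2 + z\<^sup>2 > (0::real)"
  by (smt (verit) zero_le_power2 zero_less_power2)

lemma col_sq_pos: "g \<in> GL3 \<Longrightarrow> col_sq g > 0"
  unfolding col_sq_def by (rule sum_sq3_pos) (auto simp: GL3_det det_3)

lemma minor_sq_pos:
  assumes "g \<in> GL3"
  shows "minor_sq g > 0"
proof -
  have "det g = minor12 g * g$3$3 - minor13 g * g$2$3 + minor23 g * g$1$3"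
    by (simp add: det_3 minor_defs algebra_simps)
  then show ?thesis
    unfolding minor_sq_def by (intro sum_sq3_pos) (use assms in \<open>auto simp: GL3_det\<close>)
qed

lemma smooth_entry: "smooth_on (\<lambda>g::mat3. complex_of_real (g $ i $ j)) S"
  using smooth_on_entry[of "mat 1" i j S] by simp

lemma smooth_on_diff:
  assumes "open S" "smooth_on f S" "smooth_on g S"
  shows "smooth_on (\<lambda>x. f x - g x :: complex) S"
  using smooth_on_add[OF assms(1,2) smooth_on_mult[OF assms(1) smooth_on_const[of "-1"] assms(3)]] by simp

lemmas smooth_intros = smooth_on_add smooth_on_mult smooth_on_power smooth_on_diff smooth_on_const
  smooth_entry smooth_coord open_GL3 open_UNIV

text \<open>The first column and the \<open>2 \<times> 2\<close> minors of the first two columns are invariant under the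
  unipotent group and homogeneous under diagonal matrices. A monomial in them, corrected by complex
  powers of their norms, has any prescribed equivariance.\<close>

lemma exists_test_function:
  "\<exists>f\<in>principal_series \<xi> \<mu>. \<exists>h. smooth_on h UNIV \<and> h 0 = 1 \<and>
     chart (mat 1) f = (\<lambda>x. of_real (x $ 1) ^ i * of_real (x $ 2) ^ j * of_real (x $ 3) ^ k * h x)"
proof -
  \<comment> \<open>The integral exponents \<open>e1\<close>, \<open>e2\<close>, \<open>e3\<close> adjust the signs; the complex exponents \<open>s1\<close>, \<open>s2\<close>, \<open>s3\<close>
    of the squared norms, which are invariant under signs, then adjust the positive part.\<close>
  obtain e3 :: nat where e3: "of_nat (e3 + 0) = \<xi> $ 3" using exists_nat_parity by blast
  obtain e2 where e2: "of_nat (e2 + (k + e3)) = \<xi> $ 2" using exists_nat_parity by blast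
  obtain e1 where e1: "of_nat (e1 + (i + j + (e2 + k + e3))) = \<xi> $ 1" using exists_nat_parity by blast
  define n1 n2 where "n1 = e1 + i + j" and "n2 = e2 + k"
  define s1 where "s1 = (\<mu> $ 2 - \<mu> $ 1 - of_nat n1) / 2"
  define s2 where "s2 = (\<mu> $ 3 - \<mu> $ 2 - of_nat n2) / 2"
  define s3 where "s3 = (- \<mu> $ 3 - of_nat e3) / 2"
  define A where "A g = complex_of_real (g$1$1) ^ e1 * of_real (g$2$1) ^ i * of_real (g$3$1) ^ j" for g :: mat3
  define B where "B g = complex_of_real (minor12 g) ^ e2 * of_real (minor13 g) ^ k" for g
  define C where "C g = complex_of_real (det g) ^ e3" for g :: mat3
  define P where "P g = of_real (col_sq g) powr s1 * of_real (minor_sq g) powr s2 * of_real ((det g)\<^sup>2) powr s3" for g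
  define f where "f g = (if g \<in> GL3 then A g * B g * C g * P g else 0)" for g
  have "f \<in> principal_series \<xi> \<mu>"
  proof (rule principal_seriesI)
    have sA: "smooth_on A GL3" unfolding A_def by (intro smooth_intros)
    have sB: "smooth_on B GL3" unfolding B_def minor_defs of_real_diff of_real_mult by (intro smooth_intros)
    have sC: "smooth_on C GL3" unfolding C_def det_3 of_real_diff of_real_mult of_real_add by (intro smooth_intros)
    have sP: "smooth_on P GL3"
      unfolding P_def
    proof (intro smooth_on_mult open_GL3 smooth_on_powr)
      show "smooth_on (\<lambda>g. complex_of_real (col_sq g)) GL3"
        unfolding col_sq_def of_real_add of_real_power by (intro smooth_intros)
      show "smooth_on (\<lambda>g. complex_of_real (minor_sq g)) GL3"
        unfolding minor_sq_def minor_defs of_real_add of_real_power of_real_diff of_real_mult by (intro smooth_intros)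
      show "smooth_on (\<lambda>g. complex_of_real ((det g)\<^sup>2)) GL3"
        unfolding det_3 of_real_add of_real_power of_real_diff of_real_mult by (intro smooth_intros)
      show "complex_of_real (col_sq g) \<notin> \<real>\<^sub>\<le>\<^sub>0" if "g \<in> GL3" for g
        using col_sq_pos[OF that] by simp
      show "complex_of_real (minor_sq g) \<notin> \<real>\<^sub>\<le>\<^sub>0" if "g \<in> GL3" for g
        using minor_sq_pos[OF that] by simp
      show "complex_of_real ((det g)\<^sup>2) \<notin> \<real>\<^sub>\<le>\<^sub>0" if "g \<in> GL3" for g :: mat3
        using that by (simp add: GL3_det power2_eq_square mult_le_0_iff del: of_real_power of_real_mult)
    qed
    have "smooth_on (\<lambda>g. A g * B g * C g * P g) GL3"
      by (intro smooth_on_mult open_GL3 sA sB sC sP)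
    then show "smooth_on f GL3"
      by (rule smooth_on_cong[OF open_GL3, rotated]) (simp add: f_def)
  next
    show "f g = 0" if "g \<notin> GL3" for g using that by (simp add: f_def)
  next
    fix g and m :: "real^3" assume g: "g \<in> GL3" and m: "\<And>l. m $ l = 1 \<or> m $ l = -1"
    have "diag m \<in> GL3" unfolding diag_GL3 using m by (metis neg_equal_0_iff_equal zero_neq_one)
    then have gm: "g ** diag m \<in> GL3" using g by simp
    have sq: "(m $ l)\<^sup>2 = 1" for l using m[of l] by auto
    have ent: "(g ** diag m) $ l $ l' = g $ l $ l' * m $ l'" for l l'
      using exhaust_3[of l'] by (auto simp: matrix_matrix_mult_def sum_3 diag_def)
    have A: "A (g ** diag m) = of_real (m $ 1) ^ n1 * A g"
      by (simp add: A_def ent n1_def power_mult_distrib power_add)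
    have mi: "minor12 (g ** diag m) = m$1 * m$2 * minor12 g" "minor13 (g ** diag m) = m$1 * m$2 * minor13 g"
        "minor23 (g ** diag m) = m$1 * m$2 * minor23 g"
      by (simp_all add: minor_defs ent algebra_simps)
    have de: "det (g ** diag m) = m$1 * m$2 * m$3 * det g"
      by (simp add: det_mul) (simp add: det_3 diag_def)
    have B: "B (g ** diag m) = of_real (m $ 1) ^ n2 * of_real (m $ 2) ^ n2 * B g"
      by (simp add: B_def mi n2_def power_mult_distrib power_add)
    have C: "C (g ** diag m) = of_real (m $ 1) ^ e3 * of_real (m $ 2) ^ e3 * of_real (m $ 3) ^ e3 * C g"
      by (simp add: C_def de power_mult_distrib)
    have P: "P (g ** diag m) = P g"
      by (simp add: P_def col_sq_def minor_sq_def mi de ent power_mult_distrib sq)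
    have s: "sign_char (\<xi> $ 1) (m $ 1) = (m $ 1) ^ (n1 + n2 + e3)"
      "sign_char (\<xi> $ 2) (m $ 2) = (m $ 2) ^ (n2 + e3)" "sign_char (\<xi> $ 3) (m $ 3) = (m $ 3) ^ e3"
      unfolding e1[symmetric] e2[symmetric] e3[symmetric] sign_char_power[OF m]
      by (simp_all add: n1_def n2_def ac_simps)
    show "f (g ** diag m) = (\<Prod>l\<in>UNIV. complex_of_real (sign_char (\<xi> $ l) (m $ l))) * f g"
    proof -
      have "(\<Prod>l\<in>UNIV. complex_of_real (sign_char (\<xi> $ l) (m $ l))) =
          of_real (m $ 1) ^ (n1 + n2 + e3) * of_real (m $ 2) ^ (n2 + e3) * of_real (m $ 3) ^ e3"
        by (simp only: UNIV_3) (simp add: s mult.assoc)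
      then show ?thesis using g gm by (simp only: f_def A B C P if_True power_add mult_ac)
    qed
  next
    fix g and a :: "real^3" assume g: "g \<in> GL3" and a: "\<And>l. a $ l > 0"
    have a0: "a $ l \<noteq> 0" for l using a[of l] by simp
    then have "diag a \<in> GL3" unfolding diag_GL3 by blast
    then have ga: "g ** diag a \<in> GL3" using g by simp
    have ent: "(g ** diag a) $ l $ l' = g $ l $ l' * a $ l'" for l l'
      using exhaust_3[of l'] by (auto simp: matrix_matrix_mult_def sum_3 diag_def)
    let ?b = "a $ 1 * a $ 2" let ?c = "a $ 1 * a $ 2 * a $ 3"
    have A: "A (g ** diag a) = of_real (a $ 1) ^ n1 * A g"
      by (simp add: A_def ent n1_def power_mult_distrib power_add)
    have mi: "minor12 (g ** diag a) = ?b * minor12 g" "minor13 (g ** diag a) = ?b * minor13 g"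
        "minor23 (g ** diag a) = ?b * minor23 g"
      by (simp_all add: minor_defs ent algebra_simps)
    have de: "det (g ** diag a) = ?c * det g"
      by (simp add: det_mul) (simp add: det_3 diag_def)
    have B: "B (g ** diag a) = of_real ?b ^ n2 * B g"
      by (simp add: B_def mi n2_def power_mult_distrib power_add)
    have C: "C (g ** diag a) = of_real ?c ^ e3 * C g"
      by (simp add: C_def de power_mult_distrib)
    have q: "complex_of_real (col_sq (g ** diag a)) = of_real (a $ 1) ^ 2 * of_real (col_sq g)"
      "complex_of_real (minor_sq (g ** diag a)) = of_real ?b ^ 2 * of_real (minor_sq g)"
      "complex_of_real ((det (g ** diag a))\<^sup>2) = of_real ?c ^ 2 * of_real ((det g)\<^sup>2)"
      by (simp_all only: col_sq_def minor_sq_def mi de ent power_mult_distrib of_real_mult of_real_power of_real_add)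
         (simp_all add: algebra_simps)
    have "f (g ** diag a) = (of_real (a $ 1) ^ n1 * of_real (col_sq (g ** diag a)) powr s1) *
        (of_real ?b ^ n2 * of_real (minor_sq (g ** diag a)) powr s2) *
        (of_real ?c ^ e3 * of_real ((det (g ** diag a))\<^sup>2) powr s3) * (A g * B g * C g)"
      using g ga by (simp only: f_def A B C P_def if_True mult_ac)
    also have "\<dots> = (of_real (a $ 1) powr (\<mu> $ 2 - \<mu> $ 1) * of_real (col_sq g) powr s1) *
        (of_real ?b powr (\<mu> $ 3 - \<mu> $ 2) * of_real (minor_sq g) powr s2) *
        (of_real ?c powr (- \<mu> $ 3) * of_real ((det g)\<^sup>2) powr s3) * (A g * B g * C g)"
    proof -
      have ex: "of_nat n1 + 2 * s1 = \<mu> $ 2 - \<mu> $ 1" "of_nat n2 + 2 * s2 = \<mu> $ 3 - \<mu> $ 2"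
          "of_nat e3 + 2 * s3 = - \<mu> $ 3"
        unfolding s1_def s2_def s3_def by (simp_all add: field_simps)
      have "of_real (a $ 1) ^ n1 * of_real (col_sq (g ** diag a)) powr s1 =
          of_real (a $ 1) powr (\<mu> $ 2 - \<mu> $ 1) * of_real (col_sq g) powr s1"
        unfolding q ex[symmetric] by (rule powr_homogeneous[OF a col_sq_pos[OF g]])
      moreover have "of_real ?b ^ n2 * of_real (minor_sq (g ** diag a)) powr s2 =
          of_real ?b powr (\<mu> $ 3 - \<mu> $ 2) * of_real (minor_sq g) powr s2"
        unfolding q ex[symmetric] by (rule powr_homogeneous[OF mult_pos_pos[OF a a] minor_sq_pos[OF g]])
      moreover have "of_real ?c ^ e3 * of_real ((det (g ** diag a))\<^sup>2) powr s3 =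
          of_real ?c powr (- \<mu> $ 3) * of_real ((det g)\<^sup>2) powr s3"
        unfolding q ex[symmetric]
        by (rule powr_homogeneous[OF mult_pos_pos[OF mult_pos_pos[OF a a] a]]) (use g in \<open>simp add: GL3_det\<close>)
      ultimately show ?thesis by (simp only:)
    qed
    also have "of_real ?b powr (\<mu> $ 3 - \<mu> $ 2) = of_real (a $ 1) powr (\<mu> $ 3 - \<mu> $ 2) * of_real (a $ 2) powr (\<mu> $ 3 - \<mu> $ 2)"
      using a[of 1] a[of 2] by (simp add: powr_times_real)
    also have "of_real ?c powr (- \<mu> $ 3) = of_real (a $ 1) powr (- \<mu> $ 3) * of_real (a $ 2) powr (- \<mu> $ 3) * of_real (a $ 3) powr (- \<mu> $ 3)"
      using a[of 1] a[of 2] a[of 3] by (simp add: powr_times_real)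
    finally have "f (g ** diag a) =
        (of_real (a $ 1) powr (\<mu> $ 2 - \<mu> $ 1) * of_real (a $ 1) powr (\<mu> $ 3 - \<mu> $ 2) * of_real (a $ 1) powr (- \<mu> $ 3)) *
        (of_real (a $ 2) powr (\<mu> $ 3 - \<mu> $ 2) * of_real (a $ 2) powr (- \<mu> $ 3)) * of_real (a $ 3) powr (- \<mu> $ 3) * f g"
      using g by (simp only: f_def P_def if_True mult_ac)
    also have "\<dots> = of_real (a $ 1) powr (- \<mu> $ 1) * of_real (a $ 2) powr (- \<mu> $ 2) * of_real (a $ 3) powr (- \<mu> $ 3) * f g"
      by (simp add: powr_add[symmetric])
    also have "of_real (a $ 1) powr (- \<mu> $ 1) * of_real (a $ 2) powr (- \<mu> $ 2) * of_real (a $ 3) powr (- \<mu> $ 3) =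
        (\<Prod>l\<in>UNIV. complex_of_real (a $ l) powr (- (\<mu> $ l)))"
      by (simp only: UNIV_3) (simp add: mult.assoc)
    finally show "f (g ** diag a) = (\<Prod>l\<in>UNIV. complex_of_real (a $ l) powr (- (\<mu> $ l))) * f g" .
  next
    fix g n assume g: "g \<in> GL3" and n: "n \<in> upper_unip"
    obtain x y z where n': "n = vector [vector [1, x, y], vector [0, 1, z], vector [0, 0, 1]]"
      using n unfolding upper_unip_def by blast
    have c: "(g ** n) $ l $ 1 = g $ l $ 1" "(g ** n) $ l $ 2 = g $ l $ 1 * x + g $ l $ 2" for l
      by (simp_all add: matrix_matrix_mult_def sum_3 n')
    have mi: "minor12 (g ** n) = minor12 g" "minor13 (g ** n) = minor13 g" "minor23 (g ** n) = minor23 g"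
      by (simp_all add: minor_defs c algebra_simps)
    have de: "det (g ** n) = det g" by (simp add: det_mul) (simp add: det_3 n')
    have gn: "g ** n \<in> GL3" using g upper_unip_GL3[OF n] by simp
    show "f (g ** n) = f g"
      using g gn by (simp only: f_def A_def B_def C_def P_def col_sq_def minor_sq_def mi de c if_True)
  qed
  moreover
  let ?h = "\<lambda>x::real^3. (1 + of_real (x$1) ^ 2 + of_real (x$2) ^ 2) powr s1 *
      (1 + of_real (x$3) ^ 2 + (of_real (x$1) * of_real (x$3) - of_real (x$2)) ^ 2) powr s2"
  have "smooth_on ?h UNIV"
  proof (intro smooth_on_mult smooth_on_powr open_UNIV)
    show "smooth_on (\<lambda>x::real^3. 1 + complex_of_real (x$1) ^ 2 + of_real (x$2) ^ 2) UNIV"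
      "smooth_on (\<lambda>x::real^3. 1 + complex_of_real (x$3) ^ 2 + (of_real (x$1) * of_real (x$3) - of_real (x$2)) ^ 2) UNIV"
      by (intro smooth_intros)+
    have pos: "1 + complex_of_real u ^ 2 + of_real v ^ 2 \<notin> \<real>\<^sub>\<le>\<^sub>0" for u v
    proof -
      have "1 + complex_of_real u ^ 2 + of_real v ^ 2 = of_real (1 + u\<^sup>2 + v\<^sup>2)" by simp
      moreover have "1 + u\<^sup>2 + v\<^sup>2 > 0" by (smt (verit) zero_le_power2)
      ultimately show ?thesis by (metis complex_nonpos_Reals_iff Re_complex_of_real not_less)
    qed
    show "1 + complex_of_real (x$1) ^ 2 + of_real (x$2) ^ 2 \<notin> \<real>\<^sub>\<le>\<^sub>0" for x :: "real^3" by (rule pos)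
    show "1 + complex_of_real (x$3) ^ 2 + (of_real (x$1) * of_real (x$3) - of_real (x$2)) ^ 2 \<notin> \<real>\<^sub>\<le>\<^sub>0" for x :: "real^3"
      using pos[of "x$3" "x$1 * x$3 - x$2"] by simp
  qed
  moreover have "chart (mat 1) f x = of_real (x $ 1) ^ i * of_real (x $ 2) ^ j * of_real (x $ 3) ^ k * ?h x" for x
  proof -
    have d: "det (lower_unip x) = 1" by (simp add: det_3 lower_unip_def)
    have "A (lower_unip x) = of_real (x $ 1) ^ i * of_real (x $ 2) ^ j"
      "B (lower_unip x) = of_real (x $ 3) ^ k" "C (lower_unip x) = 1" "P (lower_unip x) = ?h x"
      by (simp_all add: A_def B_def C_def P_def d) (simp_all add: minor_defs lower_unip_def col_sq_def minor_sq_def)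
    then show ?thesis by (simp add: chart_def f_def)
  qed
  ultimately show ?thesis
    by (intro bexI[of _ f] exI[of _ ?h]) (auto simp: fun_eq_iff)
qed

lemma finite_nat_maximal:
  assumes "finite S" "S \<noteq> {}"
  obtains x where "x \<in> S" "\<And>y. y \<in> S \<Longrightarrow> (w y :: nat) \<le> w x"
proof -
  have "Max (w ` S) \<in> w ` S" using assms by simp
  then obtain x where "x \<in> S" "w x = Max (w ` S)" by auto
  then show ?thesis using that[of x] assms by simp
qed

text \<open>A test function whose exponents are those of the lexicographically largest term isolates its
  coefficient.\<close>

lemma lowering_independent:
  assumes T: "finite T"
    and zero: "\<And>f. f \<in> principal_series \<xi> \<mu> \<Longrightarrow> (\<Sum>(a, b, c)\<in>T. d (a, b, c) * lowering a b c f (mat 1)) = 0"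
    and t: "t \<in> T"
  shows "d t = (0::complex)"
proof (rule ccontr)
  assume "d t \<noteq> 0"
  define S where "S = {t \<in> T. d t \<noteq> 0}"
  have "t \<in> S" using t \<open>d t \<noteq> 0\<close> by (simp add: S_def)
  then have S: "finite S" "S \<noteq> {}" using T unfolding S_def by (simp, blast)
  obtain t3 where t3: "t3 \<in> S" "\<And>y. y \<in> S \<Longrightarrow> snd (snd y) \<le> snd (snd t3)"
    using finite_nat_maximal[OF S, of "\<lambda>y. snd (snd y)"] by blast
  define S2 where "S2 = {y \<in> S. snd (snd y) = snd (snd t3)}"
  have "t3 \<in> S2" using t3(1) by (simp add: S2_def)
  then have S2: "finite S2" "S2 \<noteq> {}" using S(1) unfolding S2_def by (simp, blast)
  obtain t2 where t2: "t2 \<in> S2" "\<And>y. y \<in> S2 \<Longrightarrow> fst (snd y) \<le> fst (snd t2)"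
    using finite_nat_maximal[OF S2, of "\<lambda>y. fst (snd y)"] by blast
  define S1 where "S1 = {y \<in> S2. fst (snd y) = fst (snd t2)}"
  have "t2 \<in> S1" using t2(1) by (simp add: S1_def)
  then have S1: "finite S1" "S1 \<noteq> {}" using S2(1) unfolding S1_def by (simp, blast)
  obtain t1 where t1: "t1 \<in> S1" "\<And>y. y \<in> S1 \<Longrightarrow> fst y \<le> fst t1"
    using finite_nat_maximal[OF S1, of fst] by blast
  obtain i j k where ijk: "t1 = (i, j, k)" by (cases t1)
  have t1S: "(i, j, k) \<in> T" "d (i, j, k) \<noteq> 0" using t1(1) ijk by (auto simp: S1_def S2_def S_def)
  have lex: "c < k \<or> c = k \<and> (b < j \<or> b = j \<and> a \<le> i)" if "(a, b, c) \<in> T" "d (a, b, c) \<noteq> 0" for a b c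
  proof -
    have y: "(a, b, c) \<in> S" using that by (simp add: S_def)
    have k: "k = snd (snd t3)" "j = fst (snd t2)" using t1(1) ijk by (auto simp: S1_def S2_def)
    show ?thesis
      using t3(2)[OF y] t2(2)[of "(a, b, c)"] t1(2)[of "(a, b, c)"] y ijk k by (auto simp: S1_def S2_def)
  qed
  obtain f h where f: "f \<in> principal_series \<xi> \<mu>" and h: "smooth_on h UNIV" "h 0 = 1"
    and ch: "chart (mat 1) f = (\<lambda>x. of_real (x $ 1) ^ i * of_real (x $ 2) ^ j * of_real (x $ 3) ^ k * h x)"
    using exists_test_function by blast
  have ev: "d (a, b, c) * lowering a b c f (mat 1) = (if (a, b, c) = (i, j, k) then d (i, j, k) * (fact i * fact j * fact k) else 0)"
    if "(a, b, c) \<in> T" for a b c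
  proof (cases "d (a, b, c) = 0")
    case False
    then show ?thesis
      using multi_partial_zero[OF principal_series_smooth[OF f] GL3_one, of "vector [a, b, c]"]
        multi_partial_monomial[OF h(1), of "vector [a, b, c]" k j i] lex[OF that False] h(2)
      by (auto simp: ch split: if_splits)
  qed (use t1S in auto)
  have "0 = (\<Sum>(a, b, c)\<in>T. d (a, b, c) * lowering a b c f (mat 1))"
    using zero[OF f] by simp
  also have "\<dots> = (\<Sum>y\<in>T. if y = (i, j, k) then d (i, j, k) * (fact i * fact j * fact k) else 0)"
  proof (rule sum.cong[OF refl])
    fix y assume "y \<in> T"
    then show "(case y of (a, b, c) \<Rightarrow> d (a, b, c) * lowering a b c f (mat 1)) =
        (if y = (i, j, k) then d (i, j, k) * (fact i * fact j * fact k) else 0)"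
      by (cases y) (simp only: prod.case ev)
  qed
  also have "\<dots> = d (i, j, k) * (fact i * fact j * fact k)"
    using T t1S by (simp add: sum.delta)
  finally show False using t1S by simp
qed

section \<open>Singular vectors\<close>

text \<open>The coefficients of a vector of weight \<open>- (p \<alpha>\<^sub>1 + q \<alpha>\<^sub>2)\<close> that is killed by the two simple
  positive root vectors; \<open>h1\<close> and \<open>h2\<close> are the values of the highest weight on the simple coroots.\<close>

definition singular :: "nat \<Rightarrow> nat \<Rightarrow> complex \<Rightarrow> complex \<Rightarrow> (nat \<Rightarrow> complex) \<Rightarrow> bool" where
  "singular p q h1 h2 e \<longleftrightarrow> (\<forall>b>min p q. e b = 0) \<and>
     (\<forall>b\<le>min p q.
        of_nat (Suc b) * e (Suc b) = of_nat (p - b) * (h1 + of_nat q - of_nat p - of_nat b + 1) * e b \<and>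
        of_nat (Suc b) * e (Suc b) = - of_nat (q - b) * (h2 - of_nat q + of_nat b + 1) * e b)"

text \<open>Up to the shift by half the sum of the positive roots, the new weight is a permutation of the old
  one. The first three cases are the identity and the simple reflections, the last three are the
  two cycles of length three and the reflection in the highest root.\<close>

definition linked :: "nat \<Rightarrow> nat \<Rightarrow> complex \<Rightarrow> complex \<Rightarrow> bool" where
  "linked p q h1 h2 \<longleftrightarrow>
     p = 0 \<and> q = 0 \<or>
     p = 0 \<and> q > 0 \<and> h2 = of_nat q - 1 \<or>
     p > 0 \<and> q = 0 \<and> h1 = of_nat p - 1 \<or>
     p > 0 \<and> q > 0 \<and>
       (h1 = of_nat p - of_nat q - 1 \<and> h2 = of_nat q - 1 \<or>
        h1 = of_nat p - 1 \<and> h2 = of_nat q - of_nat p - 1 \<or>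
        p = q \<and> h1 + h2 = of_nat p - 2)"

text \<open>The first recursion alone determines \<open>e\<close> from \<open>e 0\<close>, because its left factor \<open>Suc b\<close> is never zero.\<close>

lemma singular_unique:
  assumes "singular p q h1 h2 e" "singular p q h1 h2 e'"
  shows "e' 0 * e b = e 0 * e' b"
proof (induction b)
  case (Suc b)
  show ?case
  proof (cases "b \<le> min p q")
    case True
    let ?r = "of_nat (p - b) * (h1 + of_nat q - of_nat p - of_nat b + 1)"
    have "of_nat (Suc b) * e (Suc b) = ?r * e b" "of_nat (Suc b) * e' (Suc b) = ?r * e' b"
      using assms True unfolding singular_def by blast+
    then have "of_nat (Suc b) * (e' 0 * e (Suc b)) = ?r * (e' 0 * e b)"
      "of_nat (Suc b) * (e 0 * e' (Suc b)) = ?r * (e 0 * e' b)"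
      by (metis mult.left_commute)+
    then have "of_nat (Suc b) * (e' 0 * e (Suc b)) = of_nat (Suc b) * (e 0 * e' (Suc b))"
      using Suc by (simp only:)
    then show ?thesis by (simp del: of_nat_Suc)
  next
    case False
    then have "e (Suc b) = 0" "e' (Suc b) = 0" using assms unfolding singular_def by auto
    then show ?thesis by simp
  qed
qed simp

lemma singular_nonzero:
  assumes "singular p q h1 h2 e" "e b \<noteq> 0"
  shows "e 0 \<noteq> 0"
proof
  assume e0: "e 0 = 0"
  have "e b = 0" for b
  proof (induction b)
    case (Suc b)
    show ?case
    proof (cases "b \<le> min p q")
      case True
      then have "of_nat (Suc b) * e (Suc b) = of_nat (p - b) * (h1 + of_nat q - of_nat p - of_nat b + 1) * e b"
        using assms(1) unfolding singular_def by blast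
      then show ?thesis using Suc by (simp del: of_nat_Suc)
    qed (use assms(1) in \<open>auto simp: singular_def\<close>)
  qed (rule e0)
  then show False using assms(2) by simp
qed

text \<open>Equating the two recursions gives an affine function of \<open>b\<close>. It vanishes at \<open>b = 0\<close>, and at
  \<open>b = 1\<close> unless the second coefficient is zero.\<close>

lemma singular_imp_linked:
  assumes s: "singular p q h1 h2 e" and nz: "e b \<noteq> 0"
  shows "linked p q h1 h2"
proof -
  define A where "A = h1 + of_nat q - of_nat p + 1"
  define B where "B = h2 - of_nat q + 1"
  have e0: "e 0 \<noteq> 0" using singular_nonzero[OF s nz] .
  have e1: "e 1 = of_nat p * A * e 0" "e 1 = - of_nat q * B * e 0"
    using s unfolding singular_def A_def B_def by (auto dest!: spec[of _ 0])
  then have "(of_nat p * A + of_nat q * B) * e 0 = 0" by (simp add: distrib_right)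
  then have AB: "of_nat p * A + of_nat q * B = 0" using e0 by simp
  have h: "h1 = A + of_nat p - of_nat q - 1" "h2 = B + of_nat q - 1"
    by (simp_all add: A_def B_def)
  show ?thesis
  proof (cases "p = 0 \<or> q = 0 \<or> A = 0")
    case True
    then consider "p = 0 \<and> q = 0" | "p = 0 \<and> q > 0 \<and> B = 0" | "p > 0 \<and> q = 0 \<and> A = 0"
      | "p > 0 \<and> q > 0 \<and> A = 0 \<and> B = 0"
      using AB by (cases "p = 0"; cases "q = 0") auto
    then show ?thesis unfolding linked_def h by cases auto
  next
    case False
    then have e1nz: "e 1 \<noteq> 0" unfolding e1(1) using e0 by simp
    have "1 \<le> min p q" using False by simp
    then have "of_nat (p - 1) * (h1 + of_nat q - of_nat p - of_nat 1 + 1) * e 1 =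
        - of_nat (q - 1) * (h2 - of_nat q + of_nat 1 + 1) * e 1"
      using s unfolding singular_def by metis
    moreover have "h1 + of_nat q - of_nat p - of_nat 1 + 1 = A - 1" "h2 - of_nat q + of_nat 1 + 1 = B + 1"
      by (simp_all add: A_def B_def)
    ultimately have "of_nat (p - 1) * (A - 1) = - of_nat (q - 1) * (B + 1)"
      by (simp only: mult_right_cancel[OF e1nz])
    then have *: "(of_nat p - 1) * (A - 1) + (of_nat q - 1) * (B + 1) = 0"
      using False by (simp add: of_nat_diff)
    have "A + B = of_nat q - of_nat p"
      using * AB by (simp add: algebra_simps)
    then have B: "B = of_nat q - of_nat p - A" by (simp add: algebra_simps)
    have "(of_nat p - of_nat q) * (A - of_nat q) = 0"
      using AB unfolding B by (simp add: algebra_simps)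
    then have "p = q \<or> A = of_nat q" by auto
    then show ?thesis
    proof
      assume "p = q"
      then show ?thesis using False unfolding linked_def h B by simp
    next
      assume A: "A = of_nat q"
      have "h1 = of_nat p - 1" "h2 = of_nat q - of_nat p - 1" unfolding h B A by simp_all
      then show ?thesis using False unfolding linked_def by simp
    qed
  qed
qed

text \<open>The product formula solves the first recursion. It remains to see that the second one has the same
  factors, up to those multiplying a vanishing coefficient, and that the first one stops at \<open>min p q\<close>.\<close>

lemma linked_imp_singular:
  assumes "linked p q h1 h2"
  shows "\<exists>e. singular p q h1 h2 e \<and> e 0 = 1"
proof -
  define r where "r b = of_nat (p - b) * (h1 + of_nat q - of_nat p - of_nat b + 1)" for b
  define s where "s b = - of_nat (q - b) * (h2 - of_nat q + of_nat b + 1)" for b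
  define e where "e b = (if b \<le> min p q then \<Prod>j<b. r j / of_nat (Suc j) else 0)" for b
  have e0: "e 0 = 1" by (simp add: e_def)
  have gt: "e b = 0" if "b > min p q" for b
    unfolding e_def using that by (intro if_not_P) (simp only: not_le)
  have step: "of_nat (Suc b) * e (Suc b) = r b * e b" if "b < min p q" for b
    using that by (simp add: e_def del: of_nat_Suc)
  have vanish: "e b = 0" if r0: "r 0 = 0" and b0: "0 < b" for b
  proof (cases "b \<le> min p q")
    case True
    have "(\<Prod>j<b. r j / of_nat (Suc j)) = 0"
      by (rule prod_zero[OF finite_lessThan], rule bexI[of _ 0]) (simp_all add: r0 b0)
    then show ?thesis by (simp add: e_def)
  next
    case False
    then show ?thesis unfolding e_def by (rule if_not_P)
  qed
  have key: "r b * e b = s b * e b \<and> (b = min p q \<longrightarrow> r b * e b = 0)" if b: "b \<le> min p q" for b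
  proof -
    consider "p = 0 \<and> q = 0" | "p = 0 \<and> q > 0 \<and> h2 = of_nat q - 1" | "p > 0 \<and> q = 0 \<and> h1 = of_nat p - 1"
      | "p > 0 \<and> q > 0 \<and> h1 = of_nat p - of_nat q - 1 \<and> h2 = of_nat q - 1"
      | "h1 = of_nat p - 1 \<and> h2 = of_nat q - of_nat p - 1" | "p = q \<and> h1 + h2 = of_nat p - 2"
      using assms unfolding linked_def by blast
    then show ?thesis
    proof cases
      case 4
      then have "r 0 = 0" "s 0 = 0" by (simp_all add: r_def s_def)
      then show ?thesis using vanish[of b] by (cases "b = 0") auto
    next
      case 5
      then have h: "h1 = of_nat p - 1" "h2 = of_nat q - of_nat p - 1" by simp_all
      have "r b = of_nat (p - b) * of_nat (q - b)" "s b = of_nat (p - b) * of_nat (q - b)"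
        unfolding r_def s_def h using b by (simp_all add: of_nat_diff algebra_simps)
      then show ?thesis by auto
    next
      case 6
      then have h2: "h2 = of_nat p - 2 - h1" and qp: "q = p" by (simp_all add: algebra_simps)
      have "r b = s b" using b unfolding r_def s_def h2 qp by (simp add: of_nat_diff algebra_simps)
      moreover have "b = min p q \<longrightarrow> r b = 0" by (simp add: r_def qp)
      ultimately show ?thesis by auto
    qed (use b in \<open>auto simp: r_def s_def\<close>)
  qed
  have "of_nat (Suc b) * e (Suc b) = r b * e b \<and> of_nat (Suc b) * e (Suc b) = s b * e b"
    if b: "b \<le> min p q" for b
  proof (cases "b = min p q")
    case True
    then have "e (Suc b) = 0" by (intro gt) simp
    then show ?thesis using key[OF b] True by (metis mult_zero_right)
  next
    case False
    then have "b < min p q" using b by (rule le_neq_implies_less[rotated])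
    then show ?thesis using step key[OF b] by metis
  qed
  then have "singular p q h1 h2 e" unfolding singular_def r_def s_def using gt by blast
  then show ?thesis using e0 by blast
qed

section \<open>Linkage and the parameter sets\<close>

definition shifted :: "complex^3 \<Rightarrow> complex^3 \<Rightarrow> nat \<Rightarrow> nat \<Rightarrow> bool" where
  "shifted \<mu> \<mu>' p q \<longleftrightarrow> \<mu>' $ 1 = \<mu> $ 1 + of_nat p \<and> \<mu>' $ 2 = \<mu> $ 2 + of_nat q - of_nat p \<and> \<mu>' $ 3 = \<mu> $ 3 - of_nat q"

definition parity :: "bit^3 \<Rightarrow> bit^3 \<Rightarrow> nat \<Rightarrow> nat \<Rightarrow> bool" where
  "parity \<xi> \<xi>' p q \<longleftrightarrow> \<xi> $ 1 + \<xi>' $ 1 = of_nat p \<and> \<xi> $ 2 + \<xi>' $ 2 = of_nat (p + q) \<and> \<xi> $ 3 + \<xi>' $ 3 = of_nat q"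

lemma shifted_unique: "shifted \<mu> \<mu>' p q \<Longrightarrow> shifted \<mu> \<mu>' p' q' \<Longrightarrow> p' = p \<and> q' = q"
  by (auto simp: shifted_def)

lemma pos_natsI: "0 < n \<Longrightarrow> x = of_nat n \<Longrightarrow> x \<in> pos_nats"
  by (auto simp: pos_nats_def)

text \<open>For \<open>p = q\<close> both cycles of length three become special cases of the reflection in the highest root.
  The inequalities in \<open>Lambda 4\<close> and \<open>Lambda 5\<close> remove exactly these.\<close>

lemma Lambda_iff_linked:
  "(\<exists>j\<in>{0..5}. (\<mu>, \<mu>') \<in> Lambda j) \<longleftrightarrow>
     (\<exists>p q. shifted \<mu> \<mu>' p q \<and> linked p q (\<mu> $ 2 - \<mu> $ 1) (\<mu> $ 3 - \<mu> $ 2))"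
proof
  assume "\<exists>j\<in>{0..5}. (\<mu>, \<mu>') \<in> Lambda j"
  then consider (0) "\<mu> = \<mu>'"
    | (1) "\<mu>$1 = \<mu>'$1" "\<mu>'$2 - \<mu>$2 \<in> pos_nats" "\<mu>$2 - \<mu>'$3 = 1" "\<mu>$3 - \<mu>'$2 = -1"
    | (2) "\<mu>$2 = \<mu>'$2" "\<mu>$3 - \<mu>'$3 \<in> pos_nats" "\<mu>$1 - \<mu>'$3 = 2" "\<mu>$3 - \<mu>'$1 = -2"
    | (3) "\<mu>$3 = \<mu>'$3" "\<mu>'$1 - \<mu>$1 \<in> pos_nats" "\<mu>$2 - \<mu>'$1 = -1" "\<mu>$1 - \<mu>'$2 = 1"
    | (4) "\<mu>'$1 - \<mu>$1 \<in> pos_nats" "\<mu>$3 - \<mu>'$3 \<in> pos_nats" "\<mu>'$1 - \<mu>$3 = 2" "\<mu>$2 = \<mu>'$3 + 1" "\<mu>'$2 = \<mu>$1 - 1"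
    | (5) "\<mu>'$1 - \<mu>$1 \<in> pos_nats" "\<mu>$3 - \<mu>'$3 \<in> pos_nats" "\<mu>$1 - \<mu>'$3 = 2" "\<mu>$2 = \<mu>'$1 - 1" "\<mu>'$2 = \<mu>$3 + 1"
    unfolding Lambda_def by auto
  then show "\<exists>p q. shifted \<mu> \<mu>' p q \<and> linked p q (\<mu> $ 2 - \<mu> $ 1) (\<mu> $ 3 - \<mu> $ 2)"
  proof cases
    case 0
    then show ?thesis by (intro exI[of _ 0]) (simp add: shifted_def linked_def)
  next
    case 1
    then obtain n where n: "n \<ge> 1" "\<mu>'$2 - \<mu>$2 = of_nat n" by (auto simp: pos_nats_def)
    have v: "\<mu>'$2 = \<mu>$2 + of_nat n" "\<mu>'$3 = \<mu>$2 - 1" "\<mu>$3 = \<mu>$2 + of_nat n - 1"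
      using n 1 by (simp_all add: algebra_simps)
    show ?thesis
      by (intro exI[of _ 0] exI[of _ n]) (use n(1) 1(1) in \<open>simp add: shifted_def linked_def v algebra_simps\<close>)
  next
    case 2
    then obtain n where n: "n \<ge> 1" "\<mu>$3 - \<mu>'$3 = of_nat n" by (auto simp: pos_nats_def)
    have v: "\<mu>'$3 = \<mu>$1 - 2" "\<mu>$3 = \<mu>$1 - 2 + of_nat n" "\<mu>'$1 = \<mu>$1 + of_nat n"
      using n 2 by (simp_all add: algebra_simps)
    show ?thesis
      by (intro exI[of _ n]) (use n(1) 2(1) in \<open>simp add: shifted_def linked_def v algebra_simps\<close>)
  next
    case 3
    then obtain n where n: "n \<ge> 1" "\<mu>'$1 - \<mu>$1 = of_nat n" by (auto simp: pos_nats_def)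
    have v: "\<mu>'$1 = \<mu>$1 + of_nat n" "\<mu>$2 = \<mu>$1 + of_nat n - 1" "\<mu>'$2 = \<mu>$1 - 1"
      using n 3 by (simp_all add: algebra_simps)
    show ?thesis
      by (intro exI[of _ n] exI[of _ 0]) (use n(1) 3(1) in \<open>simp add: shifted_def linked_def v algebra_simps\<close>)
  next
    case 4
    then obtain p q where n: "p \<ge> 1" "\<mu>'$1 - \<mu>$1 = of_nat p" "q \<ge> 1" "\<mu>$3 - \<mu>'$3 = of_nat q"
      by (auto simp: pos_nats_def)
    have v1: "\<mu>'$1 = \<mu>$1 + of_nat p" "\<mu>$3 = \<mu>$1 + of_nat p - 2"
      using n 4 by (simp_all add: algebra_simps)
    have v2: "\<mu>'$3 = \<mu>$1 + of_nat p - 2 - of_nat q" using n v1 by (simp add: algebra_simps)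
    have v3: "\<mu>$2 = \<mu>$1 + of_nat p - 1 - of_nat q" "\<mu>'$2 = \<mu>$1 - 1"
      unfolding 4(4,5) v2 by (simp_all add: algebra_simps)
    show ?thesis
      by (intro exI[of _ p] exI[of _ q]) (use n(1,3) in \<open>simp add: shifted_def linked_def v1 v2 v3 algebra_simps\<close>)
  next
    case 5
    then obtain p q where n: "p \<ge> 1" "\<mu>'$1 - \<mu>$1 = of_nat p" "q \<ge> 1" "\<mu>$3 - \<mu>'$3 = of_nat q"
      by (auto simp: pos_nats_def)
    have v1: "\<mu>'$1 = \<mu>$1 + of_nat p" "\<mu>'$3 = \<mu>$1 - 2"
      using n 5 by (simp_all add: algebra_simps)
    have v2: "\<mu>$3 = \<mu>$1 - 2 + of_nat q" using n v1 by (simp add: algebra_simps)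
    have v3: "\<mu>$2 = \<mu>$1 + of_nat p - 1" "\<mu>'$2 = \<mu>$1 - 1 + of_nat q"
      unfolding 5(4,5) v1 v2 by (simp_all add: algebra_simps)
    show ?thesis
      by (intro exI[of _ p] exI[of _ q]) (use n(1,3) in \<open>simp add: shifted_def linked_def v1 v2 v3 algebra_simps\<close>)
  qed
next
  assume "\<exists>p q. shifted \<mu> \<mu>' p q \<and> linked p q (\<mu> $ 2 - \<mu> $ 1) (\<mu> $ 3 - \<mu> $ 2)"
  then obtain p q where sh: "shifted \<mu> \<mu>' p q" and li: "linked p q (\<mu> $ 2 - \<mu> $ 1) (\<mu> $ 3 - \<mu> $ 2)"
    by blast
  have v: "\<mu>' $ 1 = \<mu> $ 1 + of_nat p" "\<mu>' $ 2 = \<mu> $ 2 + of_nat q - of_nat p" "\<mu>' $ 3 = \<mu> $ 3 - of_nat q"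
    using sh by (simp_all add: shifted_def)
  have sum: "\<mu> $ 2 - \<mu> $ 1 + (\<mu> $ 3 - \<mu> $ 2) = \<mu> $ 3 - \<mu> $ 1" by simp
  from li consider (0) "p = 0" "q = 0"
    | (1) "p = 0" "q > 0" "\<mu> $ 3 - \<mu> $ 2 = of_nat q - 1"
    | (3) "p > 0" "q = 0" "\<mu> $ 2 - \<mu> $ 1 = of_nat p - 1"
    | (4) "p > 0" "q > 0" "p \<noteq> q" "\<mu> $ 2 - \<mu> $ 1 = of_nat p - of_nat q - 1" "\<mu> $ 3 - \<mu> $ 2 = of_nat q - 1"
    | (5) "p > 0" "q > 0" "p \<noteq> q" "\<mu> $ 2 - \<mu> $ 1 = of_nat p - 1" "\<mu> $ 3 - \<mu> $ 2 = of_nat q - of_nat p - 1"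
    | (2) "p > 0" "q = p" "\<mu> $ 3 - \<mu> $ 1 = of_nat p - 2"
  proof (cases "p = q \<and> p > 0")
    case True
    then have "\<mu> $ 2 - \<mu> $ 1 + (\<mu> $ 3 - \<mu> $ 2) = of_nat p - 2"
      using li unfolding linked_def by (elim disjE conjE) (simp_all only:, simp_all)
    then show thesis using True that(6) unfolding sum by blast
  next
    case False
    then show thesis using li that(1-5) unfolding linked_def by blast
  qed
  then show "\<exists>j\<in>{0..5}. (\<mu>, \<mu>') \<in> Lambda j"
  proof cases
    case 0
    then have "(\<mu>, \<mu>') \<in> Lambda 0" using v by (simp add: Lambda_def vec_eq_iff forall_3)
    then show ?thesis by (intro bexI[of _ 0]) auto
  next
    case 1
    have w: "\<mu> $ 3 = \<mu> $ 2 + of_nat q - 1" using 1 by (simp add: algebra_simps)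
    have "\<mu>'$2 - \<mu>$2 \<in> pos_nats" using 1 v by (intro pos_natsI[of q]) auto
    then have "(\<mu>, \<mu>') \<in> Lambda 1" using 1 v w by (simp add: Lambda_def)
    then show ?thesis by (intro bexI[of _ 1]) auto
  next
    case 2
    have w: "\<mu> $ 3 = \<mu> $ 1 + of_nat p - 2" using 2 by (simp add: algebra_simps)
    have "\<mu>$3 - \<mu>'$3 \<in> pos_nats" using 2 v by (intro pos_natsI[of p]) auto
    then have "(\<mu>, \<mu>') \<in> Lambda 2" using 2 v w by (simp add: Lambda_def)
    then show ?thesis by (intro bexI[of _ 2]) auto
  next
    case 3
    have w: "\<mu> $ 2 = \<mu> $ 1 + of_nat p - 1" using 3 by (simp add: algebra_simps)
    have "\<mu>'$1 - \<mu>$1 \<in> pos_nats" using 3 v by (intro pos_natsI[of p]) auto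
    then have "(\<mu>, \<mu>') \<in> Lambda 3" using 3 v w by (simp add: Lambda_def)
    then show ?thesis by (intro bexI[of _ 3]) auto
  next
    case 4
    have w2: "\<mu> $ 2 = \<mu> $ 1 + of_nat p - of_nat q - 1" using 4(4) by (simp add: algebra_simps)
    have "\<mu> $ 3 = \<mu> $ 2 + of_nat q - 1" using 4(5) by (simp add: algebra_simps)
    then have w: "\<mu> $ 2 = \<mu> $ 1 + of_nat p - of_nat q - 1" "\<mu> $ 3 = \<mu> $ 1 + of_nat p - 2"
      unfolding w2 by simp_all
    have "\<mu>'$1 - \<mu>$1 \<in> pos_nats" "\<mu>$3 - \<mu>'$3 \<in> pos_nats"
      using 4(1,2) v by (auto intro: pos_natsI[of p] pos_natsI[of q])
    moreover have "\<mu>'$1 - \<mu>$3 = 2" "\<mu>$2 = \<mu>'$3 + 1" "\<mu>'$2 = \<mu>$1 - 1" unfolding v w by simp_all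
    moreover have "\<mu>$1 - \<mu>'$3 \<noteq> 2"
    proof
      assume "\<mu>$1 - \<mu>'$3 = 2"
      then have "of_nat p = (of_nat q :: complex)" unfolding v w by (simp add: algebra_simps)
      then show False using 4(3) by simp
    qed
    ultimately have "(\<mu>, \<mu>') \<in> Lambda 4" unfolding Lambda_def mem_Collect_eq prod.case by blast
    then show ?thesis by (intro bexI[of _ 4]) auto
  next
    case 5
    have w2: "\<mu> $ 2 = \<mu> $ 1 + of_nat p - 1" using 5(4) by (simp add: algebra_simps)
    have "\<mu> $ 3 = \<mu> $ 2 + of_nat q - of_nat p - 1" using 5(5) by (simp add: algebra_simps)
    then have w: "\<mu> $ 2 = \<mu> $ 1 + of_nat p - 1" "\<mu> $ 3 = \<mu> $ 1 + of_nat q - 2"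
      unfolding w2 by simp_all
    have "\<mu>'$1 - \<mu>$1 \<in> pos_nats" "\<mu>$3 - \<mu>'$3 \<in> pos_nats"
      using 5(1,2) v by (auto intro: pos_natsI[of p] pos_natsI[of q])
    moreover have "\<mu>$1 - \<mu>'$3 = 2" "\<mu>$2 = \<mu>'$1 - 1" "\<mu>'$2 = \<mu>$3 + 1" unfolding v w by simp_all
    moreover have "\<mu>'$1 - \<mu>$3 \<noteq> 2"
    proof
      assume "\<mu>'$1 - \<mu>$3 = 2"
      then have "of_nat p = (of_nat q :: complex)" unfolding v w by (simp add: algebra_simps)
      then show False using 5(3) by simp
    qed
    ultimately have "(\<mu>, \<mu>') \<in> Lambda 5" unfolding Lambda_def mem_Collect_eq prod.case by blast
    then show ?thesis by (intro bexI[of _ 5]) auto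
  qed
qed

lemma of_int_bit_diff: "of_int (int q - int p) = (of_nat (p + q) :: bit)"
proof -
  have "x - y = y + x" for x y :: bit by (cases x; cases y) simp_all
  from this[of "of_nat q" "of_nat p"] show ?thesis by simp
qed

lemma Supp_D_iff_linked:
  "(\<xi>, \<xi>', \<mu>, \<mu>') \<in> Supp_D \<longleftrightarrow>
     (\<exists>p q. shifted \<mu> \<mu>' p q \<and> parity \<xi> \<xi>' p q \<and> linked p q (\<mu> $ 2 - \<mu> $ 1) (\<mu> $ 3 - \<mu> $ 2))"
proof -
  let ?par = "\<forall>k. \<exists>n::int. \<mu>' $ k - \<mu> $ k = of_int n \<and> \<xi> $ k + \<xi>' $ k = of_int n"
  have par: "?par \<longleftrightarrow> parity \<xi> \<xi>' p q" if "shifted \<mu> \<mu>' p q" for p q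
  proof -
    have d: "\<mu>' $ 1 - \<mu> $ 1 = of_int (int p)" "\<mu>' $ 2 - \<mu> $ 2 = of_int (int q - int p)" "\<mu>' $ 3 - \<mu> $ 3 = of_int (- int q)"
      using that by (simp_all add: shifted_def)
    have "(\<exists>n::int. \<mu>' $ k - \<mu> $ k = of_int n \<and> \<xi> $ k + \<xi>' $ k = of_int n) \<longleftrightarrow> \<xi> $ k + \<xi>' $ k = of_int m"
      if "\<mu>' $ k - \<mu> $ k = of_int m" for k and m :: int
      unfolding that of_int_eq_iff by blast
    from this[OF d(1)] this[OF d(2)] this[OF d(3)] show ?thesis
      unfolding forall_3 parity_def of_int_bit_diff by simp
  qed
  have "(\<xi>, \<xi>', \<mu>, \<mu>') \<in> Supp_D \<longleftrightarrow> (\<exists>j\<in>{0..5}. (\<mu>, \<mu>') \<in> Lambda j) \<and> ?par"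
    unfolding Supp_D_def Supp_D_part_def by blast
  also have "\<dots> \<longleftrightarrow> (\<exists>p q. shifted \<mu> \<mu>' p q \<and> parity \<xi> \<xi>' p q \<and> linked p q (\<mu> $ 2 - \<mu> $ 1) (\<mu> $ 3 - \<mu> $ 2))"
    unfolding Lambda_iff_linked using par by blast
  finally show ?thesis .
qed

lemma sign_char_shift:
  assumes "m = 1 \<or> m = -1" "e + e' = of_nat n"
  shows "sign_char e' m = m ^ n * sign_char e m"
proof -
  have "e' = of_nat n + e" using assms(2) by (cases e; cases e') (auto simp: algebra_simps)
  moreover obtain k :: nat where "of_nat (k + 0) = e" using exists_nat_parity by blast
  ultimately have "e' = of_nat (n + k)" "e = of_nat k" by auto
  then show ?thesis by (simp only: sign_char_power[OF assms(1)] power_add)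
qed

lemma sign_char_minus_one_cancel:
  assumes "sign_char e' (-1) = (-1) ^ n * sign_char e (-1)"
  shows "e + e' = of_nat n"
proof -
  have "of_nat n = (if even n then 0 else 1 :: bit)" by (induction n) auto
  then show ?thesis
    using assms by (cases e; cases e'; cases "even n") (auto simp: sign_char_def)
qed

section \<open>Intertwining differential operators\<close>

text \<open>The general vector of weight \<open>- (p \<alpha>\<^sub>1 + q \<alpha>\<^sub>2)\<close>.\<close>

definition root_op :: "nat \<Rightarrow> nat \<Rightarrow> (nat \<Rightarrow> complex) \<Rightarrow> (mat3 \<Rightarrow> complex) \<Rightarrow> mat3 \<Rightarrow> complex" where
  "root_op p q e f = (\<lambda>g. \<Sum>b\<le>min p q. e b * lowering (p - b) b (q - b) f g)"

lemma smooth_root_op: "smooth_on f GL3 \<Longrightarrow> smooth_on (root_op p q e f) GL3"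
  unfolding root_op_def by (intro smooth_on_sum smooth_on_mult smooth_on_const smooth_lowering open_GL3)

lemma rd_root_op:
  "smooth_on f GL3 \<Longrightarrow> rd X (root_op p q e f) = (\<lambda>g. \<Sum>b\<le>min p q. e b * rd X (lowering (p - b) b (q - b) f) g)"
  unfolding root_op_def by (intro rd_sum smooth_lowering)

text \<open>The two terms of \<open>raise_12\<close> for the indices \<open>b\<close> and \<open>b + 1\<close> involve the same monomial. Collecting
  them needs a coefficient beyond the end of the sum, which has to be zero. The factor \<open>p - b\<close>
  vanishes where \<open>p - 1 - b\<close> is truncated.\<close>

lemma raise_12_root_op:
  assumes f: "f \<in> principal_series \<xi> \<mu>" and e: "e (Suc (min p q)) = 0"
  shows "rd (E 1 2) (root_op p q e f) g = (\<Sum>b\<le>min p q.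
    (of_nat (p - b) * (\<mu> $ 2 - \<mu> $ 1 + of_nat q - of_nat p - of_nat b + 1) * e b - of_nat (Suc b) * e (Suc b)) *
      lowering (p - 1 - b) b (q - b) f g)"
proof -
  let ?m = "min p q"
  let ?L = "\<lambda>b. lowering (p - 1 - b) b (q - b) f g"
  define u where "u b = of_nat (p - b) * (\<mu> $ 2 - \<mu> $ 1 + of_nat q - of_nat p - of_nat b + 1) * e b * ?L b" for b
  define w where "w b = of_nat b * e b * lowering (p - b) (b - 1) (q - b + 1) f g" for b
  have t: "e b * rd (E 1 2) (lowering (p - b) b (q - b) f) g = u b - w b" if "b \<le> ?m" for b
  proof -
    have "\<mu> $ 2 - \<mu> $ 1 - of_nat b + of_nat (q - b) - of_nat (p - b) + 1 =
        \<mu> $ 2 - \<mu> $ 1 + of_nat q - of_nat p - of_nat b + (1::complex)"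
      using that by (simp add: of_nat_diff)
    then show ?thesis
      by (simp add: raise_12[OF f] u_def w_def diff_commute right_diff_distrib mult_ac)
  qed
  have "rd (E 1 2) (root_op p q e f) g = (\<Sum>b\<le>?m. u b - w b)"
    unfolding rd_root_op[OF principal_series_smooth[OF f]] by (rule sum.cong) (use t in auto)
  also have "\<dots> = (\<Sum>b\<le>?m. u b) - (\<Sum>b\<le>?m. w b)" by (rule sum_subtractf)
  also have "(\<Sum>b\<le>?m. w b) = w 0 + (\<Sum>b<?m. w (Suc b))" by (rule sum.atMost_shift)
  also have "(\<Sum>b<?m. w (Suc b)) = (\<Sum>b<?m. of_nat (Suc b) * e (Suc b) * ?L b)"
    by (rule sum.cong) (auto simp: w_def Suc_diff_Suc)
  also have "w 0 + \<dots> = (\<Sum>b\<le>?m. of_nat (Suc b) * e (Suc b) * ?L b)"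
    using e by (simp add: w_def lessThan_Suc_atMost[symmetric] del: of_nat_Suc)
  finally show ?thesis by (simp add: sum_subtractf[symmetric] u_def left_diff_distrib)
qed

lemma raise_23_root_op:
  assumes f: "f \<in> principal_series \<xi> \<mu>" and e: "e (Suc (min p q)) = 0"
  shows "rd (E 2 3) (root_op p q e f) g = (\<Sum>b\<le>min p q.
    (of_nat (q - b) * (\<mu> $ 3 - \<mu> $ 2 - of_nat q + of_nat b + 1) * e b + of_nat (Suc b) * e (Suc b)) *
      lowering (p - b) b (q - 1 - b) f g)"
proof -
  let ?m = "min p q"
  let ?L = "\<lambda>b. lowering (p - b) b (q - 1 - b) f g"
  define u where "u b = of_nat (q - b) * (\<mu> $ 3 - \<mu> $ 2 - of_nat q + of_nat b + 1) * e b * ?L b" for b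
  define w where "w b = of_nat b * e b * lowering (p - b + 1) (b - 1) (q - b) f g" for b
  have t: "e b * rd (E 2 3) (lowering (p - b) b (q - b) f) g = u b + w b" if "b \<le> ?m" for b
  proof -
    have eq: "\<mu> $ 3 - \<mu> $ 2 - of_nat (q - b) + 1 = \<mu> $ 3 - \<mu> $ 2 - of_nat q + of_nat b + (1::complex)"
      using that by (simp add: of_nat_diff)
    show ?thesis
      unfolding raise_23[OF f] eq u_def w_def by (simp add: diff_commute distrib_left mult_ac)
  qed
  have "rd (E 2 3) (root_op p q e f) g = (\<Sum>b\<le>?m. u b + w b)"
    unfolding rd_root_op[OF principal_series_smooth[OF f]] by (rule sum.cong) (use t in auto)
  also have "\<dots> = (\<Sum>b\<le>?m. u b) + (\<Sum>b\<le>?m. w b)" by (rule sum.distrib)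
  also have "(\<Sum>b\<le>?m. w b) = w 0 + (\<Sum>b<?m. w (Suc b))" by (rule sum.atMost_shift)
  also have "(\<Sum>b<?m. w (Suc b)) = (\<Sum>b<?m. of_nat (Suc b) * e (Suc b) * ?L b)"
    by (rule sum.cong) (auto simp: w_def Suc_diff_Suc)
  also have "w 0 + \<dots> = (\<Sum>b\<le>?m. of_nat (Suc b) * e (Suc b) * ?L b)"
    using e by (simp add: w_def lessThan_Suc_atMost[symmetric] del: of_nat_Suc)
  finally show ?thesis by (simp add: sum.distrib[symmetric] u_def distrib_right)
qed

lemma root_family_independent:
  assumes zero: "\<And>f. f \<in> principal_series \<xi> \<mu> \<Longrightarrow> (\<Sum>b\<le>m. e b * lowering (u b) b (v b) f (mat 1)) = 0"
    and b: "b \<le> m"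
  shows "e b = (0::complex)"
proof -
  let ?t = "\<lambda>b. (u b, b, v b)"
  have inj: "inj_on ?t {..m}" by (auto simp: inj_on_def)
  have *: "(\<Sum>(a, b, c)\<in>?t ` {..m}. (\<lambda>(a, b, c). e b) (a, b, c) * lowering a b c f (mat 1)) = 0"
    if "f \<in> principal_series \<xi> \<mu>" for f
    using zero[OF that] by (subst sum.reindex[OF inj]) simp
  have "(\<lambda>(a, b, c). e b) (?t b) = 0"
    by (rule lowering_independent[where T="?t ` {..m}", OF _ *]) (use b in auto)
  then show ?thesis by simp
qed

lemma root_op_nonzero:
  assumes "b \<le> min p q" "e b \<noteq> 0"
  shows "\<exists>f\<in>principal_series \<xi> \<mu>. root_op p q e f (mat 1) \<noteq> 0"
proof (rule ccontr)
  assume "\<not> ?thesis"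
  then have "(\<Sum>b\<le>min p q. e b * lowering (p - b) b (q - b) f (mat 1)) = 0"
    if "f \<in> principal_series \<xi> \<mu>" for f using that unfolding root_op_def by blast
  from root_family_independent[OF this assms(1)] assms(2) show False by simp
qed

text \<open>All monomials in \<open>root_op\<close> have the same weight, so the scaling factor is independent of \<open>b\<close>.\<close>

lemma root_op_diag:
  assumes f: "smooth_on f GL3" and v: "\<And>j. v $ j \<noteq> 0"
    and eq: "\<And>g. g \<in> GL3 \<Longrightarrow> f (g ** diag v) = \<kappa> * f g" and g: "g \<in> GL3"
  shows "root_op p q e f (g ** diag v) =
    of_real ((v $ 2) ^ p * (v $ 3) ^ q / ((v $ 1) ^ p * (v $ 2) ^ q)) * \<kappa> * root_op p q e f g"
proof -
  have *: "(v $ 2 / v $ 1) ^ (p - b) * (v $ 3 / v $ 1) ^ b * (v $ 3 / v $ 2) ^ (q - b) =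
      (v $ 2) ^ p * (v $ 3) ^ q / ((v $ 1) ^ p * (v $ 2) ^ q)" if b: "b \<le> min p q" for b
  proof -
    have "p = (p - b) + b" "q = (q - b) + b" using b by auto
    then obtain i k where "p = i + b" "q = k + b" "p - b = i" "q - b = k" by metis
    then show ?thesis using v by (simp add: power_add power_divide field_simps)
  qed
  show ?thesis
    unfolding root_op_def sum_distrib_left
    by (rule sum.cong[OF refl], simp only: lowering_diag[OF f v eq g] atMost_iff *) (simp only: mult_ac)
qed

lemma sign_ratio:
  fixes m :: "real^3"
  assumes m: "\<And>j. m $ j = 1 \<or> m $ j = -1"
  shows "(m $ 2) ^ p * (m $ 3) ^ q / ((m $ 1) ^ p * (m $ 2) ^ q) = (m $ 1) ^ p * (m $ 2) ^ (p + q) * (m $ 3) ^ q"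
proof -
  have inv: "inverse ((m $ j) ^ n) = (m $ j) ^ n" for j n
    using m[of j] by (auto simp: power_inverse[symmetric])
  show ?thesis by (simp add: divide_inverse inv power_add mult_ac)
qed

lemma prod_UNIV_3: "(\<Prod>j\<in>UNIV. F j) = F 1 * F 2 * F (3::3)" for F :: "3 \<Rightarrow> complex"
  by (simp only: UNIV_3) (simp add: mult.assoc)

lemma root_op_outside:
  "f \<in> principal_series \<xi> \<mu> \<Longrightarrow> g \<notin> GL3 \<Longrightarrow> root_op p q e f g = 0"
  unfolding root_op_def
  by (rule sum.neutral) (use lowering_outside[OF principal_series_outside[of f \<xi> \<mu>]] in auto)

lemma left_transl_principal_series:
  assumes f: "f \<in> principal_series \<xi> \<mu>" and h: "h \<in> GL3"
  shows "left_transl h f \<in> principal_series \<xi> \<mu>"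
proof (rule principal_seriesI)
  have hg: "matrix_inv h ** g \<in> GL3" if "g \<in> GL3" for g using h that by simp
  show "smooth_on (left_transl h f) GL3" by (rule smooth_left_transl[OF principal_series_smooth[OF f] h])
  show "left_transl h f g = 0" if "g \<notin> GL3" for g
    using principal_series_outside[OF f] that by (simp add: left_transl_def)
  show "left_transl h f (g ** diag m) = (\<Prod>j\<in>UNIV. complex_of_real (sign_char (\<xi> $ j) (m $ j))) * left_transl h f g"
    if "g \<in> GL3" "\<And>j. m $ j = 1 \<or> m $ j = -1" for g m
    using principal_series_sign[OF f hg[OF that(1)] that(2)] by (simp only: left_transl_def matrix_mul_assoc)
  show "left_transl h f (g ** diag a) = (\<Prod>j\<in>UNIV. complex_of_real (a $ j) powr (- (\<mu> $ j))) * left_transl h f g"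
    if "g \<in> GL3" "\<And>j. a $ j > 0" for g a
    using principal_series_pos[OF f hg[OF that(1)] that(2)] by (simp only: left_transl_def matrix_mul_assoc)
  show "left_transl h f (g ** n) = left_transl h f g" if "g \<in> GL3" "n \<in> upper_unip" for g n
    using principal_series_unip[OF f hg[OF that(1)] that(2)] by (simp only: left_transl_def matrix_mul_assoc)
qed

lemma matrix_inv_inv:
  assumes "g \<in> GL3"
  shows "matrix_inv (matrix_inv g) = g"
proof -
  let ?h = "matrix_inv g"
  have "matrix_inv ?h = matrix_inv ?h ** (?h ** g)" by (simp add: matrix_inv_mult(2)[OF assms])
  also have "\<dots> = (matrix_inv ?h ** ?h) ** g" by (rule matrix_mul_assoc)
  also have "\<dots> = g" by (simp add: matrix_inv_mult(2)[OF matrix_inv_GL3[OF assms]])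
  finally show ?thesis .
qed

text \<open>By left invariance an intertwining operator is determined by its coefficients at the origin
  of one chart.\<close>

lemma Diff_G_lowering:
  assumes D: "D \<in> Diff_G \<xi> \<mu> \<xi>' \<mu>'"
  obtains T d where "finite T"
    "\<And>f. f \<in> principal_series \<xi> \<mu> \<Longrightarrow> D f = (\<lambda>g. \<Sum>(a, b, c)\<in>T. d (a, b, c) * lowering a b c f g)"
proof -
  let ?V = "principal_series \<xi> \<mu>"
  have maps: "D f \<in> principal_series \<xi>' \<mu>'" if "f \<in> ?V" for f using D that by (simp add: Diff_G_def)
  have comm: "D (left_transl h f) = left_transl h (D f)" if "h \<in> GL3" "f \<in> ?V" for h f
    using D that by (simp add: Diff_G_def)
  have "differential_operator ?V D" using D by (simp add: Diff_G_def)
  then obtain k c where kc: "\<And>f x. f \<in> ?V \<Longrightarrow> D f (mat 1 ** lower_unip x) =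
      (\<Sum>\<alpha>\<in>multi_indices k. c \<alpha> x * multi_partial \<alpha> (\<lambda>y. f (mat 1 ** lower_unip y)) x)"
    unfolding differential_operator_def using GL3_one by blast
  define ix where "ix = (\<lambda>\<alpha>::nat^3. (\<alpha> $ 1, \<alpha> $ 2, \<alpha> $ 3))"
  have inj: "inj_on ix (multi_indices k)" by (auto simp: inj_on_def ix_def vec_eq_iff forall_3)
  define T where "T = ix ` multi_indices k"
  define d where "d = (\<lambda>(a, b, c'). c (vector [a, b, c']) 0)"
  have vec: "vector [\<alpha> $ 1, \<alpha> $ 2, \<alpha> $ 3] = \<alpha>" for \<alpha> :: "nat^3" by (simp add: vec_eq_iff forall_3)
  have "D f g = (\<Sum>(a, b, c)\<in>T. d (a, b, c) * lowering a b c f g)" if f: "f \<in> ?V" for f g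
  proof (cases "g \<in> GL3")
    case g: True
    let ?f = "left_transl (matrix_inv g) f"
    have f': "?f \<in> ?V" using left_transl_principal_series[OF f] g by simp
    have "D f g = left_transl (matrix_inv g) (D f) (mat 1)"
      using g by (simp add: left_transl_def matrix_inv_inv)
    also have "\<dots> = D ?f (mat 1 ** lower_unip 0)" using comm[OF _ f, of "matrix_inv g"] g by simp
    also have "\<dots> = (\<Sum>\<alpha>\<in>multi_indices k. c \<alpha> 0 * multi_partial \<alpha> (chart (mat 1) ?f) 0)"
      unfolding kc[OF f'] chart_def ..
    also have "\<dots> = (\<Sum>\<alpha>\<in>multi_indices k. c \<alpha> 0 * lowering (\<alpha> $ 1) (\<alpha> $ 2) (\<alpha> $ 3) f g)"
      using g by (simp add: multi_partial_zero principal_series_smooth[OF f'] lowering_left_transl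
          principal_series_smooth[OF f]) (simp add: left_transl_def matrix_inv_inv)
    also have "\<dots> = (\<Sum>(a, b, c)\<in>T. d (a, b, c) * lowering a b c f g)"
      unfolding T_def by (subst sum.reindex[OF inj]) (simp add: ix_def d_def vec)
    finally show ?thesis .
  next
    case False
    then show ?thesis
      using principal_series_outside[OF maps[OF f]] lowering_outside[OF principal_series_outside[OF f] False]
      by (simp add: case_prod_beta)
  qed
  moreover have "finite T" by (simp add: T_def finite_multi_indices)
  ultimately show ?thesis using that by blast
qed

lemma Diff_G_zero_outside: "D \<in> Diff_G \<xi> \<mu> \<xi>' \<mu>' \<Longrightarrow> f \<notin> principal_series \<xi> \<mu> \<Longrightarrow> D f = 0"
  by (simp add: Diff_G_def)

text \<open>The weight of each monomial that occurs can be read off from the action of the diagonal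
  matrix units, because the monomials are independent. Hence only one weight occurs.\<close>

lemma Diff_G_root_op:
  assumes D: "D \<in> Diff_G \<xi> \<mu> \<xi>' \<mu>'" and nz: "D \<noteq> 0"
  obtains p q e where "shifted \<mu> \<mu>' p q" "\<And>b. b > min p q \<Longrightarrow> e b = 0"
    "\<And>f. f \<in> principal_series \<xi> \<mu> \<Longrightarrow> D f = root_op p q e f"
proof -
  let ?V = "principal_series \<xi> \<mu>"
  obtain T d where T: "finite T"
    and Df: "\<And>f. f \<in> ?V \<Longrightarrow> D f = (\<lambda>g. \<Sum>(a, b, c)\<in>T. d (a, b, c) * lowering a b c f g)"
    using Diff_G_lowering[OF D] by blast
  have maps: "D f \<in> principal_series \<xi>' \<mu>'" if "f \<in> ?V" for f using D that by (simp add: Diff_G_def)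
  have weight: "w (a, b, c) = - \<mu>' $ i"
    if w: "\<And>f a b c. f \<in> ?V \<Longrightarrow> rd (E i i) (lowering a b c f) = (\<lambda>g. w (a, b, c) * lowering a b c f g)"
      and t: "(a, b, c) \<in> T" "d (a, b, c) \<noteq> 0" for w i a b c
  proof -
    have "(\<Sum>(a, b, c)\<in>T. (d (a, b, c) * (w (a, b, c) + \<mu>' $ i)) * lowering a b c f (mat 1)) = 0"
      if f: "f \<in> ?V" for f
    proof -
      have "rd (E i i) (D f) = (\<lambda>g. \<Sum>t\<in>T. d t * rd (E i i) (case t of (a, b, c) \<Rightarrow> lowering a b c f) g)"
        unfolding Df[OF f] case_prod_beta prod.collapse
        by (rule rd_sum) (simp add: smooth_lowering principal_series_smooth[OF f])
      then have "rd (E i i) (D f) (mat 1) = (\<Sum>(a, b, c)\<in>T. d (a, b, c) * (w (a, b, c) * lowering a b c f (mat 1)))"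
        by (simp add: case_prod_beta w[OF f])
      moreover have "rd (E i i) (D f) (mat 1) = - \<mu>' $ i * D f (mat 1)"
        by (simp add: rd_diagonal[OF maps[OF f]])
      ultimately have "(\<Sum>(a, b, c)\<in>T. d (a, b, c) * (w (a, b, c) * lowering a b c f (mat 1))) +
          \<mu>' $ i * (\<Sum>(a, b, c)\<in>T. d (a, b, c) * lowering a b c f (mat 1)) = 0"
        by (simp add: Df[OF f])
      then show ?thesis
        unfolding sum_distrib_left sum.distrib[symmetric]
        by (simp add: case_prod_beta algebra_simps)
    qed
    from lowering_independent[where d="\<lambda>t. d t * (w t + \<mu>' $ i)", OF T this t(1)] t(2)
    show ?thesis by (simp add: add_eq_0_iff)
  qed
  define S where "S = {t \<in> T. d t \<noteq> 0}"
  have "\<exists>f\<in>?V. D f \<noteq> 0"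
  proof (rule ccontr)
    assume "\<not> ?thesis"
    then have "D f = 0" for f using Diff_G_zero_outside[OF D] by (cases "f \<in> ?V") auto
    then show False using nz by (simp add: fun_eq_iff)
  qed
  then have "S \<noteq> {}"
    using Df by (auto simp: S_def fun_eq_iff intro!: sum.neutral)
  then obtain a0 b0 c0 where t0: "(a0, b0, c0) \<in> S" by auto
  define p q where "p = a0 + b0" and "q = b0 + c0"
  have wS: "\<mu>' $ 1 = \<mu> $ 1 + of_nat (a + b)" "\<mu>' $ 3 = \<mu> $ 3 - of_nat (b + c)" "\<mu>' $ 2 = \<mu> $ 2 - of_nat a + of_nat c"
    if "(a, b, c) \<in> S" for a b c
  proof -
    have t: "(a, b, c) \<in> T" "d (a, b, c) \<noteq> 0" using that by (auto simp: S_def)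
    show "\<mu>' $ 1 = \<mu> $ 1 + of_nat (a + b)"
      using weight[where w="\<lambda>(a, b, c). - \<mu> $ 1 - of_nat (a + b)", OF _ t, of 1] lowering_weight(1)
      by (simp add: algebra_simps)
    show "\<mu>' $ 3 = \<mu> $ 3 - of_nat (b + c)"
      using weight[where w="\<lambda>(a, b, c). - \<mu> $ 3 + of_nat (b + c)", OF _ t, of 3] lowering_weight(2)
      by (simp add: algebra_simps)
    show "\<mu>' $ 2 = \<mu> $ 2 - of_nat a + of_nat c"
      using weight[where w="\<lambda>(a, b, c). - \<mu> $ 2 + of_nat a - of_nat c", OF _ t, of 2] lowering_weight(3)
      by (simp add: algebra_simps)
  qed
  have sh: "shifted \<mu> \<mu>' p q" using wS[OF t0] by (simp add: shifted_def p_def q_def)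
  have S_form: "b \<le> min p q \<and> a = p - b \<and> c = q - b" if "(a, b, c) \<in> S" for a b c
  proof -
    have "\<mu> $ 1 + of_nat (a + b) = \<mu> $ 1 + of_nat p" "\<mu> $ 3 - of_nat (b + c) = \<mu> $ 3 - of_nat q"
      using wS(1,2)[OF that] sh unfolding shifted_def by metis+
    then have "of_nat (a + b) = (of_nat p :: complex)" "of_nat (b + c) = (of_nat q :: complex)"
      by (metis add_left_cancel, metis diff_left_imp_eq)
    then have "a + b = p" "b + c = q" using of_nat_eq_iff by blast+
    then show ?thesis by auto
  qed
  define ix where "ix b = (p - b, b, q - b)" for b
  define e where "e b = (if b \<le> min p q \<and> ix b \<in> S then d (ix b) else 0)" for b
  have inj: "inj_on ix {..min p q}" by (auto simp: inj_on_def ix_def)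
  have "D f = root_op p q e f" if f: "f \<in> ?V" for f
  proof
    fix g
    let ?L = "\<lambda>t. case t of (a, b, c) \<Rightarrow> lowering a b c f g"
    have "D f g = (\<Sum>t\<in>T. d t * ?L t)" by (simp add: Df[OF f] case_prod_beta)
    also have "\<dots> = (\<Sum>t\<in>S. d t * ?L t)"
      by (rule sum.mono_neutral_right[OF T]) (auto simp: S_def)
    also have "\<dots> = (\<Sum>t\<in>ix ` {..min p q}. (if t \<in> S then d t else 0) * ?L t)"
    proof (rule sum.mono_neutral_cong_left)
      show "S \<subseteq> ix ` {..min p q}"
      proof
        fix t assume "t \<in> S"
        then show "t \<in> ix ` {..min p q}" using S_form by (cases t) (auto simp: ix_def image_iff)
      qed
    qed auto
    also have "\<dots> = (\<Sum>b\<le>min p q. (if ix b \<in> S then d (ix b) else 0) * ?L (ix b))"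
      by (subst sum.reindex[OF inj]) simp
    also have "\<dots> = root_op p q e f g"
      unfolding root_op_def by (rule sum.cong) (auto simp: e_def ix_def)
    finally show "D f g = root_op p q e f g" .
  qed
  moreover have "e b = 0" if "b > min p q" for b
    unfolding e_def using that by (intro if_not_P) (simp only: not_le[symmetric] simp_thms)
  ultimately show ?thesis using that sh by blast
qed

text \<open>Functions in the target are annihilated by the positive root vectors, which gives the recursions,
  and transform by signs under sign matrices, which gives the parities.\<close>

lemma Diff_G_singular:
  assumes D: "D \<in> Diff_G \<xi> \<mu> \<xi>' \<mu>'" and nz: "D \<noteq> 0"
  obtains p q e b where "shifted \<mu> \<mu>' p q" "parity \<xi> \<xi>' p q"
    "singular p q (\<mu> $ 2 - \<mu> $ 1) (\<mu> $ 3 - \<mu> $ 2) e" "e b \<noteq> 0"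
    "\<And>f. f \<in> principal_series \<xi> \<mu> \<Longrightarrow> D f = root_op p q e f"
proof -
  let ?V = "principal_series \<xi> \<mu>"
  obtain p q e where sh: "shifted \<mu> \<mu>' p q" and e: "\<And>b. b > min p q \<Longrightarrow> e b = 0"
    and Df: "\<And>f. f \<in> ?V \<Longrightarrow> D f = root_op p q e f"
    using Diff_G_root_op[OF D nz] by blast
  have maps: "D f \<in> principal_series \<xi>' \<mu>'" if "f \<in> ?V" for f using D that by (simp add: Diff_G_def)
  have es: "e (Suc (min p q)) = 0" using e by simp
  have "\<exists>b\<le>min p q. e b \<noteq> 0"
  proof (rule ccontr)
    assume "\<not> ?thesis"
    then have "D f = 0" for f
      using Df Diff_G_zero_outside[OF D] by (cases "f \<in> ?V") (auto simp: root_op_def fun_eq_iff)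
    then show False using nz by (simp add: fun_eq_iff)
  qed
  then obtain b where b: "b \<le> min p q" "e b \<noteq> 0" by blast
  have "of_nat (p - b) * (\<mu> $ 2 - \<mu> $ 1 + of_nat q - of_nat p - of_nat b + 1) * e b - of_nat (Suc b) * e (Suc b) = 0"
    if "b \<le> min p q" for b
  proof (rule root_family_independent[where e="\<lambda>b. of_nat (p - b) * (\<mu> $ 2 - \<mu> $ 1 + of_nat q - of_nat p - of_nat b + 1) * e b - of_nat (Suc b) * e (Suc b)" and u="\<lambda>b. p - 1 - b" and v="\<lambda>b. q - b", OF _ that])
    fix f assume f: "f \<in> ?V"
    have "rd (E 1 2) (D f) (mat 1) = 0" by (simp add: rd_upper[OF maps[OF f]])
    then show "(\<Sum>b\<le>min p q. (of_nat (p - b) * (\<mu> $ 2 - \<mu> $ 1 + of_nat q - of_nat p - of_nat b + 1) * e b - of_nat (Suc b) * e (Suc b)) * lowering (p - 1 - b) b (q - b) f (mat 1)) = 0"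
      unfolding Df[OF f] raise_12_root_op[where e=e, OF f es] .
  qed
  moreover have "of_nat (q - b) * (\<mu> $ 3 - \<mu> $ 2 - of_nat q + of_nat b + 1) * e b + of_nat (Suc b) * e (Suc b) = 0"
    if "b \<le> min p q" for b
  proof (rule root_family_independent[where e="\<lambda>b. of_nat (q - b) * (\<mu> $ 3 - \<mu> $ 2 - of_nat q + of_nat b + 1) * e b + of_nat (Suc b) * e (Suc b)" and u="\<lambda>b. p - b" and v="\<lambda>b. q - 1 - b", OF _ that])
    fix f assume f: "f \<in> ?V"
    have "rd (E 2 3) (D f) (mat 1) = 0" by (simp add: rd_upper[OF maps[OF f]])
    then show "(\<Sum>b\<le>min p q. (of_nat (q - b) * (\<mu> $ 3 - \<mu> $ 2 - of_nat q + of_nat b + 1) * e b + of_nat (Suc b) * e (Suc b)) * lowering (p - b) b (q - 1 - b) f (mat 1)) = 0"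
      unfolding Df[OF f] raise_23_root_op[where e=e, OF f es] .
  qed
  ultimately have "singular p q (\<mu> $ 2 - \<mu> $ 1) (\<mu> $ 3 - \<mu> $ 2) e"
    unfolding singular_def using e by (auto simp: algebra_simps add_eq_0_iff)
  moreover have "parity \<xi> \<xi>' p q"
  proof -
    obtain f where f: "f \<in> ?V" and f1: "root_op p q e f (mat 1) \<noteq> 0"
      using root_op_nonzero[of b p q e, OF b] by blast
    have key: "(\<Prod>j\<in>UNIV. complex_of_real (sign_char (\<xi>' $ j) (m $ j))) =
        of_real ((m $ 1) ^ p * (m $ 2) ^ (p + q) * (m $ 3) ^ q) *
        (\<Prod>j\<in>UNIV. complex_of_real (sign_char (\<xi> $ j) (m $ j)))"
      if m: "\<And>j. m $ j = 1 \<or> m $ j = -1" for m :: "real^3"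
    proof -
      have m0: "m $ j \<noteq> 0" for j using m[of j] by auto
      have "(\<Prod>j\<in>UNIV. complex_of_real (sign_char (\<xi>' $ j) (m $ j))) * root_op p q e f (mat 1) =
          of_real ((m $ 1) ^ p * (m $ 2) ^ (p + q) * (m $ 3) ^ q) *
          (\<Prod>j\<in>UNIV. complex_of_real (sign_char (\<xi> $ j) (m $ j))) * root_op p q e f (mat 1)"
        using root_op_diag[OF principal_series_smooth[OF f] m0 principal_series_sign[OF f _ m] GL3_one, of p q e]
          principal_series_sign[OF maps[OF f] GL3_one m] unfolding Df[OF f] sign_ratio[where m=m, OF m] by (simp only:)
      then show ?thesis by (simp only: mult_right_cancel[OF f1])
    qed
    \<comment> \<open>Changing one sign at a time isolates the three parities.\<close>
    have flip: "(\<chi> j. if j = i then -1 else (1::real)) $ j = 1 \<or> (\<chi> j. if j = i then -1 else (1::real)) $ j = -1" for i j :: 3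
      by simp
    have three: "(2::3) \<noteq> 1" "(3::3) \<noteq> 1" "(2::3) \<noteq> 3" by auto
    have "sign_char (\<xi>' $ 1) (-1) = (-1) ^ p * sign_char (\<xi> $ 1) (-1)"
    proof -
      have "complex_of_real (sign_char (\<xi>' $ 1) (-1)) = of_real ((-1) ^ p) * of_real (sign_char (\<xi> $ 1) (-1))"
        using key[OF flip[of 1]] unfolding prod_UNIV_3 by (simp add: three)
      then show ?thesis unfolding of_real_mult[symmetric] of_real_eq_iff .
    qed
    moreover have "sign_char (\<xi>' $ 2) (-1) = (-1) ^ (p + q) * sign_char (\<xi> $ 2) (-1)"
    proof -
      have "complex_of_real (sign_char (\<xi>' $ 2) (-1)) = of_real ((-1) ^ (p + q)) * of_real (sign_char (\<xi> $ 2) (-1))"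
        using key[OF flip[of 2]] unfolding prod_UNIV_3 by (simp add: three)
      then show ?thesis unfolding of_real_mult[symmetric] of_real_eq_iff .
    qed
    moreover have "sign_char (\<xi>' $ 3) (-1) = (-1) ^ q * sign_char (\<xi> $ 3) (-1)"
    proof -
      have "complex_of_real (sign_char (\<xi>' $ 3) (-1)) = of_real ((-1) ^ q) * of_real (sign_char (\<xi> $ 3) (-1))"
        using key[OF flip[of 3]] unfolding prod_UNIV_3 by (simp add: three)
      then show ?thesis unfolding of_real_mult[symmetric] of_real_eq_iff .
    qed
    ultimately show ?thesis unfolding parity_def by (blast intro: sign_char_minus_one_cancel)
  qed
  ultimately show ?thesis using that[OF sh _ _ b(2) Df] by blast
qed

text \<open>In every chart the operator is a sum over pairs \<open>(b, j)\<close>, where \<open>j\<close> is the index in the binomial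
  formula. The coefficient of a given partial derivative collects the pairs which lead to it.\<close>

lemma differential_operator_root_op:
  assumes V: "\<And>f. f \<in> V \<Longrightarrow> smooth_on f GL3" and D: "\<And>f. f \<in> V \<Longrightarrow> D f = root_op p q e f"
  shows "differential_operator V D"
  unfolding differential_operator_def
proof
  fix g :: mat3 assume g: "g \<in> GL3"
  let ?I = "\<lambda>b j. vector [p - b - j, j + b, q - b] :: nat^3"
  define c where "c \<alpha> x = (\<Sum>b\<le>min p q. \<Sum>j\<le>p - b.
      (if \<alpha> = ?I b j then e b * of_nat ((p - b) choose j) else 0) * of_real (x $ 3) ^ j)" for \<alpha> and x :: "real^3"
  have "smooth_on (c \<alpha>) UNIV" for \<alpha>
    unfolding c_def by (intro smooth_on_sum smooth_intros)
  moreover have "D f (g ** lower_unip x) =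
      (\<Sum>\<alpha>\<in>multi_indices (p + q). c \<alpha> x * multi_partial \<alpha> (\<lambda>y. f (g ** lower_unip y)) x)" if f: "f \<in> V" for f x
  proof -
    let ?M = "\<lambda>\<alpha>. multi_partial \<alpha> (chart g f) x"
    let ?k = "\<lambda>b j. e b * of_nat ((p - b) choose j) * of_real (x $ 3) ^ j"
    have mem: "?I b j \<in> multi_indices (p + q)" if "b \<le> min p q" "j \<le> p - b" for b j
      using that by (simp add: multi_indices_def sum_3)
    have "D f (g ** lower_unip x) = (\<Sum>b\<le>min p q. e b * chart g (lowering (p - b) b (q - b) f) x)"
      by (simp add: D[OF f] root_op_def chart_def)
    also have "\<dots> = (\<Sum>b\<le>min p q. \<Sum>j\<le>p - b. ?k b j * ?M (?I b j))"
      by (simp add: chart_lowering[OF V[OF f] g] sum_distrib_left mult.assoc)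
    also have "\<dots> = (\<Sum>b\<le>min p q. \<Sum>j\<le>p - b. \<Sum>\<alpha>\<in>multi_indices (p + q). if \<alpha> = ?I b j then ?k b j * ?M \<alpha> else 0)"
    proof (intro sum.cong refl)
      fix b j assume "b \<in> {..min p q}" "j \<in> {..p - b}"
      then have "?I b j \<in> multi_indices (p + q)" using mem by simp
      then show "?k b j * ?M (?I b j) = (\<Sum>\<alpha>\<in>multi_indices (p + q). if \<alpha> = ?I b j then ?k b j * ?M \<alpha> else 0)"
        by (simp only: sum.delta[OF finite_multi_indices] if_True)
    qed
    also have "\<dots> = (\<Sum>b\<le>min p q. \<Sum>\<alpha>\<in>multi_indices (p + q). \<Sum>j\<le>p - b. if \<alpha> = ?I b j then ?k b j * ?M \<alpha> else 0)"
      by (intro sum.cong refl sum.swap)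
    also have "\<dots> = (\<Sum>\<alpha>\<in>multi_indices (p + q). \<Sum>b\<le>min p q. \<Sum>j\<le>p - b. if \<alpha> = ?I b j then ?k b j * ?M \<alpha> else 0)"
      by (rule sum.swap)
    also have "\<dots> = (\<Sum>\<alpha>\<in>multi_indices (p + q). c \<alpha> x * ?M \<alpha>)"
      unfolding c_def sum_distrib_right by (intro sum.cong refl) simp
    finally show ?thesis by (simp add: chart_def)
  qed
  ultimately show "\<exists>k c. (\<forall>\<alpha>. smooth_on (c \<alpha>) UNIV) \<and> (\<forall>f\<in>V. \<forall>x. D f (g ** lower_unip x) =
      (\<Sum>\<alpha>\<in>multi_indices k. c \<alpha> x * multi_partial \<alpha> (\<lambda>y. f (g ** lower_unip y)) x))"
    by blast
qed

text \<open>The shift of the parameters and the parities give equivariance under diagonal matrices. The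
  recursions give annihilation by the two simple positive root vectors, hence by their commutator
  \<open>E 1 3\<close>, hence invariance under the whole unipotent group.\<close>

lemma root_op_principal_series:
  assumes sh: "shifted \<mu> \<mu>' p q" and par: "parity \<xi> \<xi>' p q"
    and s: "singular p q (\<mu> $ 2 - \<mu> $ 1) (\<mu> $ 3 - \<mu> $ 2) e" and f: "f \<in> principal_series \<xi> \<mu>"
  shows "root_op p q e f \<in> principal_series \<xi>' \<mu>'"
proof (rule principal_seriesI)
  have sm: "smooth_on f GL3" by (rule principal_series_smooth[OF f])
  show smo: "smooth_on (root_op p q e f) GL3" by (rule smooth_root_op[OF sm])
  show "root_op p q e f g = 0" if "g \<notin> GL3" for g by (rule root_op_outside[OF f that])
  show "root_op p q e f (g ** diag m) = (\<Prod>j\<in>UNIV. complex_of_real (sign_char (\<xi>' $ j) (m $ j))) * root_op p q e f g"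
    if g: "g \<in> GL3" and m: "\<And>j. m $ j = 1 \<or> m $ j = -1" for g m
  proof -
    have m0: "m $ j \<noteq> 0" for j using m[of j] by auto
    have x: "sign_char (\<xi>' $ 1) (m $ 1) = (m $ 1) ^ p * sign_char (\<xi> $ 1) (m $ 1)"
      "sign_char (\<xi>' $ 2) (m $ 2) = (m $ 2) ^ (p + q) * sign_char (\<xi> $ 2) (m $ 2)"
      "sign_char (\<xi>' $ 3) (m $ 3) = (m $ 3) ^ q * sign_char (\<xi> $ 3) (m $ 3)"
      using par unfolding parity_def by (auto intro!: sign_char_shift m)
    have "(\<Prod>j\<in>UNIV. complex_of_real (sign_char (\<xi>' $ j) (m $ j))) =
        of_real ((m $ 1) ^ p * (m $ 2) ^ (p + q) * (m $ 3) ^ q) * (\<Prod>j\<in>UNIV. complex_of_real (sign_char (\<xi> $ j) (m $ j)))"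
      by (simp only: UNIV_3) (simp add: x mult_ac)
    then show ?thesis
      using root_op_diag[OF sm m0 principal_series_sign[OF f _ m] g, of p q e] by (simp only: sign_ratio[where m=m, OF m])
  qed
  show "root_op p q e f (g ** diag a) = (\<Prod>j\<in>UNIV. complex_of_real (a $ j) powr (- (\<mu>' $ j))) * root_op p q e f g"
    if g: "g \<in> GL3" and a: "\<And>j. a $ j > 0" for g a
  proof -
    have a0: "a $ j \<noteq> 0" for j using a[of j] by simp
    have pn: "complex_of_real (a $ j) powr of_nat n = of_real (a $ j) ^ n" for j n
      using a0[of j] by (intro powr_nat') simp
    have ex: "- (\<mu>' $ 1) = - (\<mu> $ 1) - of_nat p" "- (\<mu>' $ 2) = - (\<mu> $ 2) + of_nat p - of_nat q"
        "- (\<mu>' $ 3) = - (\<mu> $ 3) + of_nat q"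
      using sh unfolding shifted_def by simp_all
    have "complex_of_real (a $ 1) powr (- (\<mu>' $ 1)) = of_real (a $ 1) powr (- (\<mu> $ 1)) / of_real (a $ 1) ^ p"
      "complex_of_real (a $ 2) powr (- (\<mu>' $ 2)) = of_real (a $ 2) powr (- (\<mu> $ 2)) * of_real (a $ 2) ^ p / of_real (a $ 2) ^ q"
      "complex_of_real (a $ 3) powr (- (\<mu>' $ 3)) = of_real (a $ 3) powr (- (\<mu> $ 3)) * of_real (a $ 3) ^ q"
      unfolding ex powr_diff powr_add pn by (rule refl)+
    then have "(\<Prod>j\<in>UNIV. complex_of_real (a $ j) powr (- (\<mu>' $ j))) =
        of_real ((a $ 2) ^ p * (a $ 3) ^ q / ((a $ 1) ^ p * (a $ 2) ^ q)) * (\<Prod>j\<in>UNIV. complex_of_real (a $ j) powr (- (\<mu> $ j)))"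
      by (simp only: UNIV_3) (simp add: mult_ac)
    then show ?thesis
      using root_op_diag[OF sm a0 principal_series_pos[OF f _ a] g, of p q e] by (simp only:)
  qed
  have es: "e (Suc (min p q)) = 0" using s by (simp add: singular_def)
  have "rd (E 1 2) (root_op p q e f) g = 0" for g
  proof -
    have z: "of_nat (p - b) * (\<mu> $ 2 - \<mu> $ 1 + of_nat q - of_nat p - of_nat b + 1) * e b - of_nat (Suc b) * e (Suc b) = 0"
      if "b \<le> min p q" for b
    proof -
      have "of_nat (Suc b) * e (Suc b) = of_nat (p - b) * (\<mu> $ 2 - \<mu> $ 1 + of_nat q - of_nat p - of_nat b + 1) * e b"
        using s that unfolding singular_def by blast
      then show ?thesis by (simp only: diff_self)
    qed
    show ?thesis
      unfolding raise_12_root_op[where e=e, OF f es]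
      by (rule sum.neutral, rule ballI, subst z) (simp_all only: atMost_iff mult_zero_left)
  qed
  then have r12: "rd (E 1 2) (root_op p q e f) = (\<lambda>g. 0)" by blast
  have "rd (E 2 3) (root_op p q e f) g = 0" for g
  proof -
    have z: "of_nat (q - b) * (\<mu> $ 3 - \<mu> $ 2 - of_nat q + of_nat b + 1) * e b + of_nat (Suc b) * e (Suc b) = 0"
      if "b \<le> min p q" for b
    proof -
      have "of_nat (Suc b) * e (Suc b) = - of_nat (q - b) * (\<mu> $ 3 - \<mu> $ 2 - of_nat q + of_nat b + 1) * e b"
        using s that unfolding singular_def by blast
      then show ?thesis by (simp only: mult_minus_left add.right_inverse)
    qed
    show ?thesis
      unfolding raise_23_root_op[where e=e, OF f es]
      by (rule sum.neutral, rule ballI, subst z) (simp_all only: atMost_iff mult_zero_left)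
  qed
  then have r23: "rd (E 2 3) (root_op p q e f) = (\<lambda>g. 0)" by blast
  have z: "rd X (\<lambda>g. 0) = (\<lambda>g. 0)" for X using rd_power_zero[where X=X and n=1] by simp
  have "rd (E 1 3) (root_op p q e f) g = 0" for g
    using rd_commutator[OF smo, of "E 1 2" "E 2 3" g] by (simp add: r12 r23 z E_mult)
  then have r13: "rd (E 1 3) (root_op p q e f) = (\<lambda>g. 0)" by blast
  show "root_op p q e f (g ** n) = root_op p q e f g" if "g \<in> GL3" "n \<in> upper_unip" for g n
    by (rule unip_invariant[OF smo that r12 r23 r13])
qed

lemma root_op_in_Diff_G:
  assumes "shifted \<mu> \<mu>' p q" "parity \<xi> \<xi>' p q" "singular p q (\<mu> $ 2 - \<mu> $ 1) (\<mu> $ 3 - \<mu> $ 2) e"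
  shows "(\<lambda>f. if f \<in> principal_series \<xi> \<mu> then root_op p q e f else 0) \<in> Diff_G \<xi> \<mu> \<xi>' \<mu>'"
proof -
  let ?V = "principal_series \<xi> \<mu>"
  have "differential_operator ?V (\<lambda>f. if f \<in> ?V then root_op p q e f else 0)"
    by (rule differential_operator_root_op[where p=p and q=q and e=e]) (simp_all add: principal_series_smooth)
  moreover have "root_op p q e (left_transl h f) = left_transl h (root_op p q e f)" if "h \<in> GL3" "f \<in> ?V" for h f
    using that by (simp add: root_op_def lowering_left_transl principal_series_smooth) (simp add: left_transl_def)
  ultimately show ?thesis
    unfolding Diff_G_def using root_op_principal_series[OF assms]
    by (simp add: left_transl_principal_series)
qed

lemma zero_in_Diff_G: "0 \<in> Diff_G \<xi> \<mu> \<xi>' \<mu>'"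
proof -
  have "differential_operator (principal_series \<xi> \<mu>) 0"
    by (rule differential_operator_root_op[where p=0 and q=0 and e="\<lambda>b. 0"])
       (simp_all add: principal_series_smooth root_op_def fun_eq_iff)
  moreover have "(0::mat3 \<Rightarrow> complex) \<in> principal_series \<xi>' \<mu>'"
    by (simp add: principal_series_def zero_fun_def)
  ultimately show ?thesis by (simp add: Diff_G_def left_transl_def fun_eq_iff)
qed

lemma Diff_G_nonzero_iff:
  "(\<exists>D\<in>Diff_G \<xi> \<mu> \<xi>' \<mu>'. D \<noteq> 0) \<longleftrightarrow> (\<xi>, \<xi>', \<mu>, \<mu>') \<in> Supp_D"
proof
  assume "\<exists>D\<in>Diff_G \<xi> \<mu> \<xi>' \<mu>'. D \<noteq> 0"
  then obtain D where "D \<in> Diff_G \<xi> \<mu> \<xi>' \<mu>'" "D \<noteq> 0" by blast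
  then show "(\<xi>, \<xi>', \<mu>, \<mu>') \<in> Supp_D"
    unfolding Supp_D_iff_linked using Diff_G_singular singular_imp_linked by metis
next
  assume "(\<xi>, \<xi>', \<mu>, \<mu>') \<in> Supp_D"
  then obtain p q where pq: "shifted \<mu> \<mu>' p q" "parity \<xi> \<xi>' p q" "linked p q (\<mu> $ 2 - \<mu> $ 1) (\<mu> $ 3 - \<mu> $ 2)"
    unfolding Supp_D_iff_linked by blast
  obtain e where e: "singular p q (\<mu> $ 2 - \<mu> $ 1) (\<mu> $ 3 - \<mu> $ 2) e" "e 0 = 1"
    using linked_imp_singular[OF pq(3)] by blast
  let ?D = "\<lambda>f. if f \<in> principal_series \<xi> \<mu> then root_op p q e f else 0"
  obtain f where "f \<in> principal_series \<xi> \<mu>" "root_op p q e f (mat 1) \<noteq> 0"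
    using root_op_nonzero[of 0 p q e] e(2) by auto
  then have nz: "?D f (mat 1) \<noteq> 0" by simp
  have "?D \<noteq> 0"
  proof
    assume "?D = 0"
    from fun_cong[OF fun_cong[OF this, of f], of "mat 1"] nz show False by simp
  qed
  then show "\<exists>D\<in>Diff_G \<xi> \<mu> \<xi>' \<mu>'. D \<noteq> 0" using root_op_in_Diff_G[OF pq(1,2) e(1)] by blast
qed

text \<open>The difference of the parameters determines \<open>p\<close> and \<open>q\<close>, and the initial coefficient determines the
  operator.\<close>

lemma Diff_G_proportional:
  assumes D: "D \<in> Diff_G \<xi> \<mu> \<xi>' \<mu>'" "D \<noteq> 0" and D': "D' \<in> Diff_G \<xi> \<mu> \<xi>' \<mu>'"
  shows "\<exists>c. D' = op_scale c D"
proof (cases "D' = 0")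
  case True
  then show ?thesis by (intro exI[of _ 0]) (simp add: op_scale_def fun_eq_iff)
next
  case False
  let ?V = "principal_series \<xi> \<mu>"
  obtain p q e b where e: "shifted \<mu> \<mu>' p q" "singular p q (\<mu> $ 2 - \<mu> $ 1) (\<mu> $ 3 - \<mu> $ 2) e" "e b \<noteq> 0"
    and De: "\<And>f. f \<in> ?V \<Longrightarrow> D f = root_op p q e f"
    using Diff_G_singular[OF D] by metis
  obtain p' q' e' b' where e': "shifted \<mu> \<mu>' p' q'" "singular p' q' (\<mu> $ 2 - \<mu> $ 1) (\<mu> $ 3 - \<mu> $ 2) e'"
    and De': "\<And>f. f \<in> ?V \<Longrightarrow> D' f = root_op p' q' e' f"
    using Diff_G_singular[OF D' False] by metis
  have pq: "p' = p" "q' = q" using shifted_unique[OF e(1) e'(1)] by auto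
  have e0: "e 0 \<noteq> 0" using singular_nonzero[OF e(2,3)] .
  have "e' b = (e' 0 / e 0) * e b" for b
    using singular_unique[OF e(2) e'(2)[unfolded pq], of b] e0 by (simp add: field_simps)
  then have "root_op p q e' f g = (e' 0 / e 0) * root_op p q e f g" for f g
    unfolding root_op_def sum_distrib_left by (metis (no_types, lifting) mult.assoc)
  then have "D' f g = op_scale (e' 0 / e 0) D f g" for f g
    using De De' pq Diff_G_zero_outside[OF D(1)] Diff_G_zero_outside[OF D']
    by (cases "f \<in> ?V") (simp_all add: op_scale_def)
  then show ?thesis by blast
qed

theorem theoremF:
  fixes \<xi> \<xi>' :: "bit^3" and \<mu> \<mu>' :: "complex^3"
  shows "(Diff_G \<xi> \<mu> \<xi>' \<mu>' \<noteq> {0} \<longleftrightarrow> vector_space.dim op_scale (Diff_G \<xi> \<mu> \<xi>' \<mu>') = 1) \<and>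
         (vector_space.dim op_scale (Diff_G \<xi> \<mu> \<xi>' \<mu>') = 1 \<longleftrightarrow> (\<xi>, \<xi>', \<mu>, \<mu>') \<in> Supp_D)"
proof -
  interpret vector_space op_scale by (rule vector_space_op_scale)
  have "dim (Diff_G \<xi> \<mu> \<xi>' \<mu>') = (if \<exists>D\<in>Diff_G \<xi> \<mu> \<xi>' \<mu>'. D \<noteq> 0 then 1 else 0)"
  proof (cases "\<exists>D\<in>Diff_G \<xi> \<mu> \<xi>' \<mu>'. D \<noteq> 0")
    case True
    then obtain D where D: "D \<in> Diff_G \<xi> \<mu> \<xi>' \<mu>'" "D \<noteq> 0" by blast
    have "Diff_G \<xi> \<mu> \<xi>' \<mu>' \<subseteq> span {D}"
      using Diff_G_proportional[OF D] span_scale[OF span_base[of D "{D}"]] by blast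
    then have "dim (Diff_G \<xi> \<mu> \<xi>' \<mu>') = 1"
      using D by (intro dim_unique[of "{D}"]) (auto simp: dependent_single)
    then show ?thesis using True by simp
  next
    case False
    then have "Diff_G \<xi> \<mu> \<xi>' \<mu>' \<subseteq> span {}" by auto
    then have "dim (Diff_G \<xi> \<mu> \<xi>' \<mu>') = 0"
      by (intro dim_unique[of "{}"]) (auto simp: independent_empty)
    then show ?thesis using False by simp
  qed
  then have "dim (Diff_G \<xi> \<mu> \<xi>' \<mu>') = 1 \<longleftrightarrow> (\<exists>D\<in>Diff_G \<xi> \<mu> \<xi>' \<mu>'. D \<noteq> 0)"
    by (simp only: split: if_split) simp
  moreover have "Diff_G \<xi> \<mu> \<xi>' \<mu>' \<noteq> {0} \<longleftrightarrow> (\<exists>D\<in>Diff_G \<xi> \<mu> \<xi>' \<mu>'. D \<noteq> 0)"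
  proof -
    have "A \<noteq> {0} \<longleftrightarrow> (\<exists>D\<in>A. D \<noteq> 0)" if "0 \<in> A" for A :: "((mat3 \<Rightarrow> complex) \<Rightarrow> mat3 \<Rightarrow> complex) set"
      using that by blast
    from this[OF zero_in_Diff_G] show ?thesis .
  qed
  ultimately show ?thesis unfolding Diff_G_nonzero_iff by (simp only: simp_thms)
qed

end
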